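(* For any distribution $F$ on $\mathbb{R}$ satisfying $\int_0^\infty(1-F(x))^{1/d}\,dx<\infty$, there exists a non-random finite constant $G$ such that almost surely $$G=\lim_{n\to\infty}n^{-d}G_n.$$
   Context: Fix $d\ge2$. $\{X_{\mathbf{v}}:\mathbf{v}\in\mathbb{Z}^d\}$ are independent real random variables with common distribution (function) $F$. A lattice animal is a finite non-empty connected (nearest-neighbour) set of sites $\xi\subset\mathbb{Z}^d$, with weight $S(\xi)=\sum_{\mathbf{v}\in\xi}X_{\mathbf{v}}$. $B_n=\{0,\ldots,n-1\}^d$, and $G_n=\max\{S(\xi):\xi\text{ a lattice animal},\ \xi\subseteq B_n\}$. *)

theory Defs
  imports "HOL-Probability.Probability"
begin

text \<open>
  The lattice $\mathbb{Z}^d$ is the type \<^typ>\<open>int ^ 'd\<close>, with $d$ = \<^term>\<open>CARD('d)\<close>.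
\<close>

definition nearest_neighbour :: "int ^ 'd \<Rightarrow> int ^ 'd \<Rightarrow> bool" where
  "nearest_neighbour u v \<longleftrightarrow> (\<Sum>i\<in>UNIV. \<bar>u $ i - v $ i\<bar>) = 1"

definition lattice_connected :: "(int ^ 'd) set \<Rightarrow> bool" where
  "lattice_connected \<xi> \<longleftrightarrow>
     (\<forall>u\<in>\<xi>. \<forall>v\<in>\<xi>. (\<lambda>a b. a \<in> \<xi> \<and> b \<in> \<xi> \<and> nearest_neighbour a b)\<^sup>*\<^sup>* u v)"

definition lattice_animal :: "(int ^ 'd) set \<Rightarrow> bool" where
  "lattice_animal \<xi> \<longleftrightarrow> finite \<xi> \<and> \<xi> \<noteq> {} \<and> lattice_connected \<xi>"

definition weight :: "(int ^ 'd \<Rightarrow> real) \<Rightarrow> (int ^ 'd) set \<Rightarrow> real" where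
  "weight x \<xi> = (\<Sum>v\<in>\<xi>. x v)"

definition lattice_box :: "nat \<Rightarrow> (int ^ 'd) set" where
  "lattice_box n = {v. \<forall>i. 0 \<le> v $ i \<and> v $ i < int n}"

text \<open>
  The maximum is over a finite set, non-empty for $n \ge 1$.  For $n = 0$ the box is empty and the
  value is unspecified, which does not affect limits as $n \to \infty$.
\<close>

definition greedy_weight :: "(int ^ 'd \<Rightarrow> real) \<Rightarrow> nat \<Rightarrow> real" where
  "greedy_weight x n = Max {weight x \<xi> | \<xi>. lattice_animal \<xi> \<and> \<xi> \<subseteq> lattice_box n}"

end

theory Submission
  imports Defs
begin

text \<open>
  Nothing is assumed about the lower tail of the weights, so animals in neighbouring boxes cannot be
  joined at a bounded cost along arbitrary sites.  The proof joins them only through sites of weight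
  at least \<open>-K\<close>, for a large constant \<open>K\<close>, which are organised as follows.  The cells of scale \<open>j\<close>
  are the triadic cubes of side \<open>3^j\<close>.  A cell of scale \<open>0\<close> is good if its weight is at least \<open>-K\<close>, and
  a cell of scale \<open>j + 1\<close> is good if at most one of its \<open>3^d\<close> children is bad.  The cluster of a cell
  is what remains of it when the bad cells are removed at all smaller scales.  Because \<open>d \<ge> 2\<close>, a cube
  of side 3 without one point is connected, and among the at least three pairs of adjacent children
  across a common face of two good cells, one pair is good.  So the clusters of adjacent good cells
  touch (\<open>cluster_crossing\<close>), and any two points of a cluster of scale \<open>j\<close> can be joined inside it by
  at most \<open>(3^d - 1)^j\<close> sites (\<open>cluster_joined\<close>), a number of smaller order than the volume \<open>3^(d j)\<close>.
  Distinct children are independent, so the probability \<open>p\<^sub>j\<close> of being bad satisfies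
  \<open>p\<^bsub>j+1\<^esub> \<le> 9^d p\<^sub>j\<^sup>2\<close>; it is summable, with a small sum, once \<open>K\<close> is large.

  The score of a cell is the largest weight of an animal in it that hits its cluster (or 0).  Joining
  the best animals of the children shows that the score is superadditive over children up to an error
  which, relative to the volume, has a summable expectation (\<open>cell_score_Suc\<close>).  For such a
  functional the density \<open>\<phi>\<^sub>j\<close> converges almost surely (\<open>cell_functional_converges\<close>): its mean
  increases up to a summable error, and \<open>\<phi>\<^bsub>j+1\<^esub>\<close> is an average of \<open>3^d\<close> independent copies of \<open>\<phi>\<^sub>j\<close> plus a
  remainder whose first absolute moments telescope to a finite sum.  Averaging contracts the
  variance, so the variances are summable.

  If the weights are at most \<open>M\<close>, an animal that misses all clusters has a weight of at most
  \<open>M\<close> times the number of sites outside the clusters, a small proportion of the volume; every other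
  animal is accounted for by the scores.  This determines the density of the greedy weight in cubes
  of side \<open>s 3^j\<close>, and by monotonicity in all cubes, up to an error that vanishes as \<open>K\<close> grows
  (\<open>greedy_weight_density\<close>).  Clipping the weights at \<open>M\<close> changes the greedy weight by at most the sum of
  \<open>max (X - M) 0\<close> over the box.  The hypothesis on \<open>F\<close> makes the positive part of the weights
  square integrable (\<open>square_integrable_positive_part\<close>), so Chebyshev's inequality controls that sum.
  Hence, for every \<open>\<epsilon>\<close>, the density eventually stays within \<open>\<epsilon>\<close> of a constant, and these
  constants converge to \<open>G\<close>.  The argument takes place on the product space of copies of
  \<open>F\<close>, to which every independent field with marginals \<open>F\<close> is transferred; so \<open>G\<close>
  depends on \<open>F\<close> alone.
\<close>

section \<open>Connected sets of sites\<close>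

abbreviation step_within :: "(int ^ 'd) set \<Rightarrow> int ^ 'd \<Rightarrow> int ^ 'd \<Rightarrow> bool" where
  "step_within A \<equiv> \<lambda>a b. a \<in> A \<and> b \<in> A \<and> nearest_neighbour a b"

lemma nearest_neighbour_commute: "nearest_neighbour u v \<longleftrightarrow> nearest_neighbour v u"
  unfolding nearest_neighbour_def by (simp add: abs_minus_commute)

lemma nearest_neighbour_add_axis:
  fixes v :: "int ^ 'd"
  assumes "\<bar>t\<bar> = 1"
  shows "nearest_neighbour v (v + axis i t)"
proof -
  have "(\<Sum>k\<in>UNIV. \<bar>v $ k - (v + axis i t) $ k\<bar>) = (\<Sum>k\<in>UNIV. if k = i then \<bar>t\<bar> else 0)"
    by (rule sum.cong) (auto simp: axis_def)
  then show ?thesis using assms by (simp add: nearest_neighbour_def)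
qed

lemma nearest_neighbour_cases:
  fixes u v :: "int ^ 'd"
  assumes "nearest_neighbour u v"
  obtains i t where "\<bar>t\<bar> = 1" "v = u + axis i t"
proof -
  have s: "(\<Sum>k\<in>UNIV. \<bar>u $ k - v $ k\<bar>) = 1"
    using assms by (simp add: nearest_neighbour_def)
  have "\<exists>i. u $ i \<noteq> v $ i"
  proof (rule ccontr)
    assume "\<not> ?thesis"
    then show False using s by simp
  qed
  then obtain i where i: "\<bar>u $ i - v $ i\<bar> \<noteq> 0" by auto
  have split: "(\<Sum>k\<in>UNIV. \<bar>u $ k - v $ k\<bar>) = \<bar>u $ i - v $ i\<bar> + (\<Sum>k\<in>UNIV - {i}. \<bar>u $ k - v $ k\<bar>)"
    by (simp add: sum.remove)
  have nn: "(\<Sum>k\<in>UNIV - {i}. \<bar>u $ k - v $ k\<bar>) \<ge> 0"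
    by (simp add: sum_nonneg)
  have one: "\<bar>u $ i - v $ i\<bar> = 1" and z: "(\<Sum>k\<in>UNIV - {i}. \<bar>u $ k - v $ k\<bar>) = 0"
    using s split nn i by linarith+
  have "v $ k = u $ k" if "k \<noteq> i" for k
    using z that by (subst (asm) sum_nonneg_eq_0_iff) auto
  then have "v = u + axis i (v $ i - u $ i)"
    by (auto simp: vec_eq_iff axis_def)
  moreover have "\<bar>v $ i - u $ i\<bar> = 1" using one by (simp add: abs_minus_commute)
  ultimately show ?thesis using that by blast
qed

lemma step_within_mono:
  assumes "(step_within A)\<^sup>*\<^sup>* u v" "A \<subseteq> B"
  shows "(step_within B)\<^sup>*\<^sup>* u v"
  using assms(1) by (rule rtranclp_mono[THEN predicate2D, rotated]) (use assms(2) in auto)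

lemma step_within_sym:
  assumes "(step_within A)\<^sup>*\<^sup>* u v"
  shows "(step_within A)\<^sup>*\<^sup>* v u"
proof -
  have "symp (step_within A)"
    by (auto simp: symp_def nearest_neighbour_commute)
  from symp_rtranclp[OF this] show ?thesis using assms by (rule sympD)
qed

lemma lattice_connected_rootI:
  assumes "\<And>a. a \<in> A \<Longrightarrow> (step_within A)\<^sup>*\<^sup>* a r"
  shows "lattice_connected A"
  unfolding lattice_connected_def
proof (intro ballI)
  fix u v assume "u \<in> A" "v \<in> A"
  from assms[OF this(1)] step_within_sym[OF assms[OF this(2)]]
  show "(step_within A)\<^sup>*\<^sup>* u v" by (rule rtranclp_trans)
qed

lemma lattice_connected_singleton [simp]: "lattice_connected {a}"
  by (simp add: lattice_connected_def)

lemma lattice_connected_Un: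
  assumes A: "lattice_connected A" and B: "lattice_connected B"
    and link: "a \<in> A" "b \<in> B" "a = b \<or> nearest_neighbour a b"
  shows "lattice_connected (A \<union> B)"
proof (rule lattice_connected_rootI[where r = a])
  fix c assume "c \<in> A \<union> B"
  have "(step_within (A \<union> B))\<^sup>*\<^sup>* b a"
    using link by (auto simp: nearest_neighbour_commute intro: r_into_rtranclp)
  moreover have "(step_within (A \<union> B))\<^sup>*\<^sup>* c a" if "c \<in> A"
    using A that link step_within_mono[of A c a "A \<union> B"] by (auto simp: lattice_connected_def)
  moreover have "(step_within (A \<union> B))\<^sup>*\<^sup>* c b" if "c \<in> B"
    using B that link step_within_mono[of B c b "A \<union> B"] by (auto simp: lattice_connected_def)
  ultimately show "(step_within (A \<union> B))\<^sup>*\<^sup>* c a"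
    using \<open>c \<in> A \<union> B\<close> by (blast intro: rtranclp_trans)
qed

text \<open>
  Adding to a connected set any sites adjacent to it keeps it connected, whatever the added sites look like among themselves.
\<close>

lemma lattice_connected_extend:
  assumes A: "lattice_connected A" "A \<subseteq> T" "A \<noteq> {}"
    and touch: "\<And>c. c \<in> T - A \<Longrightarrow> \<exists>b\<in>A. nearest_neighbour c b"
  shows "lattice_connected T"
proof -
  obtain r where r: "r \<in> A" using A by auto
  show ?thesis
  proof (rule lattice_connected_rootI[where r = r])
    fix c assume c: "c \<in> T"
    have *: "(step_within T)\<^sup>*\<^sup>* b r" if "b \<in> A" for b
      using A r that step_within_mono[of A b r T] by (auto simp: lattice_connected_def)
    show "(step_within T)\<^sup>*\<^sup>* c r"
    proof (cases "c \<in> A")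
      case False
      then obtain b where "b \<in> A" "nearest_neighbour c b" using touch c by auto
      then have "step_within T c b" using c A by auto
      then show ?thesis using *[OF \<open>b \<in> A\<close>] by (rule converse_rtranclp_into_rtranclp)
    qed (use * in auto)
  qed
qed

lemma lattice_connected_star:
  assumes T: "lattice_connected T"
    and arms: "\<And>i. i \<in> I \<Longrightarrow> lattice_connected (\<xi> i)" "\<And>i. i \<in> I \<Longrightarrow> \<xi> i \<inter> T \<noteq> {}"
  shows "lattice_connected (T \<union> (\<Union>i\<in>I. \<xi> i))"
proof (cases "T = {}")
  case True
  then have "I = {}" using arms by auto
  then show ?thesis using T by simp
next
  case False
  then obtain r where r: "r \<in> T" by auto
  let ?U = "T \<union> (\<Union>i\<in>I. \<xi> i)"
  show ?thesis
  proof (rule lattice_connected_rootI[where r = r])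
    fix c assume c: "c \<in> ?U"
    have *: "(step_within ?U)\<^sup>*\<^sup>* b r" if "b \<in> T" for b
      using T r that step_within_mono[of T b r ?U] by (auto simp: lattice_connected_def)
    show "(step_within ?U)\<^sup>*\<^sup>* c r"
    proof (cases "c \<in> T")
      case False
      then obtain i where i: "i \<in> I" "c \<in> \<xi> i" using c by auto
      obtain b where b: "b \<in> \<xi> i" "b \<in> T" using arms(2)[OF i(1)] by auto
      have "(step_within (\<xi> i))\<^sup>*\<^sup>* c b"
        using arms(1)[OF i(1)] i b by (auto simp: lattice_connected_def)
      then have "(step_within ?U)\<^sup>*\<^sup>* c b"
        using i by (elim step_within_mono) auto
      then show ?thesis using *[OF b(2)] by (rule rtranclp_trans)
    qed (use * in auto)
  qed
qed

text \<open>
  Used to enumerate a connected set one site at a time: as long as some sites are missing, one of them is adjacent to the sites already reached.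
\<close>

lemma lattice_connected_boundary_edge:
  assumes "lattice_connected A" "S \<subseteq> A" "S \<noteq> {}" "S \<noteq> A"
  obtains a b where "a \<in> S" "b \<in> A - S" "nearest_neighbour a b"
proof -
  obtain s t where s: "s \<in> S" and t: "t \<in> A" "t \<notin> S" using assms by auto
  have "(step_within A)\<^sup>*\<^sup>* s t" using assms s t by (auto simp: lattice_connected_def)
  then have "t \<notin> S \<longrightarrow> (\<exists>a\<in>S. \<exists>b\<in>A - S. nearest_neighbour a b)"
    by (induction rule: rtranclp_induct) (use s in auto)
  then show ?thesis using t that by auto
qed

text \<open>
  Between two points of the box, moving one coordinate that still differs one step towards its target never leaves the box and decreases the \<open>\<ell>\<^sup>1\<close> distance.
\<close>

lemma lattice_connected_interval:
  fixes l u :: "int ^ 'd"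
  shows "lattice_connected {v. \<forall>i. l $ i \<le> v $ i \<and> v $ i \<le> u $ i}" (is "lattice_connected ?B")
proof -
  have "(step_within ?B)\<^sup>*\<^sup>* a b" if "a \<in> ?B" "b \<in> ?B" for a b
    using that
  proof (induction "nat (\<Sum>i\<in>UNIV. \<bar>a $ i - b $ i\<bar>)" arbitrary: a rule: less_induct)
    case less
    show ?case
    proof (cases "a = b")
      case False
      then obtain i where i: "a $ i \<noteq> b $ i" by (auto simp: vec_eq_iff)
      define a' where "a' = a + axis i (sgn (b $ i - a $ i))"
      have nb: "nearest_neighbour a a'"
        unfolding a'_def using i by (intro nearest_neighbour_add_axis) (auto simp: sgn_if)
      have a': "a' $ k = (if k = i then a $ k + sgn (b $ i - a $ i) else a $ k)" for k
        by (auto simp: a'_def axis_def)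
      have mem: "a' \<in> ?B"
      proof safe
        fix k
        have "l $ k \<le> a $ k" "a $ k \<le> u $ k" "l $ k \<le> b $ k" "b $ k \<le> u $ k"
          using less.prems by auto
        then show "l $ k \<le> a' $ k" "a' $ k \<le> u $ k"
          using i by (auto simp: a' sgn_if)
      qed
      have "(\<Sum>k\<in>UNIV. \<bar>a' $ k - b $ k\<bar>) < (\<Sum>k\<in>UNIV. \<bar>a $ k - b $ k\<bar>)"
        by (rule sum_strict_mono_ex1) (use i in \<open>auto simp: a' sgn_if intro!: exI[of _ i]\<close>)
      moreover have "0 \<le> (\<Sum>k\<in>UNIV. \<bar>a' $ k - b $ k\<bar>)" by (simp add: sum_nonneg)
      ultimately have "nat (\<Sum>k\<in>UNIV. \<bar>a' $ k - b $ k\<bar>) < nat (\<Sum>k\<in>UNIV. \<bar>a $ k - b $ k\<bar>)"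
        by (subst nat_mono_iff) linarith+
      then have "(step_within ?B)\<^sup>*\<^sup>* a' b"
        by (rule less.hyps) (use mem less.prems in auto)
      then show ?thesis
        using nb mem less.prems by (intro converse_rtranclp_into_rtranclp[of _ a a']) auto
    qed simp
  qed
  then show ?thesis by (simp add: lattice_connected_def)
qed

lemma lattice_connected_box: "lattice_connected (lattice_box n :: (int ^ 'd) set)"
proof -
  have "lattice_box n = {v :: int ^ 'd. \<forall>i. 0 $ i \<le> v $ i \<and> v $ i \<le> (\<chi> i. int n - 1) $ i}"
    by (auto simp: lattice_box_def)
  then show ?thesis by (simp only: lattice_connected_interval)
qed

text \<open>
  Cut the cube into three slabs along some coordinate \<open>i\<close>.  The slabs that do not contain \<open>r\<close> are full
  boxes.  Every site of the slab of \<open>r\<close> is adjacent to another slab.  If \<open>r\<close> lies in the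
  middle slab, the two outer slabs are linked through any site of the middle one other than \<open>r\<close>, and
  such a site exists because there is a second coordinate.
\<close>

lemma lattice_connected_cube3_minus_point:
  fixes l r :: "int ^ 'd"
  assumes d: "CARD('d) \<ge> 2" and r: "\<And>i. l $ i \<le> r $ i \<and> r $ i \<le> l $ i + 2"
  shows "lattice_connected ({v. \<forall>i. l $ i \<le> v $ i \<and> v $ i \<le> l $ i + 2} - {r})" 
    (is "lattice_connected (?B - {r})")
proof -
  have "\<not> CARD('d) \<le> Suc 0" using d by simp
  then obtain i k :: 'd where ik: "i \<noteq> k"
    by (auto simp: card_le_Suc0_iff_eq)
  define slab where "slab s t = {v. \<forall>m. (\<chi> m. l $ m + (if m = i then s else 0)) $ m \<le> v $ m
      \<and> v $ m \<le> (\<chi> m. l $ m + (if m = i then t else 2)) $ m}" for s t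
  have slab: "lattice_connected (slab s t)" for s t
    unfolding slab_def by (rule lattice_connected_interval)
  have slab_iff: "v \<in> slab s t \<longleftrightarrow> v \<in> ?B \<and> l $ i + s \<le> v $ i \<and> v $ i \<le> l $ i + t"
    if "0 \<le> s" "t \<le> 2" for v s t
  proof
    assume v: "v \<in> slab s t"
    then have *: "l $ m + (if m = i then s else 0) \<le> v $ m \<and> v $ m \<le> l $ m + (if m = i then t else 2)" for m
      by (simp add: slab_def)
    have "l $ m \<le> v $ m \<and> v $ m \<le> l $ m + 2" for m
      using *[of m] that by (cases "m = i") auto
    then show "v \<in> ?B \<and> l $ i + s \<le> v $ i \<and> v $ i \<le> l $ i + t"
      using *[of i] by simp
  qed (auto simp: slab_def)
  have r': "r $ i = l $ i \<or> r $ i = l $ i + 1 \<or> r $ i = l $ i + 2" using r[of i] by auto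
  have slabI: "v + axis i t \<in> slab a b"
    if "v \<in> ?B" "l $ i + a \<le> v $ i + t" "v $ i + t \<le> l $ i + b" "0 \<le> a" "b \<le> 2" for v t a b
  proof -
    have "l $ m \<le> (v + axis i t) $ m \<and> (v + axis i t) $ m \<le> l $ m + 2" for m
      using that by (cases "m = i") (auto simp: axis_def)
    then show ?thesis using that by (subst slab_iff) (auto simp: axis_def)
  qed
  have spec_i: "c $ i = l $ i \<or> c $ i = l $ i + 1 \<or> c $ i = l $ i + 2" if "c \<in> ?B" for c
    using that by (auto dest!: spec[of _ i])
  have base: "slab s t \<noteq> {}" if "0 \<le> s" "s \<le> t" "t \<le> 2" for s t
    using slabI[of l s s t] that by auto
  from r' show ?thesis
  proof (elim disjE)
    assume ri: "r $ i = l $ i"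
    show ?thesis
    proof (rule lattice_connected_extend[OF slab[of 1 2]])
      show "slab 1 2 \<subseteq> ?B - {r}" using ri by (auto simp: slab_iff)
      fix c assume "c \<in> ?B - {r} - slab 1 2"
      then have "c \<in> ?B" "c $ i = l $ i" using slab_iff[of 1 2 c] spec_i[of c] by auto
      then show "\<exists>b\<in>slab 1 2. nearest_neighbour c b"
        by (intro bexI[of _ "c + axis i 1"] nearest_neighbour_add_axis slabI) auto
    qed (use base[of 1 2] in auto)
  next
    assume ri: "r $ i = l $ i + 2"
    show ?thesis
    proof (rule lattice_connected_extend[OF slab[of 0 1]])
      show "slab 0 1 \<subseteq> ?B - {r}" using ri by (auto simp: slab_iff)
      fix c assume "c \<in> ?B - {r} - slab 0 1"
      then have "c \<in> ?B" "c $ i = l $ i + 2" using slab_iff[of 0 1 c] spec_i[of c] by auto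
      then show "\<exists>b\<in>slab 0 1. nearest_neighbour c b"
        by (intro bexI[of _ "c + axis i (-1)"] nearest_neighbour_add_axis slabI) auto
    qed (use base[of 0 1] in auto)
  next
    assume ri: "r $ i = l $ i + 1"
    \<comment> \<open>A site of the middle slab that differs from \<open>r\<close> in coordinate \<open>k\<close>.\<close>
    define a where "a = (\<chi> m. if m = i then l $ i + 1 else if m = k then (if r $ k = l $ k then l $ k + 1 else l $ k) else l $ m)"
    have a: "a \<in> ?B" "a \<noteq> r" "a $ i = l $ i + 1"
      using ik by (auto simp: a_def vec_eq_iff intro!: exI[of _ k])
    have nn: "nearest_neighbour a (a + axis i (-1))" "nearest_neighbour a (a + axis i 1)"
      by (auto intro: nearest_neighbour_add_axis)
    have "lattice_connected ({a} \<union> slab 0 0)"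
      by (rule lattice_connected_Un[OF _ slab _ slabI]) (use a nn(1) in auto)
    then have "lattice_connected (({a} \<union> slab 0 0) \<union> slab 2 2)"
      by (rule lattice_connected_Un[OF _ slab _ slabI]) (use a nn(2) in auto)
    then show ?thesis
    proof (rule lattice_connected_extend)
      show "{a} \<union> slab 0 0 \<union> slab 2 2 \<subseteq> ?B - {r}" using ri a by (auto simp: slab_iff)
      fix c assume "c \<in> ?B - {r} - ({a} \<union> slab 0 0 \<union> slab 2 2)"
      then have "c \<in> ?B" "c $ i = l $ i + 1" using slab_iff[of 0 0 c] slab_iff[of 2 2 c] spec_i[of c] by auto
      then show "\<exists>b\<in>{a} \<union> slab 0 0 \<union> slab 2 2. nearest_neighbour c b"
        by (intro bexI[of _ "c + axis i 1"] nearest_neighbour_add_axis UnI2 slabI) auto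
    qed auto
  qed
qed

section \<open>Triadic cells\<close>

text \<open>
  Division rounds down, also for negative coordinates, so the cells of each scale tile the lattice and are unions of cells of the previous scale.
\<close>

definition cell :: "nat \<Rightarrow> int ^ 'd \<Rightarrow> (int ^ 'd) set" where
  "cell j z = {v. \<forall>i. v $ i div 3 ^ j = z $ i}"

text \<open>
  The upper bound is written with \<open>\<le>\<close> so that cells are boxes in the sense of \<open>lattice_connected_interval\<close>.
\<close>

lemma int_div_eq_iff:
  fixes a b q :: int
  assumes "0 < b"
  shows "a div b = q \<longleftrightarrow> b * q \<le> a \<and> a \<le> b * q + (b - 1)"
proof
  assume "a div b = q"
  moreover have "b * (a div b) + a mod b = a" "0 \<le> a mod b" "a mod b < b"
    using assms by auto
  ultimately show "b * q \<le> a \<and> a \<le> b * q + (b - 1)" by auto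
next
  assume "b * q \<le> a \<and> a \<le> b * q + (b - 1)"
  then show "a div b = q" by (intro int_div_pos_eq[of a b q "a - b * q"]) auto
qed

lemma cell_conv_interval:
  "cell j z = {v. \<forall>i. 3 ^ j * z $ i \<le> v $ i \<and> v $ i \<le> 3 ^ j * z $ i + (3 ^ j - 1)}"
  unfolding cell_def by (subst int_div_eq_iff) auto

lemma cell_0 [simp]: "cell 0 z = {z}"
  by (auto simp: cell_def vec_eq_iff)

lemma cell_disjoint: "z \<noteq> z' \<Longrightarrow> cell j z \<inter> cell j z' = {}"
  by (auto simp: cell_def vec_eq_iff)

lemma cell_add: "cell (j + r) z = (\<Union>c\<in>cell r z. cell j c)"
proof -
  have "v \<in> cell (j + r) z \<longleftrightarrow> (\<chi> i. v $ i div 3 ^ j) \<in> cell r z" for v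
    by (simp add: cell_def power_add zdiv_zmult2_eq)
  moreover have "v \<in> cell j c \<longleftrightarrow> c = (\<chi> i. v $ i div 3 ^ j)" for v c
    by (auto simp: cell_def vec_eq_iff)
  ultimately show ?thesis by auto
qed

lemma cell_Suc: "cell (Suc j) z = (\<Union>c\<in>cell 1 z. cell j c)"
  using cell_add[of j 1 z] by simp

lemma finite_card_integer_box:
  fixes l :: "int ^ 'd"
  shows "finite {v. \<forall>i. l $ i \<le> v $ i \<and> v $ i < l $ i + int n}" (is "finite ?B")
    and "card {v. \<forall>i. l $ i \<le> v $ i \<and> v $ i < l $ i + int n} = n ^ CARD('d)"
proof -
  let ?P = "PiE UNIV (\<lambda>i. {l $ i..<l $ i + int n})"
  have "bij_betw vec_nth ?B ?P"
    by (rule bij_betw_byWitness[where f' = vec_lambda]) (auto simp: PiE_iff)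
  moreover have "finite ?P" by (intro finite_PiE) auto
  moreover have "card ?P = n ^ CARD('d)" by (simp add: card_PiE)
  ultimately show "finite ?B" "card ?B = n ^ CARD('d)"
    by (auto simp: bij_betw_finite bij_betw_same_card)
qed

lemma finite_lattice_box [simp]: "finite (lattice_box n :: (int ^ 'd) set)"
  and card_lattice_box: "card (lattice_box n :: (int ^ 'd) set) = n ^ CARD('d)"
  using finite_card_integer_box[of "0 :: int ^ 'd" n] by (simp_all add: lattice_box_def)

lemma finite_cell [simp]: "finite (cell j z)"
  and card_cell: "card (cell j z :: (int ^ 'd) set) = (3 ^ CARD('d)) ^ j"
proof -
  have "cell j z = {v. \<forall>i. (\<chi> i. 3 ^ j * z $ i) $ i \<le> v $ i \<and> v $ i < (\<chi> i. 3 ^ j * z $ i) $ i + int (3 ^ j)}"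
  proof -
    have "a \<le> b + (c - 1) \<longleftrightarrow> a < b + c" for a b c :: int by auto
    then show ?thesis by (simp add: cell_conv_interval)
  qed
  with finite_card_integer_box[of "\<chi> i. 3 ^ j * z $ i" "3 ^ j"]
  show "finite (cell j z)" "card (cell j z) = (3 ^ CARD('d)) ^ j"
    by (simp_all add: power_mult[symmetric] mult.commute)
qed

lemma lattice_box_conv_cells: "lattice_box (s * 3 ^ j) = (\<Union>z\<in>lattice_box s. cell j z)"
proof -
  have "v \<in> lattice_box (s * 3 ^ j) \<longleftrightarrow> (\<chi> i. v $ i div 3 ^ j) \<in> lattice_box s" for v :: "int ^ 'd"
  proof -
    have "v $ i div 3 ^ j < int s \<longleftrightarrow> v $ i < int s * 3 ^ j" for i
    proof -
      let ?q = "v $ i div 3 ^ j"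
      have q: "3 ^ j * ?q \<le> v $ i" "v $ i \<le> 3 ^ j * ?q + (3 ^ j - 1)"
        using int_div_eq_iff[of "3 ^ j" "v $ i" ?q] by auto
      show ?thesis
      proof (cases "?q < int s")
        case True
        then have "3 ^ j * (?q + 1) \<le> 3 ^ j * int s" by (intro mult_left_mono) auto
        then show ?thesis using q True by (simp add: algebra_simps)
      next
        case False
        then have "3 ^ j * int s \<le> 3 ^ j * ?q" by (intro mult_left_mono) auto
        then have "int s * 3 ^ j \<le> v $ i" using q by (simp only: mult.commute)
        then show ?thesis using False by simp
      qed
    qed
    then show ?thesis
      by (simp add: lattice_box_def pos_imp_zdiv_nonneg_iff)
  qed
  moreover have "v \<in> cell j c \<longleftrightarrow> c = (\<chi> i. v $ i div 3 ^ j)" for v c :: "int ^ 'd"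
    by (auto simp: cell_def vec_eq_iff)
  ultimately show ?thesis by auto
qed

lemma cell_at_origin: "cell j 0 = (lattice_box (3 ^ j) :: (int ^ 'd) set)"
proof -
  have "v = 0" if "v \<in> lattice_box 1" for v :: "int ^ 'd"
  proof -
    have "v $ i = 0" for i
    proof -
      have "0 \<le> v $ i \<and> v $ i < 1" using that by (simp add: lattice_box_def)
      then show ?thesis by linarith
    qed
    then show ?thesis by (simp add: vec_eq_iff)
  qed
  moreover have "0 \<in> (lattice_box 1 :: (int ^ 'd) set)" by (simp add: lattice_box_def)
  ultimately have "lattice_box 1 = {0 :: int ^ 'd}" by blast
  moreover have "(lattice_box (1 * 3 ^ j) :: (int ^ 'd) set) = (\<Union>z\<in>lattice_box 1. cell j z)"
    by (rule lattice_box_conv_cells)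
  ultimately show ?thesis by (simp del: One_nat_def)
qed

lemma lattice_connected_cell_1: "lattice_connected (cell 1 z)"
  using lattice_connected_interval[of "\<chi> i. 3 * z $ i" "\<chi> i. 3 * z $ i + 2"]
  by (simp add: cell_conv_interval)

lemma lattice_connected_cell_1_minus:
  fixes z :: "int ^ 'd"
  assumes "CARD('d) \<ge> 2" "r \<in> cell 1 z"
  shows "lattice_connected (cell 1 z - {r})"
  using lattice_connected_cube3_minus_point[of "\<chi> i. 3 * z $ i" r] assms
  by (simp add: cell_conv_interval)

section \<open>Good cells and their clusters\<close>

text \<open>
  Goodness tolerates one bad child: then the probability of being bad is at most quadratic in that of
  the previous scale, while the good children still form a connected set.
\<close>

primrec good :: "real \<Rightarrow> (int ^ 'd \<Rightarrow> real) \<Rightarrow> nat \<Rightarrow> int ^ 'd \<Rightarrow> bool" where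
  "good K x 0 z \<longleftrightarrow> - K \<le> x z"
| "good K x (Suc j) z \<longleftrightarrow> card {c \<in> cell 1 z. \<not> good K x j c} \<le> 1"

primrec cluster :: "real \<Rightarrow> (int ^ 'd \<Rightarrow> real) \<Rightarrow> nat \<Rightarrow> int ^ 'd \<Rightarrow> (int ^ 'd) set" where
  "cluster K x 0 z = {z}"
| "cluster K x (Suc j) z = (\<Union>c\<in>{c \<in> cell 1 z. good K x j c}. cluster K x j c)"

lemma good_Suc_unique_bad:
  assumes "good K x (Suc j) z" "a \<in> cell 1 z" "b \<in> cell 1 z" "\<not> good K x j a" "\<not> good K x j b"
  shows "a = b"
proof -
  have "finite {c \<in> cell 1 z. \<not> good K x j c}" by simp
  with assms show ?thesis by (auto simp: card_le_Suc0_iff_eq)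
qed

lemma cluster_subset_cell: "cluster K x j z \<subseteq> cell j z"
proof (induction j arbitrary: z)
  case (Suc j)
  then show ?case unfolding cell_Suc by auto
qed auto

lemma finite_cluster [simp]: "finite (cluster K x j z)"
  using cluster_subset_cell finite_subset finite_cell by metis

lemma cluster_bounded_below:
  "good K x j z \<Longrightarrow> v \<in> cluster K x j z \<Longrightarrow> - K \<le> x v"
proof (induction j arbitrary: z)
  case (Suc j)
  then obtain c where "good K x j c" "v \<in> cluster K x j c" by auto
  then show ?case by (rule Suc.IH)
qed auto

lemma card_cell_1_ge:
  fixes z :: "int ^ 'd"
  assumes "CARD('d) \<ge> 2"
  shows "card (cell 1 z) \<ge> 9"
proof -
  have "(3::nat) ^ 2 \<le> 3 ^ CARD('d)" using assms by (intro power_increasing) auto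
  then show ?thesis by (simp add: card_cell)
qed

lemma exists_good_child:
  fixes z :: "int ^ 'd"
  assumes d: "CARD('d) \<ge> 2" and g: "good K x (Suc j) z"
  shows "\<exists>c\<in>cell 1 z. good K x j c"
proof (rule ccontr)
  assume "\<not> ?thesis"
  then have "{c \<in> cell 1 z. \<not> good K x j c} = cell 1 z" by auto
  then show False using g card_cell_1_ge[OF d, of z] by simp
qed

lemma cluster_nonempty:
  fixes z :: "int ^ 'd"
  assumes d: "CARD('d) \<ge> 2"
  shows "good K x j z \<Longrightarrow> cluster K x j z \<noteq> {}"
proof (induction j arbitrary: z)
  case (Suc j)
  obtain c where "c \<in> cell 1 z" "good K x j c" using exists_good_child[OF d Suc.prems] by auto
  then show ?case using Suc.IH[of c] by auto
qed auto

lemma lattice_connected_good_children: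
  fixes z :: "int ^ 'd"
  assumes d: "CARD('d) \<ge> 2" and g: "good K x (Suc j) z"
  shows "lattice_connected {c \<in> cell 1 z. good K x j c}"
proof (cases "\<exists>r\<in>cell 1 z. \<not> good K x j r")
  case True
  then obtain r where r: "r \<in> cell 1 z" "\<not> good K x j r" by auto
  then have "{c \<in> cell 1 z. good K x j c} = cell 1 z - {r}"
    using good_Suc_unique_bad[OF g] by auto
  then show ?thesis using lattice_connected_cell_1_minus[OF d r(1)] by simp
next
  case False
  then have "{c \<in> cell 1 z. good K x j c} = cell 1 z" by auto
  then show ?thesis by (simp only: lattice_connected_cell_1)
qed

lemma other_coordinate:
  fixes i :: "'d::finite"
  assumes "CARD('d) \<ge> 2"
  obtains k :: 'd where "k \<noteq> i"
proof -
  have "\<not> CARD('d) \<le> Suc 0" using assms by simp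
  then obtain a b :: 'd where "a \<noteq> b" by (auto simp: card_le_Suc0_iff_eq)
  then show ?thesis using that[of a] that[of b] by (cases "a = i") auto
qed

text \<open>
  Across the common face there are at least three disjoint pairs of adjacent children.  Each of the two
  cells spoils at most one pair, so in some pair both children are good, and the induction
  hypothesis applies to that pair.
\<close>

lemma cluster_crossing_axis:
  fixes z :: "int ^ 'd"
  assumes d: "CARD('d) \<ge> 2"
  shows "good K x j z \<Longrightarrow> good K x j (z + axis i 1) \<Longrightarrow>
    \<exists>p\<in>cluster K x j z. \<exists>q\<in>cluster K x j (z + axis i 1). nearest_neighbour p q"
proof (induction j arbitrary: z)
  case 0
  then show ?case by (auto intro: nearest_neighbour_add_axis)
next
  case (Suc j)
  obtain k where k: "k \<noteq> i" using other_coordinate[OF d] by blast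
  \<comment> \<open>Three children on the face towards \<open>z + axis i 1\<close>, numbered by coordinate \<open>k\<close>.\<close>
  define f where "f t = (\<chi> m. if m = i then 3 * z $ i + 2 else if m = k then 3 * z $ k + t else 3 * z $ m)" for t
  have f1: "f t \<in> cell 1 z" if "0 \<le> t" "t \<le> 2" for t
    using that by (auto simp: f_def cell_conv_interval)
  have f2: "f t + axis i 1 \<in> cell 1 (z + axis i 1)" if "0 \<le> t" "t \<le> 2" for t
    using that by (auto simp: f_def cell_conv_interval axis_def)
  have neq: "f s = f t \<longleftrightarrow> s = t" for s t
    using k by (auto simp: f_def vec_eq_iff)
  have "\<exists>t. 0 \<le> t \<and> t \<le> 2 \<and> good K x j (f t) \<and> good K x j (f t + axis i 1)"
  proof (rule ccontr)
    assume no: "\<not> ?thesis"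
    have u1: "s = t" if "0 \<le> s" "s \<le> 2" "0 \<le> t" "t \<le> 2" "\<not> good K x j (f s)" "\<not> good K x j (f t)" for s t
      using good_Suc_unique_bad[OF Suc.prems(1), of "f s" "f t"] f1 that neq by auto
    have u2: "s = t" if "0 \<le> s" "s \<le> 2" "0 \<le> t" "t \<le> 2"
      "\<not> good K x j (f s + axis i 1)" "\<not> good K x j (f t + axis i 1)" for s t
      using good_Suc_unique_bad[OF Suc.prems(2), of "f s + axis i 1" "f t + axis i 1"] f2 that neq by auto
    have "\<not> good K x j (f t) \<or> \<not> good K x j (f t + axis i 1)" if "0 \<le> t" "t \<le> 2" for t
      using no that by auto
    from this[of 0] this[of 1] this[of 2] show False
      using u1[of 0 1] u1[of 0 2] u1[of 1 2] u2[of 0 1] u2[of 0 2] u2[of 1 2] by auto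
  qed
  then obtain t where t: "0 \<le> t" "t \<le> 2" "good K x j (f t)" "good K x j (f t + axis i 1)" by auto
  from Suc.IH[OF t(3,4)] f1[OF t(1,2)] f2[OF t(1,2)] t(3,4) show ?case by auto
qed

lemma cluster_crossing:
  fixes z z' :: "int ^ 'd"
  assumes d: "CARD('d) \<ge> 2" and g: "good K x j z" "good K x j z'" and nb: "nearest_neighbour z z'"
  obtains p q where "p \<in> cluster K x j z" "q \<in> cluster K x j z'" "nearest_neighbour p q"
proof -
  obtain i t where t: "\<bar>t\<bar> = 1" "z' = z + axis i t" using nearest_neighbour_cases[OF nb] .
  then consider "z' = z + axis i 1" | "z = z' + axis i 1"
    by (cases "t = 1") (auto simp: vec_eq_iff axis_def abs_if split: if_splits)
  then show ?thesis
  proof cases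
    case 1
    then show ?thesis using cluster_crossing_axis[OF d, of K x j z i] g that by auto
  next
    case 2
    then show ?thesis using cluster_crossing_axis[OF d, of K x j z' i] g that
      by (auto simp: nearest_neighbour_commute)
  qed
qed

text \<open>
  The cells of \<open>R\<close> are reached one by one, each from an adjacent cell reached before, and each new cell costs
  one more set of at most \<open>m\<close> sites.  So the cells reached after \<open>n\<close> steps are within \<open>n * m\<close> sites of \<open>p\<close>.
\<close>

lemma join_through_cells:
  fixes R :: "(int ^ 'd) set"
  assumes d: "CARD('d) \<ge> 2"
    and joined: "\<And>z p q. \<lbrakk>good K x j z; p \<in> cluster K x j z; q \<in> cluster K x j z\<rbrakk> \<Longrightarrow>
      \<exists>S. lattice_connected S \<and> S \<subseteq> cluster K x j z \<and> p \<in> S \<and> q \<in> S \<and> card S \<le> m"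
    and R: "finite R" "lattice_connected R" "\<And>z. z \<in> R \<Longrightarrow> good K x j z"
    and ends: "a \<in> R" "p \<in> cluster K x j a" "b \<in> R" "q \<in> cluster K x j b"
  shows "\<exists>T. lattice_connected T \<and> T \<subseteq> (\<Union>z\<in>R. cluster K x j z) \<and> p \<in> T \<and> q \<in> T \<and> card T \<le> card R * m"
proof -
  let ?U = "\<Union>z\<in>R. cluster K x j z"
  let ?P = "\<lambda>n S. S \<subseteq> R \<and> card S = n \<and> a \<in> S \<and>
    (\<forall>b\<in>S. \<forall>q\<in>cluster K x j b. \<exists>T. lattice_connected T \<and> T \<subseteq> ?U \<and> p \<in> T \<and> q \<in> T \<and> card T \<le> n * m)"
  have "n < card R \<longrightarrow> (\<exists>S. ?P (Suc n) S)" for n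
  proof (induction n)
    case 0
    have "\<exists>T. lattice_connected T \<and> T \<subseteq> ?U \<and> p \<in> T \<and> q \<in> T \<and> card T \<le> m" if "q \<in> cluster K x j a" for q
      using joined[OF R(3)[OF ends(1)] ends(2) that] ends(1) by blast
    then have "?P (Suc 0) {a}" using ends(1) by auto
    then show ?case by blast
  next
    case (Suc n)
    show ?case
    proof
      assume n: "Suc n < card R"
      with Suc obtain S where S: "?P (Suc n) S" by auto
      then have "S \<noteq> R" "S \<noteq> {}" using n by auto
      then obtain u v where uv: "u \<in> S" "v \<in> R - S" "nearest_neighbour u v"
        using lattice_connected_boundary_edge[OF R(2), of S] S by blast
      have gu: "good K x j u" "good K x j v" using uv S R(3) by auto
      obtain p' q' where pq: "p' \<in> cluster K x j u" "q' \<in> cluster K x j v" "nearest_neighbour p' q'"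
        using cluster_crossing[OF d gu uv(3)] by blast
      obtain T where T: "lattice_connected T" "T \<subseteq> ?U" "p \<in> T" "p' \<in> T" "card T \<le> Suc n * m"
        using S uv(1) pq(1) by blast
      have new: "\<exists>T. lattice_connected T \<and> T \<subseteq> ?U \<and> p \<in> T \<and> q \<in> T \<and> card T \<le> Suc (Suc n) * m"
        if q: "q \<in> cluster K x j v" for q
      proof -
        obtain T' where T': "lattice_connected T'" "T' \<subseteq> cluster K x j v" "q' \<in> T'" "q \<in> T'" "card T' \<le> m"
          using joined[OF gu(2) pq(2) q] by blast
        have "lattice_connected (T \<union> T')"
          using lattice_connected_Un[OF T(1) T'(1) T(4) T'(3)] pq(3) by simp
        moreover have "card (T \<union> T') \<le> Suc (Suc n) * m"
          using card_Un_le[of T T'] T(5) T'(5) by simp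
        moreover have "T \<union> T' \<subseteq> ?U" using T(2) T'(2) uv(2) by auto
        ultimately show ?thesis using T(3) T'(4) by blast
      qed
      have old: "\<exists>T. lattice_connected T \<and> T \<subseteq> ?U \<and> p \<in> T \<and> q \<in> T \<and> card T \<le> Suc (Suc n) * m"
        if q: "b \<in> S" "q \<in> cluster K x j b" for q b
      proof -
        obtain T where "lattice_connected T" "T \<subseteq> ?U" "p \<in> T" "q \<in> T" "card T \<le> Suc n * m"
          using S q by blast
        moreover from this(5) have "card T \<le> Suc (Suc n) * m" by simp
        ultimately show ?thesis by blast
      qed
      have "finite S" using S R(1) finite_subset by blast
      then have "card (insert v S) = Suc (Suc n)" using S uv(2) by simp
      then have "?P (Suc (Suc n)) (insert v S)" using S uv(2) new old by blast
      then show "\<exists>S. ?P (Suc (Suc n)) S" by blast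
    qed
  qed
  moreover have "0 < card R" using R(1) ends(1) by (auto simp: card_gt_0_iff)
  then obtain n where n: "card R = Suc n" by (cases "card R") auto
  ultimately obtain S where S: "?P (card R) S" by (metis lessI)
  then have "S = R" using card_subset_eq[OF R(1)] by blast
  then show ?thesis using S ends by blast
qed

text \<open>
  The exponent base \<open>3^d - 1\<close> must be smaller than \<open>3^d\<close>.  If all children are good, one of them that
  contains neither endpoint can be left out, so in every case \<open>p\<close> and \<open>q\<close> are joined through a
  connected set of \<open>3^d - 1\<close> good children.
\<close>

lemma cluster_joined:
  fixes z :: "int ^ 'd"
  assumes d: "CARD('d) \<ge> 2"
  shows "\<lbrakk>good K x j z; p \<in> cluster K x j z; q \<in> cluster K x j z\<rbrakk> \<Longrightarrow>
    \<exists>S. lattice_connected S \<and> S \<subseteq> cluster K x j z \<and> p \<in> S \<and> q \<in> S \<and> card S \<le> (3 ^ CARD('d) - 1) ^ j"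
proof (induction j arbitrary: z p q)
  case 0
  then show ?case by (intro exI[of _ "{z}"]) auto
next
  case (Suc j)
  obtain a where a: "a \<in> cell 1 z" "good K x j a" "p \<in> cluster K x j a" using Suc.prems(2) by auto
  obtain b where b: "b \<in> cell 1 z" "good K x j b" "q \<in> cluster K x j b" using Suc.prems(3) by auto
  obtain r where r: "r \<in> cell 1 z" "r \<noteq> a" "r \<noteq> b" "\<And>c. c \<in> cell 1 z - {r} \<Longrightarrow> good K x j c"
  proof (cases "\<exists>r\<in>cell 1 z. \<not> good K x j r")
    case True
    then obtain r where "r \<in> cell 1 z" "\<not> good K x j r" by auto
    then show ?thesis using that[of r] a b good_Suc_unique_bad[OF Suc.prems(1)] by auto
  next
    case False
    have "card {a, b} < card (cell 1 z)"
      using card_cell_1_ge[OF d, of z] by (auto simp: card_insert_if)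
    then obtain r where "r \<in> cell 1 z" "r \<notin> {a, b}"
      by (meson card_mono finite.emptyI finite_insert not_le subsetI)
    then show ?thesis using that[of r] False by auto
  qed
  let ?R = "cell 1 z - {r}"
  have cR: "card ?R = 3 ^ CARD('d) - 1" using r(1) by (simp add: card_cell)
  have "\<exists>T. lattice_connected T \<and> T \<subseteq> (\<Union>z\<in>?R. cluster K x j z) \<and> p \<in> T \<and> q \<in> T
     \<and> card T \<le> card ?R * (3 ^ CARD('d) - 1) ^ j"
    by (rule join_through_cells[OF d Suc.IH _ lattice_connected_cell_1_minus[OF d r(1)] r(4) _ a(3) _ b(3)])
      (use a b r in auto)
  then obtain T where T: "lattice_connected T" "T \<subseteq> (\<Union>z\<in>?R. cluster K x j z)" "p \<in> T" "q \<in> T"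
     "card T \<le> card ?R * (3 ^ CARD('d) - 1) ^ j" by blast
  have "T \<subseteq> cluster K x (Suc j) z" using T(2) r(4) by auto
  then show ?case using T cR by auto
qed

text \<open>
  Again the cells are added one by one; a new cell \<open>v\<close>, entered from \<open>u\<close>, costs a set from \<open>y u\<close> to the
  crossing and a set from the crossing to \<open>y v\<close>.
\<close>

lemma cluster_trunk:
  fixes R :: "(int ^ 'd) set"
  assumes d: "CARD('d) \<ge> 2"
    and R: "finite R" "R \<noteq> {}" "lattice_connected R" "\<And>z. z \<in> R \<Longrightarrow> good K x j z"
    and y: "\<And>z. z \<in> R \<Longrightarrow> y z \<in> cluster K x j z"
  shows "\<exists>T. lattice_connected T \<and> T \<subseteq> (\<Union>z\<in>R. cluster K x j z) \<and> y ` R \<subseteq> T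
    \<and> card T \<le> 2 * card R * (3 ^ CARD('d) - 1) ^ j"
proof -
  let ?U = "\<Union>z\<in>R. cluster K x j z"
  let ?m = "(3 ^ CARD('d) - 1) ^ j :: nat"
  let ?P = "\<lambda>n S. S \<subseteq> R \<and> card S = n \<and> S \<noteq> {} \<and>
    (\<exists>T. lattice_connected T \<and> T \<subseteq> ?U \<and> y ` S \<subseteq> T \<and> card T \<le> 2 * n * ?m)"
  obtain a where a: "a \<in> R" using R(2) by auto
  have m: "1 \<le> ?m"
  proof -
    have "(1::nat) \<le> 3 ^ CARD('d) - 1" using card_cell_1_ge[OF d, of 0] by (simp add: card_cell)
    then show ?thesis by simp
  qed
  have "n < card R \<longrightarrow> (\<exists>S. ?P (Suc n) S)" for n
  proof (induction n)
    case 0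
    have "?P (Suc 0) {a}"
      using a y m by (auto intro!: exI[of _ "{y a}"])
    then show ?case by blast
  next
    case (Suc n)
    show ?case
    proof
      assume n: "Suc n < card R"
      with Suc obtain S T where S: "S \<subseteq> R" "card S = Suc n" "S \<noteq> {}"
        and T: "lattice_connected T" "T \<subseteq> ?U" "y ` S \<subseteq> T" "card T \<le> 2 * Suc n * ?m" by auto
      then have "S \<noteq> R" using n by auto
      then obtain u v where uv: "u \<in> S" "v \<in> R - S" "nearest_neighbour u v"
        using lattice_connected_boundary_edge[OF R(3), of S] S by blast
      have gu: "good K x j u" "good K x j v" using uv S R(4) by auto
      have yu: "y u \<in> cluster K x j u" "y v \<in> cluster K x j v" using uv S y by auto
      obtain p q where pq: "p \<in> cluster K x j u" "q \<in> cluster K x j v" "nearest_neighbour p q"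
        using cluster_crossing[OF d gu uv(3)] by blast
      obtain A where A: "lattice_connected A" "A \<subseteq> cluster K x j u" "y u \<in> A" "p \<in> A" "card A \<le> ?m"
        using cluster_joined[OF d gu(1) yu(1) pq(1)] by blast
      obtain B where B: "lattice_connected B" "B \<subseteq> cluster K x j v" "q \<in> B" "y v \<in> B" "card B \<le> ?m"
        using cluster_joined[OF d gu(2) pq(2) yu(2)] by blast
      have yuT: "y u \<in> T" using T(3) uv(1) by auto
      have "lattice_connected (T \<union> A)"
        using lattice_connected_Un[OF T(1) A(1) yuT A(3)] by simp
      then have "lattice_connected (T \<union> A \<union> B)"
        using lattice_connected_Un[OF _ B(1) _ B(3), of "T \<union> A" p] A(4) pq(3) by simp
      moreover have "T \<union> A \<union> B \<subseteq> ?U" using T(2) A(2) B(2) uv S by auto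
      moreover have "y ` insert v S \<subseteq> T \<union> A \<union> B" using T(3) B(4) by auto
      moreover have "card (T \<union> A \<union> B) \<le> 2 * Suc (Suc n) * ?m"
        using card_Un_le[of "T \<union> A" B] card_Un_le[of T A] T(4) A(5) B(5) by simp
      moreover have "card (insert v S) = Suc (Suc n)"
        using S uv(2) R(1) finite_subset[OF S(1)] by simp
      ultimately have "?P (Suc (Suc n)) (insert v S)" using S uv(2) by blast
      then show "\<exists>S. ?P (Suc (Suc n)) S" by blast
    qed
  qed
  moreover have "0 < card R" using R(1) a by (auto simp: card_gt_0_iff)
  then obtain n where n: "card R = Suc n" by (cases "card R") auto
  ultimately obtain S where S: "?P (card R) S" by (metis lessI)
  then have "S = R" using card_subset_eq[OF R(1)] by blast
  then show ?thesis using S by blast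
qed

section \<open>Joining animals, and the score of a cell\<close>

text \<open>
  Choose in each cell a site of the cluster, on the prescribed animal if there is one, and join these sites
  by a trunk.  The trunk consists of sites of weight at least \<open>-K\<close>, so adding it to the disjoint animals
  costs at most \<open>K\<close> times its size.
\<close>

lemma join_animals:
  fixes \<xi> :: "int ^ 'd \<Rightarrow> (int ^ 'd) set"
  assumes d: "CARD('d) \<ge> 2" and K: "0 \<le> K"
    and R: "finite R" "R \<noteq> {}" "lattice_connected R" "\<And>z. z \<in> R \<Longrightarrow> good K x j z"
    and \<xi>: "\<And>z. z \<in> R \<Longrightarrow> \<xi> z = {} \<or> lattice_animal (\<xi> z) \<and> \<xi> z \<inter> cluster K x j z \<noteq> {}"
    and disj: "\<And>z z'. \<lbrakk>z \<in> R; z' \<in> R; z \<noteq> z'\<rbrakk> \<Longrightarrow> \<xi> z \<inter> \<xi> z' = {}"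
  obtains \<zeta> where "lattice_animal \<zeta>" "\<zeta> \<subseteq> (\<Union>z\<in>R. cluster K x j z \<union> \<xi> z)"
    "\<exists>z\<in>R. \<zeta> \<inter> cluster K x j z \<noteq> {}"
    "(\<Sum>z\<in>R. weight x (\<xi> z)) - K * (2 * card R * (3 ^ CARD('d) - 1) ^ j) \<le> weight x \<zeta>"
proof -
  have "\<forall>z\<in>R. \<exists>p. p \<in> cluster K x j z \<and> (\<xi> z \<noteq> {} \<longrightarrow> p \<in> \<xi> z)"
    using \<xi> cluster_nonempty[OF d R(4)] by blast
  then obtain y where y: "\<And>z. z \<in> R \<Longrightarrow> y z \<in> cluster K x j z" "\<And>z. z \<in> R \<Longrightarrow> \<xi> z \<noteq> {} \<Longrightarrow> y z \<in> \<xi> z"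
    by metis
  obtain T where T: "lattice_connected T" "T \<subseteq> (\<Union>z\<in>R. cluster K x j z)" "y ` R \<subseteq> T"
    "card T \<le> 2 * card R * (3 ^ CARD('d) - 1) ^ j"
    using cluster_trunk[OF d R y(1)] by blast
  define U where "U = (\<Union>z\<in>R. \<xi> z)"
  have fin: "finite (\<xi> z)" if "z \<in> R" for z using \<xi>[OF that] by (auto simp: lattice_animal_def)
  have finU: "finite U" using R(1) fin by (auto simp: U_def)
  have finT: "finite T" by (rule finite_subset[OF T(2)]) (use R(1) in auto)
  define R' where "R' = {z \<in> R. \<xi> z \<noteq> {}}"
  have UR': "U = (\<Union>z\<in>R'. \<xi> z)" by (auto simp: U_def R'_def)
  have "lattice_connected (T \<union> (\<Union>z\<in>R'. \<xi> z))"
  proof (rule lattice_connected_star[OF T(1)])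
    fix z assume "z \<in> R'"
    then have z: "z \<in> R" "\<xi> z \<noteq> {}" by (auto simp: R'_def)
    then show "lattice_connected (\<xi> z)" using \<xi>[of z] by (auto simp: lattice_animal_def)
    have "y z \<in> \<xi> z" "y z \<in> T" using z y T(3) by auto
    then show "\<xi> z \<inter> T \<noteq> {}" by auto
  qed
  then have conn: "lattice_connected (T \<union> U)" by (simp add: UR')
  obtain z0 where z0: "z0 \<in> R" using R(2) by auto
  have "y z0 \<in> T" "y z0 \<in> cluster K x j z0" using z0 y T(3) by auto
  then have hit: "\<exists>z\<in>R. (T \<union> U) \<inter> cluster K x j z \<noteq> {}" using z0 by blast
  have "- K * card T \<le> weight x (T - U)"
  proof -
    have "(\<Sum>v\<in>T - U. - K) \<le> weight x (T - U)"
      unfolding weight_def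
    proof (rule sum_mono)
      fix v assume "v \<in> T - U"
      then obtain z where "z \<in> R" "v \<in> cluster K x j z" using T(2) by auto
      then show "- K \<le> x v" using cluster_bounded_below[OF R(4)] by blast
    qed
    moreover have "card (T - U) \<le> card T" using finT by (intro card_mono) auto
    then have "K * card (T - U) \<le> K * card T" using K by (intro mult_left_mono) auto
    ultimately show ?thesis by (simp add: mult.commute)
  qed
  moreover have "K * card T \<le> K * real (2 * card R * (3 ^ CARD('d) - 1) ^ j)"
    using T(4) K by (intro mult_left_mono) (simp_all only: of_nat_le_iff)
  moreover have "weight x (T \<union> U) = weight x U + weight x (T - U)"
    unfolding weight_def using sum.union_disjoint[of U "T - U" x] finU finT
    by (simp add: Un_commute)
  moreover have "weight x U = (\<Sum>z\<in>R. weight x (\<xi> z))"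
    unfolding weight_def U_def using R(1) fin disj by (intro sum.UNION_disjoint) auto
  ultimately have "(\<Sum>z\<in>R. weight x (\<xi> z)) - K * real (2 * card R * (3 ^ CARD('d) - 1) ^ j) \<le> weight x (T \<union> U)"
    by linarith
  moreover have "lattice_animal (T \<union> U)"
    using conn finT finU \<open>y z0 \<in> T\<close> by (auto simp: lattice_animal_def)
  moreover have "T \<union> U \<subseteq> (\<Union>z\<in>R. cluster K x j z \<union> \<xi> z)" using T(2) by (auto simp: U_def)
  ultimately show ?thesis using that[of "T \<union> U"] hit by blast
qed

definition admissible :: "real \<Rightarrow> (int ^ 'd \<Rightarrow> real) \<Rightarrow> nat \<Rightarrow> int ^ 'd \<Rightarrow> (int ^ 'd) set \<Rightarrow> bool" where
  "admissible K x j z \<xi> \<longleftrightarrow> good K x j z \<and> lattice_animal \<xi> \<and> \<xi> \<subseteq> cell j z \<and> \<xi> \<inter> cluster K x j z \<noteq> {}"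

text \<open>
  Sets that are not admissible compete with value 0.  So the score is nonnegative and the empty
  set stands for the absence of an animal; in particular bad cells have score 0.
\<close>

definition cell_score :: "real \<Rightarrow> (int ^ 'd \<Rightarrow> real) \<Rightarrow> nat \<Rightarrow> int ^ 'd \<Rightarrow> real" where
  "cell_score K x j z = Max ((\<lambda>\<xi>. if admissible K x j z \<xi> then weight x \<xi> else 0) ` Pow (cell j z))"

lemma weight_empty [simp]: "weight x {} = 0"
  by (simp add: weight_def)

lemma weight_le:
  assumes "\<And>v. x v \<le> M" "0 \<le> M" "\<xi> \<subseteq> A" "finite A"
  shows "weight x \<xi> \<le> M * card A"
proof -
  have "weight x \<xi> \<le> (\<Sum>v\<in>\<xi>. M)" unfolding weight_def by (intro sum_mono assms)
  also have "\<dots> = M * card \<xi>" by simp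
  also have "\<dots> \<le> M * card A" using assms by (intro mult_left_mono) (auto intro: card_mono)
  finally show ?thesis .
qed

lemma cell_score_ge: "admissible K x j z \<xi> \<Longrightarrow> weight x \<xi> \<le> cell_score K x j z"
  unfolding cell_score_def
  by (rule Max_ge) (auto simp: admissible_def image_iff intro!: bexI[of _ \<xi>])

lemma cell_score_nonneg: "0 \<le> cell_score K x j z"
  unfolding cell_score_def
  by (rule Max_ge) (auto simp: admissible_def lattice_animal_def image_iff intro!: bexI[of _ "{}"])

lemma cell_score_attained:
  obtains \<xi> where "cell_score K x j z = weight x \<xi>" "\<xi> = {} \<or> admissible K x j z \<xi>"
proof -
  have "cell_score K x j z \<in> (\<lambda>\<xi>. if admissible K x j z \<xi> then weight x \<xi> else 0) ` Pow (cell j z)"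
    unfolding cell_score_def by (rule Max_in) auto
  then obtain \<xi> where "cell_score K x j z = (if admissible K x j z \<xi> then weight x \<xi> else 0)" by blast
  then show ?thesis using that[of \<xi>] that[of "{}"] by (auto split: if_splits)
qed

lemma cell_score_bad: "\<not> good K x j z \<Longrightarrow> cell_score K x j z = 0"
  using cell_score_attained[of K x j z] by (auto simp: admissible_def)

lemma cell_score_le:
  assumes "\<And>v. x v \<le> M" "0 \<le> M"
  shows "cell_score K x j z \<le> M * card (cell j z)"
proof -
  obtain \<xi> where "cell_score K x j z = weight x \<xi>" "\<xi> = {} \<or> admissible K x j z \<xi>"
    by (rule cell_score_attained)
  then show ?thesis using weight_le[OF assms, of \<xi> "cell j z"] by (auto simp: admissible_def)
qed

text \<open>
  In a good cell the best animals of the good children are joined through the connected set of good children.  In a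
  bad cell the scores of the children are estimated by \<open>M\<close> times the volume.
\<close>

lemma cell_score_Suc:
  fixes z :: "int ^ 'd"
  assumes d: "CARD('d) \<ge> 2" and K: "0 \<le> K" and M: "\<And>v. x v \<le> M" "0 \<le> M"
  shows "(\<Sum>c\<in>cell 1 z. cell_score K x j c) - K * (2 * 3 ^ CARD('d) * (3 ^ CARD('d) - 1) ^ j)
    - (if good K x (Suc j) z then 0 else M * (3 ^ CARD('d)) ^ Suc j) \<le> cell_score K x (Suc j) z"
proof (cases "good K x (Suc j) z")
  case False
  have "(\<Sum>c\<in>cell 1 z. cell_score K x j c) \<le> (\<Sum>c\<in>cell 1 z. M * card (cell j z))"
    using cell_score_le[OF M] by (intro sum_mono) (simp add: card_cell)
  also have "\<dots> = M * (3 ^ CARD('d)) ^ Suc j" by (simp add: card_cell)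
  finally have "(\<Sum>c\<in>cell 1 z. cell_score K x j c) \<le> M * (3 ^ CARD('d)) ^ Suc j" .
  moreover have "0 \<le> K * (2 * 3 ^ CARD('d) * (3 ^ CARD('d) - 1) ^ j)" using K by simp
  ultimately show ?thesis using False cell_score_bad[OF False] by simp
next
  case True
  define R where "R = {c \<in> cell 1 z. good K x j c}"
  have "\<forall>c. \<exists>\<xi>. cell_score K x j c = weight x \<xi> \<and> (\<xi> = {} \<or> admissible K x j c \<xi>)"
    using cell_score_attained by metis
  then obtain \<xi> where \<xi>: "\<And>c. cell_score K x j c = weight x (\<xi> c)" "\<And>c. \<xi> c = {} \<or> admissible K x j c (\<xi> c)"
    by metis
  have sub: "\<xi> c \<subseteq> cell j c" for c using \<xi>(2)[of c] by (auto simp: admissible_def)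
  obtain \<zeta> where \<zeta>: "lattice_animal \<zeta>" "\<zeta> \<subseteq> (\<Union>c\<in>R. cluster K x j c \<union> \<xi> c)"
    "\<exists>c\<in>R. \<zeta> \<inter> cluster K x j c \<noteq> {}"
    "(\<Sum>c\<in>R. weight x (\<xi> c)) - K * (2 * card R * (3 ^ CARD('d) - 1) ^ j) \<le> weight x \<zeta>"
  proof (rule join_animals[OF d K, of R x j \<xi>])
    show "R \<noteq> {}" using exists_good_child[OF d True] by (auto simp: R_def)
    show "lattice_connected R" unfolding R_def by (rule lattice_connected_good_children[OF d True])
    show "\<xi> c = {} \<or> lattice_animal (\<xi> c) \<and> \<xi> c \<inter> cluster K x j c \<noteq> {}" for c
      using \<xi>(2)[of c] by (auto simp: admissible_def)
    show "\<xi> c \<inter> \<xi> c' = {}" if "c \<noteq> c'" for c c'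
      using sub[of c] sub[of c'] cell_disjoint[OF that, of j] by blast
  qed (auto simp: R_def)
  have "cluster K x j c \<union> \<xi> c \<subseteq> cell j c" for c using sub cluster_subset_cell by blast
  then have "\<zeta> \<subseteq> (\<Union>c\<in>R. cell j c)" using \<zeta>(2) by (meson UN_mono order_refl order_trans)
  also have "\<dots> \<subseteq> cell (Suc j) z" unfolding cell_Suc R_def by auto
  finally have "\<zeta> \<subseteq> cell (Suc j) z" .
  then have "admissible K x (Suc j) z \<zeta>"
    using True \<zeta>(1,3) by (auto simp: admissible_def R_def)
  then have "weight x \<zeta> \<le> cell_score K x (Suc j) z" by (rule cell_score_ge)
  moreover have "(\<Sum>c\<in>R. weight x (\<xi> c)) = (\<Sum>c\<in>cell 1 z. cell_score K x j c)"
    unfolding \<xi>(1)[symmetric]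
    by (rule sum.mono_neutral_left) (auto simp: R_def cell_score_bad)
  moreover have "K * (2 * card R * (3 ^ CARD('d) - 1) ^ j) \<le> K * (2 * 3 ^ CARD('d) * (3 ^ CARD('d) - 1) ^ j)"
  proof -
    have "card R \<le> 3 ^ CARD('d)"
      using card_mono[of "cell 1 z" R] by (auto simp: R_def card_cell)
    then have "real (card R) \<le> real (3 ^ CARD('d))" by (simp only: of_nat_le_iff)
    then have "real (card R) \<le> 3 ^ CARD('d)" by simp
    then show ?thesis using K by (intro mult_left_mono mult_right_mono) (auto simp: of_nat_diff)
  qed
  ultimately show ?thesis using True \<zeta>(4) by (simp add: of_nat_diff)
qed

text \<open>
  Like the score, it vanishes on bad cells, so that it too is superadditive over children up to the bad cells.
\<close>

definition cluster_size :: "real \<Rightarrow> (int ^ 'd \<Rightarrow> real) \<Rightarrow> nat \<Rightarrow> int ^ 'd \<Rightarrow> real" where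
  "cluster_size K x j z = (if good K x j z then card (cluster K x j z) else 0)"

lemma cluster_size_nonneg: "0 \<le> cluster_size K x j z"
  by (simp add: cluster_size_def)

lemma cluster_size_le: "cluster_size K x j z \<le> card (cell j z)"
  by (simp add: cluster_size_def card_mono cluster_subset_cell)

lemma cluster_size_Suc:
  fixes z :: "int ^ 'd"
  shows "(\<Sum>c\<in>cell 1 z. cluster_size K x j c) - (if good K x (Suc j) z then 0 else (3 ^ CARD('d)) ^ Suc j)
    \<le> cluster_size K x (Suc j) z"
proof (cases "good K x (Suc j) z")
  case False
  have "(\<Sum>c\<in>cell 1 z. cluster_size K x j c) \<le> (\<Sum>c\<in>cell 1 z. real (card (cell j z)))"
    using cluster_size_le by (intro sum_mono) (simp add: card_cell)
  also have "\<dots> = (3 ^ CARD('d)) ^ Suc j" by (simp add: card_cell)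
  finally show ?thesis using False by (simp add: cluster_size_def)
next
  case True
  have "card (cluster K x (Suc j) z) = (\<Sum>c\<in>{c \<in> cell 1 z. good K x j c}. card (cluster K x j c))"
    unfolding cluster.simps
  proof (rule card_UN_disjoint)
    show "\<forall>c\<in>{c \<in> cell 1 z. good K x j c}. \<forall>c'\<in>{c \<in> cell 1 z. good K x j c}.
        c \<noteq> c' \<longrightarrow> cluster K x j c \<inter> cluster K x j c' = {}"
    proof (intro ballI impI)
      fix c c' :: "int ^ 'd" assume "c \<noteq> c'"
      from cell_disjoint[OF this, of j] cluster_subset_cell[of K x j c] cluster_subset_cell[of K x j c']
      show "cluster K x j c \<inter> cluster K x j c' = {}" by blast
    qed
  qed auto
  also have "real \<dots> = (\<Sum>c\<in>cell 1 z. cluster_size K x j c)"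
    unfolding of_nat_sum
    by (rule sum.mono_neutral_cong_left) (auto simp: cluster_size_def)
  finally show ?thesis using True by (simp add: cluster_size_def)
qed

section \<open>The greedy weight of a box\<close>

lemma finite_greedy_candidates:
  "finite {weight x \<xi> | \<xi>. lattice_animal \<xi> \<and> \<xi> \<subseteq> lattice_box n}"
proof -
  have "{weight x \<xi> | \<xi>. lattice_animal \<xi> \<and> \<xi> \<subseteq> lattice_box n} \<subseteq> weight x ` Pow (lattice_box n)" by auto
  then show ?thesis by (rule finite_subset) simp
qed

lemma greedy_weight_ge:
  "lattice_animal \<xi> \<Longrightarrow> \<xi> \<subseteq> lattice_box n \<Longrightarrow> weight x \<xi> \<le> greedy_weight x n"
  unfolding greedy_weight_def by (rule Max_ge[OF finite_greedy_candidates]) auto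

lemma greedy_weight_attained:
  fixes x :: "int ^ 'd \<Rightarrow> real"
  assumes "n \<ge> 1"
  obtains \<xi> where "lattice_animal \<xi>" "\<xi> \<subseteq> lattice_box n" "greedy_weight x n = weight x \<xi>"
proof -
  let ?S = "{weight x \<xi> | \<xi>. lattice_animal \<xi> \<and> \<xi> \<subseteq> lattice_box n}"
  have "lattice_animal {0 :: int ^ 'd}" "{0 :: int ^ 'd} \<subseteq> lattice_box n"
    using assms by (auto simp: lattice_animal_def lattice_box_def)
  then have "?S \<noteq> {}" by blast
  then have "greedy_weight x n \<in> ?S"
    unfolding greedy_weight_def by (rule Max_in[OF finite_greedy_candidates])
  then show ?thesis using that by auto
qed

lemma lattice_box_mono: "m \<le> n \<Longrightarrow> lattice_box m \<subseteq> lattice_box n"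
  by (auto simp: lattice_box_def intro: less_le_trans)

lemma greedy_weight_mono:
  assumes "1 \<le> m" "m \<le> n"
  shows "greedy_weight x m \<le> greedy_weight x n"
proof -
  obtain \<xi> where "lattice_animal \<xi>" "\<xi> \<subseteq> lattice_box m" "greedy_weight x m = weight x \<xi>"
    using greedy_weight_attained[OF assms(1)] .
  then show ?thesis using greedy_weight_ge[of \<xi> n x] lattice_box_mono[OF assms(2)] by auto
qed

lemma greedy_weight_box_ge:
  fixes x :: "int ^ 'd \<Rightarrow> real"
  assumes d: "CARD('d) \<ge> 2" and K: "0 \<le> K" and s: "s \<ge> 1"
    and g: "\<And>z. z \<in> lattice_box s \<Longrightarrow> good K x j z"
  shows "(\<Sum>z\<in>lattice_box s. cell_score K x j z) - K * (2 * s ^ CARD('d) * (3 ^ CARD('d) - 1) ^ j)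
    \<le> greedy_weight x (s * 3 ^ j)"
proof -
  have "\<forall>c. \<exists>\<xi>. cell_score K x j c = weight x \<xi> \<and> (\<xi> = {} \<or> admissible K x j c \<xi>)"
    using cell_score_attained by metis
  then obtain \<xi> where \<xi>: "\<And>c. cell_score K x j c = weight x (\<xi> c)" "\<And>c. \<xi> c = {} \<or> admissible K x j c (\<xi> c)"
    by metis
  have sub: "\<xi> c \<subseteq> cell j c" for c using \<xi>(2)[of c] by (auto simp: admissible_def)
  have ne: "(lattice_box s :: (int ^ 'd) set) \<noteq> {}"
    using s card_lattice_box[where ?'d = 'd, of s] by auto
  obtain \<zeta> where \<zeta>: "lattice_animal \<zeta>" "\<zeta> \<subseteq> (\<Union>c\<in>lattice_box s. cluster K x j c \<union> \<xi> c)"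
    "(\<Sum>c\<in>lattice_box s. weight x (\<xi> c)) - K * (2 * card (lattice_box s :: (int ^ 'd) set) * (3 ^ CARD('d) - 1) ^ j) \<le> weight x \<zeta>"
  proof (rule join_animals[OF d K, of "lattice_box s" x j \<xi>])
    show "lattice_connected (lattice_box s :: (int ^ 'd) set)" by (rule lattice_connected_box)
    show "\<xi> c = {} \<or> lattice_animal (\<xi> c) \<and> \<xi> c \<inter> cluster K x j c \<noteq> {}" for c
      using \<xi>(2)[of c] by (auto simp: admissible_def)
    show "\<xi> c \<inter> \<xi> c' = {}" if "c \<noteq> c'" for c c'
      using sub[of c] sub[of c'] cell_disjoint[OF that, of j] by blast
  qed (use ne g in auto)
  have "cluster K x j c \<union> \<xi> c \<subseteq> cell j c" for c using sub cluster_subset_cell by blast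
  then have "\<zeta> \<subseteq> lattice_box (s * 3 ^ j)"
    using \<zeta>(2) unfolding lattice_box_conv_cells by (meson UN_mono order_refl order_trans)
  then have "weight x \<zeta> \<le> greedy_weight x (s * 3 ^ j)" by (rule greedy_weight_ge[OF \<zeta>(1)])
  with \<zeta>(3) show ?thesis by (simp add: \<xi>(1) card_lattice_box of_nat_diff)
qed

lemma weight_outside_clusters_le:
  fixes x :: "int ^ 'd \<Rightarrow> real"
  assumes M: "\<And>v. x v \<le> M" "0 \<le> M" and \<xi>: "\<xi> \<subseteq> (\<Union>z\<in>R. cell j z)" and R: "finite R"
    and g: "\<And>z. z \<in> R \<Longrightarrow> good K x j z" and miss: "\<And>z. z \<in> R \<Longrightarrow> \<xi> \<inter> cluster K x j z = {}"
  shows "weight x \<xi> \<le> M * (\<Sum>z\<in>R. (3 ^ CARD('d)) ^ j - cluster_size K x j z)"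
proof -
  let ?A = "\<Union>z\<in>R. cell j z - cluster K x j z"
  have "\<xi> \<subseteq> ?A" using \<xi> miss by blast
  then have w: "weight x \<xi> \<le> M * card ?A" using R by (intro weight_le M) auto
  have "real (card ?A) \<le> real (\<Sum>z\<in>R. card (cell j z - cluster K x j z))"
    unfolding of_nat_le_iff by (rule card_UN_le[OF R])
  also have "\<dots> = (\<Sum>z\<in>R. (3 ^ CARD('d)) ^ j - cluster_size K x j z)"
    unfolding of_nat_sum
  proof (rule sum.cong[OF refl])
    fix z assume z: "z \<in> R"
    have "card (cluster K x j z) \<le> card (cell j z)" by (intro card_mono cluster_subset_cell) simp
    then show "real (card (cell j z - cluster K x j z)) = (3 ^ CARD('d)) ^ j - cluster_size K x j z"
      using g[OF z] by (simp add: cluster_size_def card_Diff_subset cluster_subset_cell of_nat_diff card_cell)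
  qed
  finally have "M * card ?A \<le> M * (\<Sum>z\<in>R. (3 ^ CARD('d)) ^ j - cluster_size K x j z)"
    by (rule mult_left_mono) (rule M(2))
  with w show ?thesis by (rule order_trans)
qed

lemma greedy_weight_cell_le:
  fixes x :: "int ^ 'd \<Rightarrow> real"
  assumes M: "\<And>v. x v \<le> M" "0 \<le> M" and g: "good K x j 0"
  shows "greedy_weight x (3 ^ j) \<le> max (M * ((3 ^ CARD('d)) ^ j - cluster_size K x j 0)) (cell_score K x j 0)"
proof -
  obtain \<xi> where \<xi>: "lattice_animal \<xi>" "\<xi> \<subseteq> lattice_box (3 ^ j)" "greedy_weight x (3 ^ j) = weight x \<xi>"
    using greedy_weight_attained[of "3 ^ j" x] by auto
  have sub: "\<xi> \<subseteq> cell j 0" using \<xi>(2) by (simp add: cell_at_origin)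
  show ?thesis
  proof (cases "\<xi> \<inter> cluster K x j 0 = {}")
    case True
    then have "weight x \<xi> \<le> M * (\<Sum>z\<in>{0}. (3 ^ CARD('d)) ^ j - cluster_size K x j z)"
      using sub g by (intro weight_outside_clusters_le[OF M]) auto
    then show ?thesis using \<xi>(3) by simp
  next
    case False
    then have "admissible K x j 0 \<xi>" using \<xi>(1) sub g by (simp add: admissible_def)
    then show ?thesis using cell_score_ge[of K x j 0 \<xi>] \<xi>(3) by simp
  qed
qed

text \<open>
  If the optimal animal of the small box meets a cluster, it can be joined to the best animals of the
  cells in the rest of the larger box, which gives a competitor there.  So an upper bound for the larger box
  yields one for the smaller.
\<close>

lemma greedy_weight_box_le:
  fixes x :: "int ^ 'd \<Rightarrow> real"
  assumes d: "CARD('d) \<ge> 2" and K: "0 \<le> K" and M: "\<And>v. x v \<le> M" "0 \<le> M" and s: "s \<ge> 1" "s \<le> t"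
    and g: "\<And>z. z \<in> lattice_box t \<Longrightarrow> good K x j z"
  shows "greedy_weight x (s * 3 ^ j) \<le> max
    (M * (\<Sum>z\<in>lattice_box s. (3 ^ CARD('d)) ^ j - cluster_size K x j z))
    (greedy_weight x (t * 3 ^ j) - (\<Sum>z\<in>lattice_box t - lattice_box s. cell_score K x j z)
      + K * (2 * t ^ CARD('d) * (3 ^ CARD('d) - 1) ^ j))"
proof -
  let ?Bs = "lattice_box s :: (int ^ 'd) set" and ?Bt = "lattice_box t :: (int ^ 'd) set"
  have st: "?Bs \<subseteq> ?Bt" by (rule lattice_box_mono[OF s(2)])
  obtain \<xi>0 where \<xi>0: "lattice_animal \<xi>0" "\<xi>0 \<subseteq> lattice_box (s * 3 ^ j)" "greedy_weight x (s * 3 ^ j) = weight x \<xi>0"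
    using greedy_weight_attained[of "s * 3 ^ j" x] s by auto
  have sub0: "\<xi>0 \<subseteq> (\<Union>z\<in>?Bs. cell j z)" using \<xi>0(2) by (simp add: lattice_box_conv_cells)
  show ?thesis
  proof (cases "\<forall>z\<in>?Bs. \<xi>0 \<inter> cluster K x j z = {}")
    case True
    then have "weight x \<xi>0 \<le> M * (\<Sum>z\<in>?Bs. (3 ^ CARD('d)) ^ j - cluster_size K x j z)"
      using sub0 g st by (intro weight_outside_clusters_le[OF M]) auto
    then show ?thesis using \<xi>0(3) by simp
  next
    case False
    then obtain z0 where z0: "z0 \<in> ?Bs" "\<xi>0 \<inter> cluster K x j z0 \<noteq> {}" by auto
    have "\<forall>c. \<exists>\<xi>. cell_score K x j c = weight x \<xi> \<and> (\<xi> = {} \<or> admissible K x j c \<xi>)"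
      using cell_score_attained by metis
    then obtain \<xi> where \<xi>: "\<And>c. cell_score K x j c = weight x (\<xi> c)" "\<And>c. \<xi> c = {} \<or> admissible K x j c (\<xi> c)"
      by metis
    \<comment> \<open>The optimal animal extends over many cells; it is listed at \<open>z0\<close>, where it meets the cluster, and all
      other cells of the small box carry no animal.\<close>
    define \<psi> where "\<psi> c = (if c = z0 then \<xi>0 else if c \<in> ?Bs then {} else \<xi> c)" for c
    have sub: "\<xi> c \<subseteq> cell j c" for c using \<xi>(2)[of c] by (auto simp: admissible_def)
    have out: "\<xi>0 \<inter> \<xi> c = {}" if "c \<notin> ?Bs" for c
    proof (rule ccontr)
      assume "\<xi>0 \<inter> \<xi> c \<noteq> {}"
      then obtain v z where "v \<in> \<xi> c" "z \<in> ?Bs" "v \<in> cell j z" using sub0 by blast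
      moreover have "z \<noteq> c" using that \<open>z \<in> ?Bs\<close> by blast
      ultimately show False using sub[of c] cell_disjoint[of z c j] by blast
    qed
    obtain \<zeta> where \<zeta>: "lattice_animal \<zeta>" "\<zeta> \<subseteq> (\<Union>c\<in>?Bt. cluster K x j c \<union> \<psi> c)"
      "(\<Sum>c\<in>?Bt. weight x (\<psi> c)) - K * (2 * card ?Bt * (3 ^ CARD('d) - 1) ^ j) \<le> weight x \<zeta>"
    proof (rule join_animals[OF d K, of ?Bt x j \<psi>])
      show "lattice_connected ?Bt" by (rule lattice_connected_box)
      show "?Bt \<noteq> {}" using z0 st by auto
      show "\<psi> c = {} \<or> lattice_animal (\<psi> c) \<and> \<psi> c \<inter> cluster K x j c \<noteq> {}" for c
        using \<xi>(2)[of c] z0(2) \<xi>0(1) by (auto simp: admissible_def \<psi>_def)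
      show "\<psi> c \<inter> \<psi> c' = {}" if "c \<noteq> c'" for c c'
        using sub[of c] sub[of c'] cell_disjoint[OF that, of j] out[of c] out[of c'] that
        unfolding \<psi>_def by (auto split: if_splits)
    qed (use g in auto)
    have "cluster K x j c \<union> \<psi> c \<subseteq> lattice_box (t * 3 ^ j)" if "c \<in> ?Bt" for c
    proof -
      have "cell j c \<subseteq> lattice_box (t * 3 ^ j)" using that by (auto simp: lattice_box_conv_cells)
      moreover have "\<xi>0 \<subseteq> lattice_box (t * 3 ^ j)" using sub0 st by (auto simp: lattice_box_conv_cells)
      moreover have "cluster K x j c \<subseteq> cell j c" by (rule cluster_subset_cell)
      ultimately show ?thesis using sub[of c] by (auto simp: \<psi>_def)
    qed
    then have "\<zeta> \<subseteq> lattice_box (t * 3 ^ j)" using \<zeta>(2) by blast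
    then have "weight x \<zeta> \<le> greedy_weight x (t * 3 ^ j)" by (rule greedy_weight_ge[OF \<zeta>(1)])
    moreover have "(\<Sum>c\<in>?Bt. weight x (\<psi> c)) = weight x \<xi>0 + (\<Sum>z\<in>?Bt - ?Bs. cell_score K x j z)"
    proof -
      have "(\<Sum>c\<in>?Bt. weight x (\<psi> c)) = (\<Sum>c\<in>?Bt - ?Bs. weight x (\<psi> c)) + (\<Sum>c\<in>?Bs. weight x (\<psi> c))"
        using st by (rule sum.subset_diff) simp
      also have "(\<Sum>c\<in>?Bs. weight x (\<psi> c)) = (\<Sum>c\<in>?Bs. if c = z0 then weight x \<xi>0 else 0)"
        by (rule sum.cong) (auto simp: \<psi>_def)
      also have "\<dots> = weight x \<xi>0" using z0(1) by simp
      also have "(\<Sum>c\<in>?Bt - ?Bs. weight x (\<psi> c)) = (\<Sum>c\<in>?Bt - ?Bs. cell_score K x j c)"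
        using z0(1) by (intro sum.cong) (auto simp: \<psi>_def \<xi>(1))
      finally show ?thesis by simp
    qed
    ultimately show ?thesis using \<zeta>(3) \<xi>0(3) by (simp add: card_lattice_box of_nat_diff)
  qed
qed

section \<open>Translations and locality\<close>

text \<open>
  Translating the index of a cell by \<open>w\<close> translates its sites by \<open>3^j w\<close>.  Goodness, clusters and scores follow, so in an
  independent, identically distributed field all cells of one scale have the same law.
\<close>

lemma cell_translate: "cell j (z + w) = (\<lambda>v. v + 3 ^ j *s w) ` cell j z"
proof -
  have "v + 3 ^ j *s w \<in> cell j (z + w)" if "v \<in> cell j z" for v z w :: "int ^ 'a"
    using that by (simp add: cell_def)
  note * = this
  show ?thesis
  proof (intro equalityI subsetI)
    fix v assume "v \<in> cell j (z + w)"
    from *[OF this, of "- w"] have "v + 3 ^ j *s (- w) \<in> cell j z" by simp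
    moreover have "v = (v + 3 ^ j *s (- w)) + 3 ^ j *s w" by (simp add: vec_eq_iff)
    ultimately show "v \<in> (\<lambda>v. v + 3 ^ j *s w) ` cell j z" by blast
  qed (use * in auto)
qed

lemma good_translate: "good K x j (z + w) = good K (\<lambda>v. x (v + 3 ^ j *s w)) j z"
proof (induction j arbitrary: z w)
  case (Suc j)
  have "good K x j (c + 3 *s w) = good K (\<lambda>v. x (v + 3 ^ Suc j *s w)) j c" for c
    using Suc.IH[of c "3 *s w"] by (simp add: mult.commute)
  then have "{c \<in> cell 1 (z + w). \<not> good K x j c}
    = (\<lambda>c. c + 3 *s w) ` {c \<in> cell 1 z. \<not> good K (\<lambda>v. x (v + 3 ^ Suc j *s w)) j c}"
    by (auto simp: cell_translate)
  then have "card {c \<in> cell 1 (z + w). \<not> good K x j c}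
    = card {c \<in> cell 1 z. \<not> good K (\<lambda>v. x (v + 3 ^ Suc j *s w)) j c}"
    by (simp add: card_image)
  then show ?case by simp
qed simp

lemma cluster_translate:
  "cluster K x j (z + w) = (\<lambda>v. v + 3 ^ j *s w) ` cluster K (\<lambda>v. x (v + 3 ^ j *s w)) j z"
proof (induction j arbitrary: z w)
  case (Suc j)
  have "good K x j (c + 3 *s w) = good K (\<lambda>v. x (v + 3 ^ Suc j *s w)) j c" for c
    using good_translate[of K x j c "3 *s w"] by (simp add: mult.commute)
  then have sets: "{c \<in> cell 1 (z + w). good K x j c}
    = (\<lambda>c. c + 3 *s w) ` {c \<in> cell 1 z. good K (\<lambda>v. x (v + 3 ^ Suc j *s w)) j c}"
    by (auto simp: cell_translate)
  have "cluster K x j (c + 3 *s w)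
    = (\<lambda>v. v + 3 ^ Suc j *s w) ` cluster K (\<lambda>v. x (v + 3 ^ Suc j *s w)) j c" for c
    using Suc.IH[of c "3 *s w"] by (simp add: mult.commute)
  then show ?case by (simp only: cluster.simps sets) auto
qed simp

lemma nearest_neighbour_translate [simp]:
  "nearest_neighbour (u + w) (v + w) \<longleftrightarrow> nearest_neighbour u v"
  by (simp add: nearest_neighbour_def)

lemma lattice_animal_translate: "lattice_animal ((\<lambda>v. v + w) ` \<xi>) \<longleftrightarrow> lattice_animal \<xi>"
proof -
  have conn: "lattice_connected ((\<lambda>v. v + w) ` \<xi>)" if c: "lattice_connected \<xi>" for w and \<xi> :: "(int ^ 'a) set"
  proof -
    have "(step_within ((\<lambda>v. v + w) ` \<xi>))\<^sup>*\<^sup>* (u + w) (v + w)" if "(step_within \<xi>)\<^sup>*\<^sup>* u v" for u v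
      using that
    proof (induction rule: rtranclp_induct)
      case (step y z)
      then show ?case by (auto intro: rtranclp.rtrancl_into_rtrancl)
    qed simp
    with c show ?thesis by (auto simp: lattice_connected_def)
  qed
  have "(\<lambda>v. v + - w) ` (\<lambda>v. v + w) ` \<xi> = \<xi>" by (simp add: image_image)
  with conn[of \<xi> w] conn[of "(\<lambda>v. v + w) ` \<xi>" "- w"]
  have "lattice_connected ((\<lambda>v. v + w) ` \<xi>) \<longleftrightarrow> lattice_connected \<xi>" by auto
  moreover have "finite ((\<lambda>v. v + w) ` \<xi>) \<longleftrightarrow> finite \<xi>" by (simp add: finite_image_iff)
  ultimately show ?thesis by (simp add: lattice_animal_def)
qed

lemma weight_translate: "weight x ((\<lambda>v. v + w) ` \<xi>) = weight (\<lambda>v. x (v + w)) \<xi>"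
  unfolding weight_def by (subst sum.reindex) (auto simp: inj_on_def)

lemma cell_score_translate: "cell_score K x j (z + w) = cell_score K (\<lambda>v. x (v + 3 ^ j *s w)) j z"
proof -
  let ?\<tau> = "\<lambda>v. v + 3 ^ j *s w" and ?y = "\<lambda>v. x (v + 3 ^ j *s w)"
  have inj: "inj ?\<tau>" by (simp add: inj_def)
  have "admissible K x j (z + w) (?\<tau> ` \<xi>) \<longleftrightarrow> admissible K ?y j z \<xi>" for \<xi>
  proof -
    have "?\<tau> ` \<xi> \<subseteq> cell j (z + w) \<longleftrightarrow> \<xi> \<subseteq> cell j z"
      unfolding cell_translate by (rule inj_image_subset_iff[OF inj])
    moreover have "?\<tau> ` \<xi> \<inter> cluster K x j (z + w) = ?\<tau> ` (\<xi> \<inter> cluster K ?y j z)"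
      unfolding cluster_translate by (rule image_Int[OF inj, symmetric])
    ultimately show ?thesis
      by (simp add: admissible_def good_translate lattice_animal_translate)
  qed
  then have "(\<lambda>\<xi>. if admissible K x j (z + w) \<xi> then weight x \<xi> else 0) ` Pow (cell j (z + w))
    = (\<lambda>\<xi>. if admissible K ?y j z \<xi> then weight ?y \<xi> else 0) ` Pow (cell j z)"
    unfolding cell_translate image_Pow_surj[OF refl, symmetric] image_image by (simp add: weight_translate)
  then show ?thesis by (simp add: cell_score_def)
qed

lemma cluster_size_translate: "cluster_size K x j (z + w) = cluster_size K (\<lambda>v. x (v + 3 ^ j *s w)) j z"
  by (simp add: cluster_size_def good_translate cluster_translate card_image)

text \<open>
  Goodness, cluster and score of a cell are functions of the weights inside the cell.  Hence they are independent for distinct cells of one scale.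
\<close>

lemma good_local:
  "(\<And>v. v \<in> cell j z \<Longrightarrow> x v = y v) \<Longrightarrow> good K x j z = good K y j z"
proof (induction j arbitrary: z)
  case (Suc j)
  have "good K x j c = good K y j c" if "c \<in> cell 1 z" for c
    using that Suc.prems unfolding cell_Suc by (intro Suc.IH) auto
  then have "{c \<in> cell 1 z. \<not> good K x j c} = {c \<in> cell 1 z. \<not> good K y j c}" by auto
  then show ?case by simp
qed simp

lemma cluster_local:
  "(\<And>v. v \<in> cell j z \<Longrightarrow> x v = y v) \<Longrightarrow> cluster K x j z = cluster K y j z"
proof (induction j arbitrary: z)
  case (Suc j)
  have eq: "x v = y v" if "c \<in> cell 1 z" "v \<in> cell j c" for c v
    using that Suc.prems unfolding cell_Suc by auto
  have "{c \<in> cell 1 z. good K x j c} = {c \<in> cell 1 z. good K y j c}"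
    using good_local[of j _ x y K] eq by auto
  moreover have "cluster K x j c = cluster K y j c" if "c \<in> cell 1 z" for c
    using eq[OF that] by (rule Suc.IH)
  ultimately show ?case by auto
qed simp

lemma cell_score_local:
  assumes "\<And>v. v \<in> cell j z \<Longrightarrow> x v = y v"
  shows "cell_score K x j z = cell_score K y j z"
proof -
  have "admissible K x j z \<xi> = admissible K y j z \<xi>" for \<xi>
    using assms by (simp add: admissible_def good_local[of j z x y] cluster_local[of j z x y])
  moreover have "weight x \<xi> = weight y \<xi>" if "\<xi> \<subseteq> cell j z" for \<xi>
    using assms that unfolding weight_def by (intro sum.cong) auto
  ultimately show ?thesis
    unfolding cell_score_def by (intro arg_cong[where f = Max] image_cong) auto
qed

lemma cluster_size_local:
  assumes "\<And>v. v \<in> cell j z \<Longrightarrow> x v = y v"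
  shows "cluster_size K x j z = cluster_size K y j z"
  using assms by (simp add: cluster_size_def good_local[of j z x y] cluster_local[of j z x y])

section \<open>Measurability\<close>

abbreviation field_space :: "(int ^ 'd \<Rightarrow> real) measure" where
  "field_space \<equiv> PiM UNIV (\<lambda>_. borel)"

lemma measurable_coordinate [measurable]: "(\<lambda>x. x v) \<in> borel_measurable field_space"
  by (rule measurable_component_singleton) simp

lemma measurable_good [measurable]: "Measurable.pred field_space (\<lambda>x. good K x j z)"
proof (induction j arbitrary: z)
  case (Suc j)
  have "good K x (Suc j) z \<longleftrightarrow> (\<forall>a\<in>cell 1 z. \<forall>b\<in>cell 1 z. a \<noteq> b \<longrightarrow> good K x j a \<or> good K x j b)" for x
    by (simp add: card_le_Suc0_iff_eq) blast
  moreover have "Measurable.pred field_space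
      (\<lambda>x. \<forall>a\<in>cell 1 z. \<forall>b\<in>cell 1 z. a \<noteq> b \<longrightarrow> good K x j a \<or> good K x j b)"
    using Suc.IH by (intro pred_intros_finite pred_intros_logic) auto
  ultimately show ?case by simp
qed simp

lemma measurable_in_cluster [measurable]: "Measurable.pred field_space (\<lambda>x. v \<in> cluster K x j z)"
proof (induction j arbitrary: z)
  case (Suc j)
  have "v \<in> cluster K x (Suc j) z \<longleftrightarrow> (\<exists>c\<in>cell 1 z. good K x j c \<and> v \<in> cluster K x j c)" for x
    by auto
  moreover have "Measurable.pred field_space (\<lambda>x. \<exists>c\<in>cell 1 z. good K x j c \<and> v \<in> cluster K x j c)"
    using Suc.IH by (intro pred_intros_finite pred_intros_logic measurable_good) auto
  ultimately show ?case by simp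
qed simp

lemma measurable_weight [measurable]: "(\<lambda>x. weight x \<xi>) \<in> borel_measurable field_space"
  unfolding weight_def by measurable

lemma measurable_cell_score [measurable]: "(\<lambda>x. cell_score K x j z) \<in> borel_measurable field_space"
proof -
  have [measurable]: "Measurable.pred field_space (\<lambda>x. admissible K x j z \<xi>)" for \<xi>
  proof (cases "finite \<xi>")
    case True
    have "admissible K x j z \<xi> \<longleftrightarrow> good K x j z \<and> lattice_animal \<xi> \<and> \<xi> \<subseteq> cell j z \<and> (\<exists>v\<in>\<xi>. v \<in> cluster K x j z)" for x
      by (auto simp: admissible_def)
    moreover have "Measurable.pred field_space (\<lambda>x. \<exists>v\<in>\<xi>. v \<in> cluster K x j z)"
      using True by (intro pred_intros_finite measurable_in_cluster)
    ultimately show ?thesis by simp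
  qed (simp add: admissible_def lattice_animal_def)
  show ?thesis unfolding cell_score_def by (intro borel_measurable_Max) auto
qed

lemma measurable_cluster_size [measurable]: "(\<lambda>x. cluster_size K x j z) \<in> borel_measurable field_space"
proof -
  have "real (card (cluster K x j z)) = (\<Sum>v\<in>cell j z. if v \<in> cluster K x j z then 1 else 0)" for x
    using cluster_subset_cell[of K x j z] by (simp add: sum.If_cases Int_absorb1)
  then have "cluster_size K x j z = (if good K x j z then (\<Sum>v\<in>cell j z. if v \<in> cluster K x j z then 1 else 0) else 0)" for x
    by (simp add: cluster_size_def)
  then show ?thesis by simp
qed

section \<open>Independent, identically distributed fields\<close>

text \<open>
  By monotone convergence the sum of the \<open>f j\<close> has a finite expectation, so it is finite almost surely.
\<close>

lemma (in prob_space) AE_LIMSEQ_zero_of_summable_expectations: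
  fixes f :: "nat \<Rightarrow> 'a \<Rightarrow> real"
  assumes f: "\<And>j. integrable M (f j)" "\<And>j x. 0 \<le> f j x" and s: "summable (\<lambda>j. expectation (f j))"
  shows "AE x in M. (\<lambda>j. f j x) \<longlonglongrightarrow> 0"
proof -
  have [measurable]: "f j \<in> borel_measurable M" for j using f(1) by auto
  have "(\<integral>\<^sup>+x. (\<Sum>j. ennreal (f j x)) \<partial>M) = (\<Sum>j. \<integral>\<^sup>+x. ennreal (f j x) \<partial>M)"
    by (rule nn_integral_suminf) simp
  also have "\<dots> = (\<Sum>j. ennreal (expectation (f j)))"
    by (intro arg_cong[where f = suminf] ext nn_integral_eq_integral f AE_I2)
  also have "\<dots> = ennreal (\<Sum>j. expectation (f j))"
    by (rule suminf_ennreal2) (use s f(2) in auto)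
  finally have "(\<integral>\<^sup>+x. (\<Sum>j. ennreal (f j x)) \<partial>M) \<noteq> \<infinity>" by simp
  then have "AE x in M. (\<Sum>j. ennreal (f j x)) \<noteq> \<infinity>" by (intro nn_integral_PInf_AE) auto
  then show ?thesis
  proof eventually_elim
    case (elim x)
    then have "summable (\<lambda>j. f j x)" using f(2) by (intro summable_suminf_not_top) auto
    then show ?case by (rule summable_LIMSEQ_zero)
  qed
qed

locale iid_field = real_distribution F for F :: "real measure" +
  fixes P :: "(int ^ 'd::finite \<Rightarrow> real) measure"
  assumes P_eq: "P = PiM UNIV (\<lambda>_. F)"
begin

sublocale P: prob_space P
  unfolding P_eq by (intro prob_space_PiM prob_space_axioms)

lemma sets_P [measurable_cong, simp]: "sets P = sets field_space"
  unfolding P_eq by (intro sets_PiM_cong) auto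

lemma space_P [simp]: "space P = UNIV"
  unfolding P_eq by (simp add: space_PiM)

lemma integrable_bounded:
  assumes "f \<in> borel_measurable P" "\<And>x. \<bar>f x\<bar> \<le> (B :: real)"
  shows "integrable P f"
  using assms by (intro P.integrable_const_bound[of _ B]) auto

lemma expectation_translate:
  assumes f: "f \<in> borel_measurable P"
  shows "P.expectation (\<lambda>x. f (\<lambda>v. x (v + w))) = (P.expectation f :: real)"
proof -
  have m: "(\<lambda>x v. x (v + w)) \<in> measurable P P"
  proof -
    have "(\<lambda>x v. x (v + w)) \<in> measurable P field_space" by (rule measurable_abs_UNIV) measurable
    then show ?thesis by (simp add: measurable_cong_sets[OF refl sets_P])
  qed
  have "distr P P (\<lambda>x v. x (v + w)) = P"
    using distr_PiM_reindex[of UNIV "\<lambda>_. F" "\<lambda>v. v + w" UNIV] prob_space_axioms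
    by (simp add: P_eq inj_def restrict_UNIV)
  then have "P.expectation f = integral\<^sup>L (distr P P (\<lambda>x v. x (v + w))) f" by simp
  also have "\<dots> = P.expectation (\<lambda>x. f (\<lambda>v. x (v + w)))"
    by (rule integral_distr[OF m f])
  finally show ?thesis by simp
qed

lemma expectation_coordinate:
  assumes f: "f \<in> borel_measurable borel"
  shows "P.expectation (\<lambda>x. f (x v)) = (expectation f :: real)"
proof -
  have "distr P F (\<lambda>x. x v) = F"
    unfolding P_eq by (rule distr_PiM_component) (auto intro: prob_space_axioms)
  then have "expectation f = integral\<^sup>L (distr P F (\<lambda>x. x v)) f" by simp
  also have "\<dots> = P.expectation (\<lambda>x. f (x v))"
    by (rule integral_distr) (use f in \<open>auto simp: measurable_cong_sets[OF refl events_eq_borel]\<close>)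
  finally show ?thesis by simp
qed

lemma indep_coordinates: "P.indep_vars (\<lambda>_. borel) (\<lambda>v x. x v) UNIV"
proof (subst P.indep_vars_iff_distr_eq_PiM)
  have dist: "distr P borel (\<lambda>x. x v) = F" for v
  proof -
    have "distr P borel (\<lambda>x. x v) = distr P F (\<lambda>x. x v)" by (rule distr_cong) auto
    also have "\<dots> = F"
      unfolding P_eq by (rule distr_PiM_component) (auto intro: prob_space_axioms)
    finally show ?thesis .
  qed
  have "distr P field_space (\<lambda>x. restrict x UNIV) = distr P P (\<lambda>x. x)"
    by (rule distr_cong) auto
  also have "\<dots> = P" by (rule distr_id2) simp
  finally show "distr P field_space (\<lambda>x. \<lambda>v\<in>UNIV. x v) = PiM UNIV (\<lambda>v. distr P borel (\<lambda>x. x v))"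
    by (simp only: dist P_eq[symmetric])
qed auto

text \<open>
  A functional of the weights in \<open>A\<close> can be evaluated on their restriction to \<open>A\<close>, and the restrictions to disjoint sets are independent.
\<close>

lemma integral_mult_disjoint:
  fixes f g :: "(int ^ 'd \<Rightarrow> real) \<Rightarrow> real"
  assumes f: "f \<in> borel_measurable P" "integrable P f" "\<And>x y. (\<And>v. v \<in> A \<Longrightarrow> x v = y v) \<Longrightarrow> f x = f y"
    and g: "g \<in> borel_measurable P" "integrable P g" "\<And>x y. (\<And>v. v \<in> B \<Longrightarrow> x v = y v) \<Longrightarrow> g x = g y"
    and disj: "A \<inter> B = {}"
  shows "P.expectation (\<lambda>x. f x * g x) = P.expectation f * P.expectation g"
proof -
  have extend: "(\<lambda>y. y) \<in> measurable (PiM A (\<lambda>_. borel)) P" for A :: "(int ^ 'd) set"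
  proof -
    have "(\<lambda>y i. y i) \<in> measurable (PiM A (\<lambda>_. borel)) field_space"
    proof (rule measurable_abs_UNIV)
      fix v
      show "(\<lambda>y. y v) \<in> borel_measurable (PiM A (\<lambda>_. borel :: real measure))"
      proof (cases "v \<in> A")
        case True
        then show ?thesis by (rule measurable_component_singleton)
      next
        case False
        have "(\<lambda>y. undefined :: real) \<in> borel_measurable (PiM A (\<lambda>_. borel :: real measure))" by simp
        then show ?thesis
          by (rule measurable_cong[THEN iffD1, rotated]) (use False in \<open>auto simp: space_PiM PiE_def extensional_def\<close>)
      qed
    qed
    then show ?thesis by (simp add: measurable_cong_sets[OF refl sets_P])
  qed
  have "P.indep_var borel (f \<circ> (\<lambda>x. restrict (\<lambda>v. x v) A)) borel (g \<circ> (\<lambda>x. restrict (\<lambda>v. x v) B))"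
    by (rule P.indep_var_compose[OF P.indep_var_restrict[OF indep_coordinates disj]])
       (use measurable_compose[OF extend f(1)] measurable_compose[OF extend g(1)] in auto)
  moreover have "f \<circ> (\<lambda>x. restrict (\<lambda>v. x v) A) = f" by (rule ext) (auto intro!: f(3))
  moreover have "g \<circ> (\<lambda>x. restrict (\<lambda>v. x v) B) = g" by (rule ext) (auto intro!: g(3))
  ultimately have "P.indep_var borel f borel g" by simp
  then show ?thesis using f(2) g(2) by (rule P.indep_var_lebesgue_integral)
qed

lemma expectation_sum_square:
  fixes f :: "'i \<Rightarrow> (int ^ 'd \<Rightarrow> real) \<Rightarrow> real"
  assumes I: "finite I" and m: "\<And>i. i \<in> I \<Longrightarrow> f i \<in> borel_measurable P"
    and sq: "\<And>i. i \<in> I \<Longrightarrow> integrable P (\<lambda>x. (f i x)\<^sup>2)"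
    and loc: "\<And>i x y. i \<in> I \<Longrightarrow> (\<And>v. v \<in> A i \<Longrightarrow> x v = y v) \<Longrightarrow> f i x = f i y"
    and disj: "\<And>i j. i \<in> I \<Longrightarrow> j \<in> I \<Longrightarrow> i \<noteq> j \<Longrightarrow> A i \<inter> A j = {}"
    and mean: "\<And>i. i \<in> I \<Longrightarrow> P.expectation (f i) = 0"
  shows "integrable P (\<lambda>x. (\<Sum>i\<in>I. f i x)\<^sup>2)"
    and "P.expectation (\<lambda>x. (\<Sum>i\<in>I. f i x)\<^sup>2) = (\<Sum>i\<in>I. P.expectation (\<lambda>x. (f i x)\<^sup>2))"
proof -
  have int: "integrable P (f i)" if "i \<in> I" for i
    using P.square_integrable_imp_integrable[OF m sq] that by auto
  have prod: "integrable P (\<lambda>x. f i x * f j x)" if "i \<in> I" "j \<in> I" for i j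
  proof (rule Bochner_Integration.integrable_bound)
    show "integrable P (\<lambda>x. (f i x)\<^sup>2 + (f j x)\<^sup>2)" using sq that by auto
    show "(\<lambda>x. f i x * f j x) \<in> borel_measurable P" using m that by auto
    have "\<bar>a * b\<bar> \<le> a\<^sup>2 + b\<^sup>2" for a b :: real
    proof -
      have "2 * \<bar>a\<bar> * \<bar>b\<bar> \<le> a\<^sup>2 + b\<^sup>2" using sum_squares_bound[of "\<bar>a\<bar>" "\<bar>b\<bar>"] by simp
      moreover have "0 \<le> \<bar>a\<bar> * \<bar>b\<bar>" by simp
      ultimately show ?thesis unfolding abs_mult by linarith
    qed
    then show "AE x in P. norm (f i x * f j x) \<le> norm ((f i x)\<^sup>2 + (f j x)\<^sup>2)" by simp
  qed
  have eq: "(\<lambda>x. (\<Sum>i\<in>I. f i x)\<^sup>2) = (\<lambda>x. \<Sum>i\<in>I. \<Sum>j\<in>I. f i x * f j x)"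
    by (simp add: power2_eq_square sum_product)
  show "integrable P (\<lambda>x. (\<Sum>i\<in>I. f i x)\<^sup>2)" unfolding eq using prod by auto
  have "P.expectation (\<lambda>x. (\<Sum>i\<in>I. f i x)\<^sup>2) = (\<Sum>i\<in>I. \<Sum>j\<in>I. P.expectation (\<lambda>x. f i x * f j x))"
    unfolding eq using prod by (simp add: Bochner_Integration.integral_sum)
  also have "\<dots> = (\<Sum>i\<in>I. \<Sum>j\<in>I. if j = i then P.expectation (\<lambda>x. (f i x)\<^sup>2) else 0)"
  proof (intro sum.cong refl)
    fix i j assume ij: "i \<in> I" "j \<in> I"
    show "P.expectation (\<lambda>x. f i x * f j x) = (if j = i then P.expectation (\<lambda>x. (f i x)\<^sup>2) else 0)"
    proof (cases "j = i")
      case False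
      have "P.expectation (\<lambda>x. f i x * f j x) = P.expectation (f i) * P.expectation (f j)"
      proof (rule integral_mult_disjoint[where A = "A i" and B = "A j"])
        show "A i \<inter> A j = {}" by (rule disj[OF ij]) (use False in simp)
        show "f i x = f i y" if "\<And>v. v \<in> A i \<Longrightarrow> x v = y v" for x y by (rule loc[OF ij(1) that])
        show "f j x = f j y" if "\<And>v. v \<in> A j \<Longrightarrow> x v = y v" for x y by (rule loc[OF ij(2) that])
      qed (simp_all add: ij m int)
      then show ?thesis using mean ij False by simp
    qed (simp add: power2_eq_square)
  qed
  also have "\<dots> = (\<Sum>i\<in>I. P.expectation (\<lambda>x. (f i x)\<^sup>2))" using I by simp
  finally show "P.expectation (\<lambda>x. (\<Sum>i\<in>I. f i x)\<^sup>2) = (\<Sum>i\<in>I. P.expectation (\<lambda>x. (f i x)\<^sup>2))" .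
qed

end

section \<open>Almost superadditive cell functionals converge\<close>

context iid_field
begin

text \<open>
  Let \<open>\<phi> j\<close> be the density of \<open>\<Phi> j\<close>.  Then \<open>\<phi> (Suc j) 0 = S j + R j\<close>, where \<open>S j\<close> averages over the children and
  \<open>R j \<ge> - e j\<close>.  Since \<open>R j + 2 * e j\<close> dominates \<open>\<bar>R j\<bar>\<close> and the expectation of \<open>R j\<close> is the increment of the
  means \<open>a j\<close>, the expectations of \<open>\<bar>R j\<bar>\<close>, and as \<open>R j\<close> is bounded those of \<open>(R j)\<^sup>2\<close>, are summable.  The children are
  independent, so the variance of \<open>S j\<close> is that of \<open>\<phi> j\<close> divided by \<open>3^d \<ge> 9\<close>.
\<close>

lemma cell_functional_converges:
  fixes \<Phi> :: "nat \<Rightarrow> int ^ 'd \<Rightarrow> (int ^ 'd \<Rightarrow> real) \<Rightarrow> real"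
    and e :: "nat \<Rightarrow> (int ^ 'd \<Rightarrow> real) \<Rightarrow> real"
  assumes d: "CARD('d) \<ge> 2"
    and meas: "\<And>j z. \<Phi> j z \<in> borel_measurable P"
    and loc: "\<And>j z x y. (\<And>v. v \<in> cell j z \<Longrightarrow> x v = y v) \<Longrightarrow> \<Phi> j z x = \<Phi> j z y"
    and trans: "\<And>j z x. \<Phi> j z x = \<Phi> j 0 (\<lambda>v. x (v + 3 ^ j *s z))"
    and bounds: "\<And>j z x. 0 \<le> \<Phi> j z x" "\<And>j z x. \<Phi> j z x \<le> M * (3 ^ CARD('d)) ^ j"
    and e: "\<And>j. integrable P (e j)" "\<And>j x. 0 \<le> e j x" "summable (\<lambda>j. P.expectation (e j))"
    and super: "\<And>j x. (\<Sum>c\<in>cell 1 0. \<Phi> j c x) - (3 ^ CARD('d)) ^ Suc j * e j x \<le> \<Phi> (Suc j) 0 x"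
  obtains \<gamma> where "0 \<le> \<gamma>" "P.expectation (\<Phi> 0 0) - (\<Sum>j. P.expectation (e j)) \<le> \<gamma>"
    "\<And>z. AE x in P. (\<lambda>j. \<Phi> j z x / (3 ^ CARD('d)) ^ j) \<longlonglongrightarrow> \<gamma>"
proof -
  define N :: real where "N = 3 ^ CARD('d)"
  have N: "9 \<le> N"
  proof -
    have "(3::real) ^ 2 \<le> 3 ^ CARD('d)" using d by (intro power_increasing) auto
    then show ?thesis by (simp add: N_def)
  qed
  have N0: "0 < N" using N by simp
  define \<phi> where "\<phi> j z x = \<Phi> j z x / N ^ j" for j z x
  define a where "a j = P.expectation (\<phi> j 0)" for j
  define \<eta> where "\<eta> j = P.expectation (e j)" for j
  define S where "S j x = (\<Sum>c\<in>cell 1 0. \<phi> j c x) / N" for j x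
  define R where "R j x = \<phi> (Suc j) 0 x - S j x" for j x
  have M0: "0 \<le> M" using order_trans[OF bounds(1)[of 0 0 undefined] bounds(2)[of 0 0 undefined]] by simp
  have meas\<phi> [measurable]: "\<phi> j z \<in> borel_measurable P" for j z
    unfolding \<phi>_def using meas by measurable
  have \<phi>b: "0 \<le> \<phi> j z x" "\<phi> j z x \<le> M" for j z x
    using bounds[of j z x] N0 by (auto simp: \<phi>_def N_def[symmetric] divide_simps)
  have cardN: "real (card (cell 1 (0 :: int ^ 'd))) = N" by (simp add: card_cell N_def)
  have Sb: "0 \<le> S j x" "S j x \<le> M" for j x
  proof -
    show "0 \<le> S j x" using N0 \<phi>b by (auto simp: S_def intro!: divide_nonneg_pos sum_nonneg)
    have "(\<Sum>c\<in>cell 1 0. \<phi> j c x) \<le> real (card (cell 1 (0 :: int ^ 'd))) * M"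
      by (rule sum_bounded_above) (rule \<phi>b)
    then show "S j x \<le> M" unfolding cardN S_def using N0 by (simp add: divide_simps mult.commute)
  qed
  have measS [measurable]: "S j \<in> borel_measurable P" for j unfolding S_def by measurable
  have measR [measurable]: "R j \<in> borel_measurable P" for j unfolding R_def by measurable
  have int\<phi>: "integrable P (\<phi> j z)" for j z
    using \<phi>b by (intro integrable_bounded[of _ M]) auto
  have intS: "integrable P (S j)" for j using Sb by (intro integrable_bounded[of _ M]) auto
  have Rb: "\<bar>R j x\<bar> \<le> M" for j x
    using \<phi>b[of "Suc j" 0 x] Sb[of j x] by (simp add: R_def abs_le_iff)
  have intR: "integrable P (R j)" for j using Rb by (intro integrable_bounded[of _ M]) auto
  have R_lower: "- e j x \<le> R j x" for j x
  proof -
    have "((\<Sum>c\<in>cell 1 0. \<Phi> j c x) - N ^ Suc j * e j x) / N ^ Suc j \<le> \<Phi> (Suc j) 0 x / N ^ Suc j"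
      using super[of j x] N0 by (intro divide_right_mono) (auto simp: N_def)
    moreover have "((\<Sum>c\<in>cell 1 0. \<Phi> j c x) - N ^ Suc j * e j x) / N ^ Suc j = S j x - e j x"
      using N0 by (simp add: S_def \<phi>_def sum_divide_distrib[symmetric] diff_divide_distrib mult.commute)
    ultimately show ?thesis by (simp add: R_def \<phi>_def)
  qed
  have mean\<phi>: "P.expectation (\<phi> j z) = a j" for j z
  proof -
    have "\<phi> j z = (\<lambda>x. \<phi> j 0 (\<lambda>v. x (v + 3 ^ j *s z)))" by (simp add: \<phi>_def fun_eq_iff trans[of j z])
    then show ?thesis using expectation_translate[OF meas\<phi>[of j 0], of "3 ^ j *s z"] by (simp add: a_def)
  qed
  have var\<phi>: "P.expectation (\<lambda>x. (\<phi> j z x - a j)\<^sup>2) = P.expectation (\<lambda>x. (\<phi> j 0 x - a j)\<^sup>2)" for j z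
  proof -
    have "(\<lambda>x. (\<phi> j z x - a j)\<^sup>2) = (\<lambda>x. (\<phi> j 0 (\<lambda>v. x (v + 3 ^ j *s z)) - a j)\<^sup>2)"
      by (simp add: \<phi>_def fun_eq_iff trans[of j z])
    then show ?thesis
      using expectation_translate[of "\<lambda>x. (\<phi> j 0 x - a j)\<^sup>2" "3 ^ j *s z"] by simp
  qed
  have meanS: "P.expectation (S j) = a j" for j
  proof -
    have "P.expectation (S j) = (\<Sum>c\<in>cell 1 (0 :: int ^ 'd). a j) / N"
      unfolding S_def using int\<phi> by (simp add: Bochner_Integration.integral_sum mean\<phi>)
    then show ?thesis using cardN N0 by simp
  qed
  have meanR: "P.expectation (R j) = a (Suc j) - a j" for j
    unfolding R_def using int\<phi> intS by (simp add: mean\<phi> meanS)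
  have ab: "0 \<le> a j" "a j \<le> M" for j
    unfolding a_def using P.integral_ge_const[OF int\<phi>, of 0 j 0] P.integral_le_const[OF int\<phi>, of j 0 M] \<phi>b by auto
  have \<eta>0: "0 \<le> \<eta> j" for j unfolding \<eta>_def using e(2) by (intro Bochner_Integration.integral_nonneg) auto
  have \<eta>s: "summable \<eta>" using e(3) by (simp add: \<eta>_def[abs_def])
  have \<eta>le: "(\<Sum>i<n. \<eta> i) \<le> (\<Sum>i. \<eta> i)" for n
    using \<eta>s \<eta>0 by (intro sum_le_suminf) auto
  have step: "a j - \<eta> j \<le> a (Suc j)" for j
  proof -
    have "- \<eta> j = P.expectation (\<lambda>x. - e j x)" by (simp add: \<eta>_def)
    also have "\<dots> \<le> P.expectation (R j)"
      using R_lower e(1) intR by (intro integral_mono) auto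
    finally show ?thesis by (simp add: meanR)
  qed
  \<comment> \<open>Compensating the means by the accumulated errors makes them monotone.\<close>
  define b where "b n = a n + (\<Sum>i<n. \<eta> i)" for n
  have "incseq b"
  proof (rule incseq_SucI)
    show "b n \<le> b (Suc n)" for n using step[of n] by (simp add: b_def)
  qed
  moreover have "b n \<le> M + (\<Sum>i. \<eta> i)" for n using ab[of n] \<eta>le[of n] by (simp add: b_def)
  ultimately obtain B where B: "b \<longlonglongrightarrow> B" using incseq_convergent[of b] by blast
  define \<gamma> where "\<gamma> = B - (\<Sum>i. \<eta> i)"
  have "(\<lambda>n. b n - (\<Sum>i<n. \<eta> i)) \<longlonglongrightarrow> \<gamma>"
    unfolding \<gamma>_def using B summable_LIMSEQ[OF \<eta>s] by (rule tendsto_diff)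
  then have a\<gamma>: "a \<longlonglongrightarrow> \<gamma>" by (simp add: b_def)
  have \<gamma>0: "0 \<le> \<gamma>" by (rule LIMSEQ_le_const[OF a\<gamma>]) (use ab in auto)
  have "a 0 - (\<Sum>i. \<eta> i) \<le> a n" for n
    using incseqD[OF \<open>incseq b\<close>, of 0 n] \<eta>le[of n] by (simp add: b_def)
  then have \<gamma>a: "a 0 - (\<Sum>i. \<eta> i) \<le> \<gamma>" by (intro LIMSEQ_le_const[OF a\<gamma>]) auto
  define V where "V j = P.expectation (\<lambda>x. (\<phi> j 0 x - a j)\<^sup>2)" for j
  have varV: "P.expectation (\<lambda>x. (\<phi> j z x - a j)\<^sup>2) = V j" for j z
    unfolding V_def by (rule var\<phi>)
  have sqb: "\<bar>(\<phi> j z x - a j)\<^sup>2\<bar> \<le> M\<^sup>2" for j z x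
  proof -
    have "\<bar>\<phi> j z x - a j\<bar> \<le> M" using \<phi>b[of j z x] ab[of j] by (simp add: abs_le_iff)
    then have "\<bar>\<phi> j z x - a j\<bar>\<^sup>2 \<le> M\<^sup>2" by (intro power_mono) auto
    then show ?thesis by simp
  qed
  have intsq: "integrable P (\<lambda>x. (\<phi> j z x - a j)\<^sup>2)" for j z
    using sqb by (intro integrable_bounded[of _ "M\<^sup>2"]) auto
  have V0: "0 \<le> V j" "V j \<le> M\<^sup>2" for j
    unfolding V_def using P.integral_ge_const[OF intsq, of 0 j 0] P.integral_le_const[OF intsq, of j 0 "M\<^sup>2"] sqb
    by (auto simp: abs_le_iff)
  have VS: "integrable P (\<lambda>x. (S j x - a j)\<^sup>2)" "P.expectation (\<lambda>x. (S j x - a j)\<^sup>2) = V j / N" for j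
  proof -
    let ?f = "\<lambda>c x. \<phi> j c x - a j"
    have *: "S j x - a j = (\<Sum>c\<in>cell 1 (0 :: int ^ 'd). ?f c x) / N" for x
      using N0 cardN by (simp add: S_def sum_subtractf diff_divide_distrib)
    have locf: "\<phi> j c x - a j = \<phi> j c y - a j" if "\<And>v. v \<in> cell j c \<Longrightarrow> (x :: int ^ 'd \<Rightarrow> real) v = y v" for c x y
      unfolding \<phi>_def using loc[OF that] by simp
    have meanf: "P.expectation (?f c) = 0" for c
      using int\<phi> P.prob_space by (simp add: mean\<phi>)
    have disjf: "cell j c \<inter> cell j c' = {}" if "c \<noteq> c'" for c c' :: "int ^ 'd"
      using that by (rule cell_disjoint)
    note ess = expectation_sum_square[of "cell 1 (0 :: int ^ 'd)" ?f "cell j", OF finite_cell _ intsq locf disjf meanf]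
    have ess2: "P.expectation (\<lambda>x. (\<Sum>c\<in>cell 1 (0 :: int ^ 'd). ?f c x)\<^sup>2)
        = (\<Sum>c\<in>cell 1 (0 :: int ^ 'd). P.expectation (\<lambda>x. (?f c x)\<^sup>2))"
      by (rule ess(2)) auto
    show "integrable P (\<lambda>x. (S j x - a j)\<^sup>2)"
      unfolding * power_divide by (intro integrable_divide_zero ess(1)) auto
    have "P.expectation (\<lambda>x. (S j x - a j)\<^sup>2) = (\<Sum>c\<in>cell 1 (0 :: int ^ 'd). V j) / N\<^sup>2"
      unfolding * power_divide by (simp only: Bochner_Integration.integral_divide_zero ess2 varV)
    then show "P.expectation (\<lambda>x. (S j x - a j)\<^sup>2) = V j / N"
      using cardN N0 by (simp add: power2_eq_square)
  qed
  define t where "t j = a (Suc j) - a j + 2 * \<eta> j" for j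
  have intR2: "integrable P (\<lambda>x. (R j x)\<^sup>2)" for j
  proof (rule integrable_bounded[of _ "M\<^sup>2"])
    show "\<bar>(R j x)\<^sup>2\<bar> \<le> M\<^sup>2" for x using power_mono[OF Rb[of j x], of 2] by simp
  qed measurable
  have ER2: "P.expectation (\<lambda>x. (R j x)\<^sup>2) \<le> M * t j" for j
  proof -
    have "(R j x)\<^sup>2 \<le> M * (R j x + 2 * e j x)" for x
    proof -
      have "(R j x)\<^sup>2 = \<bar>R j x\<bar> * \<bar>R j x\<bar>" by (simp add: power2_eq_square)
      also have "\<dots> \<le> M * (R j x + 2 * e j x)"
        using Rb[of j x] R_lower[of j x] e(2)[of j x] M0 by (intro mult_mono) (auto simp: abs_if)
      finally show ?thesis .
    qed
    then have "P.expectation (\<lambda>x. (R j x)\<^sup>2) \<le> P.expectation (\<lambda>x. M * (R j x + 2 * e j x))"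
      using intR2 intR e(1) by (intro integral_mono) auto
    also have "\<dots> = M * t j" using intR e(1) by (simp add: t_def meanR \<eta>_def)
    finally show ?thesis .
  qed
  have Vrec: "V (Suc j) \<le> V j / 4 + 2 * M * t j" for j
  proof -
    let ?r = "\<lambda>x. R j x - (a (Suc j) - a j)"
    have ir: "integrable P (\<lambda>x. (?r x)\<^sup>2)"
      using intR intR2 by (simp add: power2_diff)
    have "(\<phi> (Suc j) 0 x - a (Suc j))\<^sup>2 \<le> 2 * (S j x - a j)\<^sup>2 + 2 * (?r x)\<^sup>2" for x
    proof -
      have "\<phi> (Suc j) 0 x - a (Suc j) = (S j x - a j) + ?r x" by (simp add: R_def)
      moreover have "(u + w)\<^sup>2 \<le> 2 * u\<^sup>2 + 2 * w\<^sup>2" for u w :: real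
        using sum_squares_bound[of u w] by (simp add: power2_sum)
      ultimately show ?thesis by metis
    qed
    then have "V (Suc j) \<le> P.expectation (\<lambda>x. 2 * (S j x - a j)\<^sup>2 + 2 * (?r x)\<^sup>2)"
      unfolding V_def using intsq VS(1) ir by (intro integral_mono) auto
    also have "\<dots> = 2 * (V j / N) + 2 * P.expectation (\<lambda>x. (?r x)\<^sup>2)"
      using VS ir by simp
    also have "P.expectation (\<lambda>x. (?r x)\<^sup>2) = P.expectation (\<lambda>x. (R j x)\<^sup>2) - (a (Suc j) - a j)\<^sup>2"
      using P.variance_eq[OF intR intR2, of j] by (simp add: meanR)
    also have "\<dots> \<le> P.expectation (\<lambda>x. (R j x)\<^sup>2)" by simp
    also have "\<dots> \<le> M * t j" by (rule ER2)
    finally have "V (Suc j) \<le> 2 * (V j / N) + 2 * (M * t j)" by simp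
    moreover have "2 * (V j / N) \<le> V j / 4"
    proof -
      have "V j / N \<le> V j / 8" using V0(1) N by (intro divide_left_mono) auto
      then show ?thesis by linarith
    qed
    ultimately show ?thesis by linarith
  qed
  have tsum: "(\<Sum>j<n. t j) \<le> M + 2 * (\<Sum>i. \<eta> i)" for n
  proof -
    have "(\<Sum>j<n. t j) = a n - a 0 + 2 * (\<Sum>i<n. \<eta> i)"
      by (simp add: t_def sum.distrib sum_lessThan_telescope sum_distrib_left)
    then show ?thesis using ab[of n] ab[of 0] \<eta>le[of n] by simp
  qed
  define q where "q = 2 * M * (M + 2 * (\<Sum>i. \<eta> i))"
  have "summable V"
  proof (rule summableI_nonneg_bounded)
    fix n
    have shift: "(\<Sum>j<Suc n. V j) = V 0 + (\<Sum>j<n. V (Suc j))" by (rule sum.lessThan_Suc_shift)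
    have "(\<Sum>j<n. V (Suc j)) \<le> (\<Sum>j<n. V j / 4 + 2 * M * t j)" by (intro sum_mono Vrec)
    also have "\<dots> = (\<Sum>j<n. V j) / 4 + 2 * M * (\<Sum>j<n. t j)"
      by (simp add: sum.distrib sum_distrib_left sum_divide_distrib)
    also have "\<dots> \<le> (\<Sum>j<Suc n. V j) / 4 + q"
      unfolding q_def using V0(1)[of n] M0 tsum[of n] by (intro add_mono mult_left_mono) auto
    finally have "(\<Sum>j<n. V (Suc j)) \<le> (\<Sum>j<Suc n. V j) / 4 + q" .
    moreover have "s \<le> 4 / 3 * (m + r)" if "t \<le> s / 4 + r" "s = v + t" "v \<le> m" for s t v m r :: real
      using that by (simp add: field_simps)
    ultimately have "(\<Sum>j<Suc n. V j) \<le> 4 / 3 * (M\<^sup>2 + q)"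
      using shift V0(2)[of 0] by blast
    moreover have "(\<Sum>j<n. V j) \<le> (\<Sum>j<Suc n. V j)" using V0(1)[of n] by simp
    ultimately show "(\<Sum>j<n. V j) \<le> 4 / 3 * (M\<^sup>2 + q)" by linarith
  qed (rule V0)
  have "AE x in P. (\<lambda>j. \<Phi> j z x / N ^ j) \<longlonglongrightarrow> \<gamma>" for z
  proof -
    have "AE x in P. (\<lambda>j. (\<phi> j z x - a j)\<^sup>2) \<longlonglongrightarrow> 0"
      by (rule P.AE_LIMSEQ_zero_of_summable_expectations)
         (use intsq \<open>summable V\<close> in \<open>auto simp: varV\<close>)
    then show ?thesis
    proof eventually_elim
      case (elim x)
      then have "(\<lambda>j. \<phi> j z x - a j) \<longlonglongrightarrow> 0"
        using tendsto_real_sqrt[OF elim] by (simp add: tendsto_rabs_zero_iff)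
      from tendsto_add[OF this a\<gamma>] show ?case by (simp add: \<phi>_def)
    qed
  qed
  moreover have "\<phi> 0 0 = \<Phi> 0 0" by (simp add: \<phi>_def fun_eq_iff)
  then have "P.expectation (\<Phi> 0 0) - (\<Sum>j. P.expectation (e j)) \<le> \<gamma>"
    using \<gamma>a by (simp add: a_def \<eta>_def)
  ultimately show ?thesis using that \<gamma>0 unfolding N_def by blast
qed

end

section \<open>Densities of scores and clusters\<close>

abbreviation clip :: "real \<Rightarrow> (int ^ 'd \<Rightarrow> real) \<Rightarrow> int ^ 'd \<Rightarrow> real" where
  "clip M x \<equiv> \<lambda>v. min (x v) M"

lemma good_clip: "0 \<le> K \<Longrightarrow> 0 \<le> M \<Longrightarrow> good K (clip M x) j z = good K x j z"
  by (induction j arbitrary: z) auto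

context iid_field
begin

definition bad_prob :: "real \<Rightarrow> nat \<Rightarrow> real" where
  "bad_prob K j = P.expectation (\<lambda>x. of_bool (\<not> good K x j 0))"

lemma measurable_bad [measurable]: "(\<lambda>x. of_bool (\<not> good K x j z) :: real) \<in> borel_measurable P"
proof -
  have "(\<lambda>x. if good K x j z then 0 else 1 :: real) \<in> borel_measurable P" by measurable
  then show ?thesis by (rule measurable_cong[THEN iffD1, rotated]) auto
qed

lemma integrable_bad [simp]: "integrable P (\<lambda>x. of_bool (\<not> good K x j z) :: real)"
  by (rule integrable_bounded[of _ 1]) auto

lemma expectation_bad: "P.expectation (\<lambda>x. of_bool (\<not> good K x j z)) = bad_prob K j"
  using expectation_translate[OF measurable_bad[of K j 0], of "3 ^ j *s z"] good_translate[of K _ j 0 z]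
  by (simp add: bad_prob_def)

lemma bad_prob_nonneg: "0 \<le> bad_prob K j"
  unfolding bad_prob_def by (intro Bochner_Integration.integral_nonneg) auto

text \<open>
  A bad cell has two distinct bad children, and these are independent; there are fewer than \<open>9^d\<close> ordered pairs.
\<close>

lemma bad_prob_Suc: "bad_prob K (Suc j) \<le> ((3 ^ CARD('d))\<^sup>2) * (bad_prob K j)\<^sup>2"
proof -
  let ?C = "cell 1 (0 :: int ^ 'd)"
  let ?b = "\<lambda>c x. of_bool (\<not> good K x j c) :: real"
  have prod_eq: "P.expectation (\<lambda>x. ?b a x * ?b c x) = (bad_prob K j)\<^sup>2" if "a \<noteq> c" for a c
  proof -
    have "P.expectation (\<lambda>x. ?b a x * ?b c x) = P.expectation (?b a) * P.expectation (?b c)"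
    proof (rule integral_mult_disjoint[where A = "cell j a" and B = "cell j c"])
      show "?b a x = ?b a y" if "\<And>v. v \<in> cell j a \<Longrightarrow> x v = y v" for x y
      proof -
        have "good K x j a = good K y j a" by (rule good_local) (rule that)
        then show ?thesis by simp
      qed
      show "?b c x = ?b c y" if "\<And>v. v \<in> cell j c \<Longrightarrow> x v = y v" for x y
      proof -
        have "good K x j c = good K y j c" by (rule good_local) (rule that)
        then show ?thesis by simp
      qed
    qed (use cell_disjoint[OF that] in simp_all)
    then show ?thesis by (simp add: expectation_bad power2_eq_square)
  qed
  have int2: "integrable P (\<lambda>x. ?b a x * ?b c x)" for a c
    by (rule integrable_bounded[of _ 1]) auto
  have "of_bool (\<not> good K x (Suc j) 0) \<le> (\<Sum>a\<in>?C. \<Sum>c\<in>?C - {a}. ?b a x * ?b c x)" for x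
  proof (cases "good K x (Suc j) 0")
    case False
    then have "\<exists>a\<in>?C. \<exists>c\<in>?C. a \<noteq> c \<and> \<not> good K x j a \<and> \<not> good K x j c"
      by (auto simp: card_le_Suc0_iff_eq)
    then obtain a c where ac: "a \<in> ?C" "c \<in> ?C - {a}" "\<not> good K x j a" "\<not> good K x j c" by blast
    have "1 = ?b a x * ?b c x" using ac by simp
    also have "\<dots> \<le> (\<Sum>c\<in>?C - {a}. ?b a x * ?b c x)"
      using ac by (intro member_le_sum[of c _ "\<lambda>c. ?b a x * ?b c x"]) auto
    also have "\<dots> \<le> (\<Sum>a\<in>?C. \<Sum>c\<in>?C - {a}. ?b a x * ?b c x)"
      using ac by (intro member_le_sum[of a _ "\<lambda>a. \<Sum>c\<in>?C - {a}. ?b a x * ?b c x"] sum_nonneg) auto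
    finally show ?thesis using False by simp
  qed (simp add: sum_nonneg)
  then have "bad_prob K (Suc j) \<le> P.expectation (\<lambda>x. \<Sum>a\<in>?C. \<Sum>c\<in>?C - {a}. ?b a x * ?b c x)"
    unfolding bad_prob_def
    by (intro integral_mono integrable_bad Bochner_Integration.integrable_sum int2)
  also have "\<dots> = (\<Sum>a\<in>?C. \<Sum>c\<in>?C - {a}. P.expectation (\<lambda>x. ?b a x * ?b c x))"
    by (simp only: Bochner_Integration.integral_sum Bochner_Integration.integrable_sum int2)
  also have "\<dots> = (\<Sum>a\<in>?C. \<Sum>c\<in>?C - {a}. (bad_prob K j)\<^sup>2)"
    using prod_eq by (intro sum.cong) auto
  also have "\<dots> \<le> (\<Sum>a\<in>?C. \<Sum>c\<in>?C. (bad_prob K j)\<^sup>2)"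
    by (intro sum_mono sum_mono2) auto
  also have "\<dots> = ((3 ^ CARD('d))\<^sup>2) * (bad_prob K j)\<^sup>2"
    by (simp only: sum_constant card_cell) (simp add: power2_eq_square)
  finally show ?thesis .
qed

lemma bad_prob_le:
  assumes \<theta>: "(3 ^ CARD('d))\<^sup>2 * bad_prob K 0 \<le> \<theta>" "\<theta> \<le> 1 / 2"
  shows "bad_prob K j \<le> \<theta> * (1 / 2) ^ j"
proof -
  let ?N = "(3 ^ CARD('d))\<^sup>2 :: real"
  have N: "1 \<le> ?N" by (intro one_le_power) simp_all
  have \<theta>0: "0 \<le> \<theta>" using \<theta>(1) bad_prob_nonneg[of K 0] by (meson mult_nonneg_nonneg order_trans zero_le_power2)
  have "?N * bad_prob K j \<le> \<theta> * (1 / 2) ^ j"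
  proof (induction j)
    case (Suc j)
    have "?N * bad_prob K (Suc j) \<le> ?N * (?N * (bad_prob K j)\<^sup>2)"
      using bad_prob_Suc[of K j] N by (intro mult_left_mono) auto
    also have "\<dots> = (?N * bad_prob K j)\<^sup>2" by (simp add: power2_eq_square)
    also have "\<dots> \<le> (\<theta> * (1 / 2) ^ j)\<^sup>2"
      using Suc bad_prob_nonneg[of K j] by (intro power_mono mult_nonneg_nonneg) auto
    also have "\<dots> = \<theta> * (1 / 2) ^ j * (\<theta> * (1 / 2) ^ j)" by (simp only: power2_eq_square)
    also have "\<dots> \<le> \<theta> * (1 / 2) ^ j * (1 / 2)"
    proof (rule mult_left_mono)
      have "\<theta> * (1 / 2) ^ j \<le> (1 / 2) * 1"
        using \<theta>(2) by (intro mult_mono power_le_one) auto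
      then show "\<theta> * (1 / 2) ^ j \<le> 1 / 2" by simp
    qed (use \<theta>0 in simp)
    finally show ?case by (simp add: mult.assoc)
  qed (use \<theta> in simp)
  moreover have "1 * bad_prob K j \<le> ?N * bad_prob K j"
    using N bad_prob_nonneg[of K j] by (intro mult_right_mono) auto
  ultimately show ?thesis by simp
qed

lemma summable_bad_prob:
  assumes "(3 ^ CARD('d))\<^sup>2 * bad_prob K 0 \<le> \<theta>" "\<theta> \<le> 1 / 2"
  shows "summable (bad_prob K)" "suminf (bad_prob K) \<le> 2 * \<theta>"
proof -
  have g: "(\<lambda>j. \<theta> * (1 / 2) ^ j) sums (\<theta> * 2)"
    using sums_mult[OF geometric_sums[of "1 / 2 :: real"], of \<theta>] by simp
  show s: "summable (bad_prob K)"
    by (rule summable_comparison_test'[OF sums_summable[OF g], of 0])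
       (use bad_prob_nonneg bad_prob_le[OF assms] in auto)
  have "suminf (bad_prob K) \<le> (\<Sum>j. \<theta> * (1 / 2) ^ j)"
    by (intro suminf_le s sums_summable[OF g] bad_prob_le[OF assms])
  then show "suminf (bad_prob K) \<le> 2 * \<theta>" using sums_unique[OF g] by simp
qed

lemma AE_eventually_good:
  assumes "summable (bad_prob K)"
  shows "AE x in P. eventually (\<lambda>j. good K x j z) sequentially"
proof -
  have "AE x in P. (\<lambda>j. of_bool (\<not> good K x j z) :: real) \<longlonglongrightarrow> 0"
    by (rule P.AE_LIMSEQ_zero_of_summable_expectations) (use assms in \<open>auto simp: expectation_bad\<close>)
  then show ?thesis
  proof eventually_elim
    case (elim x)
    then have "eventually (\<lambda>j. (of_bool (\<not> good K x j z) :: real) < 1) sequentially"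
      by (rule order_tendstoD) simp
    then show ?case by eventually_elim (simp split: if_splits)
  qed
qed

lemma measurable_clip [measurable]: "clip M \<in> measurable P P"
proof -
  have "clip M \<in> measurable P field_space" by (rule measurable_abs_UNIV) measurable
  then show ?thesis by (simp add: measurable_cong_sets[OF refl sets_P])
qed

text \<open>
  The joining cost relative to the volume is a multiple of \<open>\<rho>^j\<close> with \<open>\<rho> = (3^d - 1) / 3^d\<close>, hence
  summable; the bad cells contribute \<open>M\<close> times their probability.
\<close>

lemma cell_score_density:
  assumes d: "CARD('d) \<ge> 2" and K: "0 \<le> K" and M: "0 \<le> M" and s: "summable (bad_prob K)"
  obtains \<gamma> where "0 \<le> \<gamma>"
    "\<And>z. AE x in P. (\<lambda>j. cell_score K (clip M x) j z / (3 ^ CARD('d)) ^ j) \<longlonglongrightarrow> \<gamma>"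
proof -
  define N :: real where "N = 3 ^ CARD('d)"
  have N: "1 < N" unfolding N_def by (intro one_less_power) auto
  define \<rho> where "\<rho> = (N - 1) / N"
  have \<rho>: "0 \<le> \<rho>" "\<rho> < 1" using N by (auto simp: \<rho>_def divide_simps)
  define e where "e j x = 2 * K * \<rho> ^ j + M * of_bool (\<not> good K x (Suc j) 0)" for j and x :: "int ^ 'd \<Rightarrow> real"
  have Ee: "P.expectation (e j) = 2 * K * \<rho> ^ j + M * bad_prob K (Suc j)" for j
    unfolding e_def by (simp add: expectation_bad P.prob_space[simplified] del: good.simps)
  have meas: "(\<lambda>x. cell_score K (clip M x) j z) \<in> borel_measurable P" for j z
    by (rule measurable_compose[OF measurable_clip]) simp
  have bnd: "cell_score K (clip M x) j z \<le> M * (3 ^ CARD('d)) ^ j" for x j and z :: "int ^ 'd"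
    using cell_score_le[of "clip M x" M K j z] M by (simp add: card_cell)
  have sup: "(\<Sum>c\<in>cell 1 0. cell_score K (clip M x) j c) - (3 ^ CARD('d)) ^ Suc j * e j x
      \<le> cell_score K (clip M x) (Suc j) 0" for j x
  proof -
    have "N ^ Suc j * (2 * K * \<rho> ^ j) = K * (2 * N * (N - 1) ^ j)"
      using N by (simp add: \<rho>_def power_divide)
    then have "(3 ^ CARD('d)) ^ Suc j * e j x = K * (2 * 3 ^ CARD('d) * (3 ^ CARD('d) - 1) ^ j)
        + (if good K x (Suc j) 0 then 0 else M * (3 ^ CARD('d)) ^ Suc j)"
      unfolding e_def N_def[symmetric] distrib_left by simp
    moreover have "(\<Sum>c\<in>cell 1 0. cell_score K (clip M x) j c) - K * (2 * 3 ^ CARD('d) * (3 ^ CARD('d) - 1) ^ j)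
      - (if good K x (Suc j) 0 then 0 else M * (3 ^ CARD('d)) ^ Suc j) \<le> cell_score K (clip M x) (Suc j) 0"
      using cell_score_Suc[OF d K, of "clip M x" M j 0] M by (simp only: good_clip[OF K M])
    ultimately show ?thesis by linarith
  qed
  have "summable (\<lambda>j. 2 * K * \<rho> ^ j + M * bad_prob K (Suc j))"
    using \<rho> s by (intro summable_add summable_mult summable_geometric) (auto simp: summable_Suc_iff)
  then have sum: "summable (\<lambda>j. P.expectation (e j))" by (simp add: Ee)
  have inte: "integrable P (e j)" for j
    unfolding e_def using P.integrable_const by (intro Bochner_Integration.integrable_add) (auto simp del: good.simps)
  have e0: "0 \<le> e j x" for j x unfolding e_def using K M \<rho> by simp
  have loc: "cell_score K (clip M x) j z = cell_score K (clip M y) j z"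
    if "\<And>v. v \<in> cell j z \<Longrightarrow> x v = y v" for j x y and z :: "int ^ 'd"
    by (rule cell_score_local) (simp add: that)
  have trans: "cell_score K (clip M x) j z = cell_score K (clip M (\<lambda>v. x (v + 3 ^ j *s z))) j 0"
    for j x and z :: "int ^ 'd"
    using cell_score_translate[of K "clip M x" j 0 z] by simp
  show ?thesis
    by (rule cell_functional_converges[OF d meas loc trans cell_score_nonneg bnd inte e0 sum sup])
       (simp, rule that)
qed

text \<open>
  At scale 0 the expected density is the probability of a good site; every later scale loses at most the probability of a bad cell.
\<close>

lemma cluster_density:
  assumes d: "CARD('d) \<ge> 2" and s: "summable (bad_prob K)"
  obtains \<kappa> where "1 - suminf (bad_prob K) \<le> \<kappa>"
    "\<And>z. AE x in P. (\<lambda>j. cluster_size K x j z / (3 ^ CARD('d)) ^ j) \<longlonglongrightarrow> \<kappa>"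
proof -
  define e where "e j x = (of_bool (\<not> good K x (Suc j) 0) :: real)" for j and x :: "int ^ 'd \<Rightarrow> real"
  have Ee: "P.expectation (e j) = bad_prob K (Suc j)" for j
    unfolding e_def by (rule expectation_bad)
  have meas: "(\<lambda>x. cluster_size K x j z) \<in> borel_measurable P" for j z by measurable
  have bnd: "cluster_size K x j z \<le> 1 * (3 ^ CARD('d)) ^ j" for x j and z :: "int ^ 'd"
    using cluster_size_le[of K x j z] by (simp add: card_cell)
  have sup: "(\<Sum>c\<in>cell 1 0. cluster_size K x j c) - (3 ^ CARD('d)) ^ Suc j * e j x \<le> cluster_size K x (Suc j) 0"
    for j and x :: "int ^ 'd \<Rightarrow> real"
    using cluster_size_Suc[of K x j 0] by (cases "good K x (Suc j) 0") (simp_all add: e_def del: good.simps)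
  have sum: "summable (\<lambda>j. P.expectation (e j))" using s by (simp add: Ee summable_Suc_iff)
  have inte: "integrable P (e j)" for j unfolding e_def by (rule integrable_bad)
  have e0: "0 \<le> e j x" for j x unfolding e_def by simp
  have loc: "cluster_size K x j z = cluster_size K y j z"
    if "\<And>v. v \<in> cell j z \<Longrightarrow> x v = y v" for j x y and z :: "int ^ 'd"
    by (rule cluster_size_local) (rule that)
  have trans: "cluster_size K x j z = cluster_size K (\<lambda>v. x (v + 3 ^ j *s z)) j 0"
    for j x and z :: "int ^ 'd"
    using cluster_size_translate[of K x j 0 z] by simp
  obtain \<kappa> where \<kappa>: "P.expectation (\<lambda>x. cluster_size K x 0 0) - (\<Sum>j. P.expectation (e j)) \<le> \<kappa>"
    "\<And>z. AE x in P. (\<lambda>j. cluster_size K x j z / (3 ^ CARD('d)) ^ j) \<longlonglongrightarrow> \<kappa>"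
    by (rule cell_functional_converges[OF d meas loc trans cluster_size_nonneg bnd inte e0 sum sup])
       (simp, rule that)
  have "P.expectation (\<lambda>x. cluster_size K x 0 0) = P.expectation (\<lambda>x. 1 - of_bool (\<not> good K x 0 0))"
    by (intro Bochner_Integration.integral_cong) (auto simp: cluster_size_def)
  also have "\<dots> = 1 - bad_prob K 0"
    using P.prob_space integrable_bad[of K 0 0] expectation_bad[of K 0 0]
    by (subst Bochner_Integration.integral_diff) (auto simp del: good.simps)
  finally have "1 - suminf (bad_prob K) \<le> \<kappa>"
    using \<kappa>(1) suminf_split_head[OF s] by (simp add: Ee)
  then show ?thesis using \<kappa>(2) that by blast
qed

end

section \<open>From triadic scales to all scales\<close>

lemma power_ratio_tendsto_1: "(\<lambda>s. (real (Suc s) / real s) ^ d) \<longlonglongrightarrow> 1"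
proof -
  have "(\<lambda>s. 1 + inverse (real s)) \<longlonglongrightarrow> 1 + 0" by (intro tendsto_add tendsto_const lim_inverse_n)
  then have "(\<lambda>s. 1 + inverse (real s)) \<longlonglongrightarrow> 1" by simp
  then have "(\<lambda>s. real (Suc s) / real s) \<longlonglongrightarrow> 1"
    by (rule Lim_transform_eventually)
       (auto intro!: eventually_mono[OF eventually_gt_at_top[of 0]] simp: field_simps)
  from tendsto_power[OF this, of d] show ?thesis by simp
qed

text \<open>
  Take the largest \<open>j\<close> with \<open>s0 * 3^j \<le> n\<close>, and \<open>s = n div 3^j\<close>.
\<close>

lemma triadic_bracket:
  assumes "1 \<le> s0" "s0 * 3 ^ J \<le> n"
  obtains s j where "J \<le> j" "s0 \<le> s" "s < 3 * s0" "s * 3 ^ j \<le> n" "n < Suc s * 3 ^ j"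
proof -
  have bound: "j \<le> n" if "s0 * 3 ^ j \<le> n" for j
  proof -
    have "j < 3 ^ j" by (induction j) auto
    also have "3 ^ j \<le> s0 * 3 ^ j" using assms(1) by simp
    finally show ?thesis using that by simp
  qed
  define j where "j = (GREATEST j. s0 * 3 ^ j \<le> n)"
  have j1: "s0 * 3 ^ j \<le> n" unfolding j_def by (rule GreatestI_nat[of _ J n]) (use assms bound in auto)
  have j2: "J \<le> j" unfolding j_def by (rule Greatest_le_nat[of _ J n]) (use assms bound in auto)
  have j3: "n < s0 * 3 ^ Suc j"
  proof (rule ccontr)
    assume "\<not> ?thesis"
    then have "Suc j \<le> j" unfolding j_def by (intro Greatest_le_nat[of _ _ n]) (use bound in auto)
    then show False by simp
  qed
  have "s0 \<le> n div 3 ^ j" using j1 by (simp add: less_eq_div_iff_mult_less_eq)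
  moreover have "n div 3 ^ j < 3 * s0" using j3 by (intro less_mult_imp_div_less) (simp add: mult_ac)
  moreover have "n div 3 ^ j * 3 ^ j \<le> n" by simp
  moreover have "n < Suc (n div 3 ^ j) * 3 ^ j"
    using dividend_less_div_times[of "3 ^ j" n] by (simp add: add.commute)
  ultimately show ?thesis using j2 that by blast
qed

text \<open>
  Only finitely many \<open>s\<close>, those between \<open>s0\<close> and \<open>3 * s0\<close>, are needed to bracket every large \<open>n\<close> between \<open>s * 3^j\<close> and
  \<open>(s + 1) * 3^j\<close>.  The two sides differ by a factor that tends to 1 as \<open>s0\<close> grows.
\<close>

lemma monotone_density_from_triadic_scales:
  fixes g :: "nat \<Rightarrow> real"
  assumes mono: "\<And>m n. 1 \<le> m \<Longrightarrow> m \<le> n \<Longrightarrow> g m \<le> g n"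
    and pos: "0 \<le> \<gamma>" "0 \<le> \<beta>"
    and lower: "\<And>s \<epsilon>. 1 \<le> s \<Longrightarrow> 0 < \<epsilon> \<Longrightarrow> eventually (\<lambda>j. (\<gamma> - \<epsilon>) * real (s * 3 ^ j) ^ d \<le> g (s * 3 ^ j)) sequentially"
    and upper: "\<And>s \<epsilon>. 1 \<le> s \<Longrightarrow> 0 < \<epsilon> \<Longrightarrow> eventually (\<lambda>j. g (s * 3 ^ j) \<le> (\<beta> + \<epsilon>) * real (s * 3 ^ j) ^ d) sequentially"
    and \<epsilon>: "0 < \<epsilon>"
  shows "eventually (\<lambda>n. \<gamma> - \<epsilon> \<le> g n / real n ^ d \<and> g n / real n ^ d \<le> \<beta> + \<epsilon>) sequentially"
proof -
  define c where "c = \<gamma> + \<beta> + 1 + \<epsilon>"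
  have c: "0 < c" using pos \<epsilon> by (simp add: c_def)
  \<comment> \<open>Both \<open>\<gamma> * q\<close> and \<open>(\<beta> + \<epsilon> / 2) * q\<close> are at most \<open>\<epsilon> / 2\<close>.\<close>
  define q where "q = \<epsilon> / (2 * c)"
  have q: "0 < q" using c \<epsilon> by (simp add: q_def)
  have "eventually (\<lambda>s. (real (Suc s) / real s) ^ d < 1 + q) sequentially"
    using q by (intro order_tendstoD(2)[OF power_ratio_tendsto_1]) simp
  then obtain s1 where s1: "\<And>s. s1 \<le> s \<Longrightarrow> (real (Suc s) / real s) ^ d < 1 + q"
    by (auto simp: eventually_sequentially)
  define s0 where "s0 = max 1 s1"
  have s0: "1 \<le> s0" by (simp add: s0_def)
  have "eventually (\<lambda>j. \<forall>s\<in>{s0..3 * s0}. (\<gamma> - \<epsilon> / 2) * real (s * 3 ^ j) ^ d \<le> g (s * 3 ^ j)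
      \<and> g (s * 3 ^ j) \<le> (\<beta> + \<epsilon> / 2) * real (s * 3 ^ j) ^ d) sequentially"
    using lower[of _ "\<epsilon> / 2"] upper[of _ "\<epsilon> / 2"] s0 \<epsilon>
    by (intro eventually_ball_finite ballI eventually_conj) auto
  then obtain J where "\<forall>j\<ge>J. \<forall>s\<in>{s0..3 * s0}. (\<gamma> - \<epsilon> / 2) * real (s * 3 ^ j) ^ d \<le> g (s * 3 ^ j)
      \<and> g (s * 3 ^ j) \<le> (\<beta> + \<epsilon> / 2) * real (s * 3 ^ j) ^ d"
    unfolding eventually_sequentially by blast
  then have J: "(\<gamma> - \<epsilon> / 2) * real (s * 3 ^ j) ^ d \<le> g (s * 3 ^ j)
      \<and> g (s * 3 ^ j) \<le> (\<beta> + \<epsilon> / 2) * real (s * 3 ^ j) ^ d" if "J \<le> j" "s0 \<le> s" "s \<le> 3 * s0" for j s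
    using that by simp
  have "\<gamma> - \<epsilon> \<le> g n / real n ^ d \<and> g n / real n ^ d \<le> \<beta> + \<epsilon>" if n: "s0 * 3 ^ J \<le> n" for n
  proof -
    obtain s j where sj: "J \<le> j" "s0 \<le> s" "s < 3 * s0" "s * 3 ^ j \<le> n" "n < Suc s * 3 ^ j"
      using triadic_bracket[OF s0 n] .
    have spos: "1 \<le> s" using s0 sj by simp
    define L where "L = real (s * 3 ^ j) ^ d"
    define U where "U = real (Suc s * 3 ^ j) ^ d"
    define V where "V = real n ^ d"
    have npos: "0 < n" using sj(4) spos by (cases n) auto
    have L0: "0 < L" using spos by (simp add: L_def)
    have V0: "0 < V" using npos by (simp add: V_def)
    have LV: "L \<le> V" unfolding L_def V_def using sj(4) by (intro power_mono) (simp_all only: of_nat_le_iff of_nat_0_le_iff)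
    have VU: "V \<le> U" unfolding U_def V_def using sj(5) by (intro power_mono) (simp_all only: of_nat_le_iff of_nat_0_le_iff less_imp_le)
    have "U = real (Suc s) ^ d * (3 ^ j) ^ d" "L = real s ^ d * (3 ^ j) ^ d"
      by (simp_all only: U_def L_def of_nat_mult of_nat_power of_nat_numeral power_mult_distrib)
    then have "U = (real (Suc s) / real s) ^ d * L"
      using spos by (simp add: power_divide)
    also have "\<dots> \<le> (1 + q) * L" using s1[of s] sj(2) L0 by (intro mult_right_mono) (auto simp: s0_def)
    finally have UL: "U \<le> (1 + q) * L" .
    have "\<gamma> * V \<le> \<gamma> * ((1 + q) * L)" using VU UL pos by (intro mult_left_mono) auto
    also have "\<dots> \<le> \<gamma> * L + \<gamma> * q * V" proof -
      have "\<gamma> * q * L \<le> \<gamma> * q * V" using LV pos q by (intro mult_left_mono) auto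
      then show ?thesis by (simp add: algebra_simps)
    qed
    finally have a1: "\<gamma> * V \<le> \<gamma> * L + \<gamma> * q * V" .
    have cq: "c * q = \<epsilon> / 2" using c by (simp add: q_def)
    have "\<gamma> * q \<le> c * q" using q pos \<epsilon> by (intro mult_right_mono) (auto simp: c_def)
    then have a2: "\<gamma> * q * V \<le> \<epsilon> / 2 * V" using cq V0 by (intro mult_right_mono) auto
    have "(\<gamma> - \<epsilon> / 2) * L \<le> g (s * 3 ^ j)" using J[of j s] sj by (simp add: L_def)
    also have "\<dots> \<le> g n" using sj(4) spos by (intro mono) auto
    finally have "\<gamma> * L - \<epsilon> / 2 * L \<le> g n" by (simp add: left_diff_distrib)
    moreover have "\<epsilon> / 2 * L \<le> \<epsilon> / 2 * V" using LV \<epsilon> by (intro mult_left_mono) auto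
    ultimately have "\<gamma> * V - \<epsilon> / 2 * V - \<epsilon> / 2 * V \<le> g n" using a1 a2 by linarith
    then have lo: "(\<gamma> - \<epsilon>) * V \<le> g n" by (simp add: algebra_simps)
    have "g n \<le> g (Suc s * 3 ^ j)" using sj(5) npos by (intro mono) auto
    also have "\<dots> \<le> (\<beta> + \<epsilon> / 2) * U" using J[of j "Suc s"] sj by (simp add: U_def)
    also have "\<dots> \<le> (\<beta> + \<epsilon> / 2) * ((1 + q) * V)"
    proof (rule mult_left_mono)
      have "(1 + q) * L \<le> (1 + q) * V" using LV q by (intro mult_left_mono) auto
      then show "U \<le> (1 + q) * V" using UL by simp
    qed (use pos \<epsilon> in simp)
    also have "\<dots> = (\<beta> + \<epsilon> / 2) * V + (\<beta> + \<epsilon> / 2) * q * V" by (simp add: algebra_simps)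
    also have "(\<beta> + \<epsilon> / 2) * q * V \<le> \<epsilon> / 2 * V"
    proof (rule mult_right_mono)
      have "(\<beta> + \<epsilon> / 2) * q \<le> c * q" using q pos \<epsilon> by (intro mult_right_mono) (auto simp: c_def)
      then show "(\<beta> + \<epsilon> / 2) * q \<le> \<epsilon> / 2" using cq by simp
    qed (use V0 in simp)
    finally have hi: "g n \<le> (\<beta> + \<epsilon>) * V" by (simp add: algebra_simps)
    show ?thesis using lo hi V0 unfolding V_def[symmetric] by (simp add: pos_le_divide_eq pos_divide_le_eq)
  qed
  then show ?thesis by (auto simp: eventually_sequentially)
qed

lemma eventually_le_of_tendsto:
  fixes f g :: "nat \<Rightarrow> real"
  assumes "eventually (\<lambda>j. f j \<le> g j) sequentially" "g \<longlonglongrightarrow> l" "l < u"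
  shows "eventually (\<lambda>j. f j \<le> u) sequentially"
  using assms(1) order_tendstoD(2)[OF assms(2,3)] by eventually_elim simp

lemma eventually_ge_of_tendsto:
  fixes f g :: "nat \<Rightarrow> real"
  assumes "eventually (\<lambda>j. g j \<le> f j) sequentially" "g \<longlonglongrightarrow> l" "u < l"
  shows "eventually (\<lambda>j. u \<le> f j) sequentially"
  using assms(1) order_tendstoD(1)[OF assms(2,3)] by eventually_elim simp

text \<open>
  The lower bound joins the best animals of the cells in the box.  The upper bound holds first for
  boxes of side \<open>3^j\<close>, which are single cells.  A box of side \<open>s * 3^j\<close> is then compared with the
  triadic box of side \<open>t * 3^j\<close>, \<open>s \<le> t \<le> 3 * s\<close>, that contains it; the comparison multiplies the error
  \<open>M * \<eta>\<close> by at most the ratio \<open>3^d\<close> of the volumes.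
\<close>

lemma greedy_weight_density:
  fixes x :: "int ^ 'd \<Rightarrow> real"
  assumes d: "CARD('d) \<ge> 2" and K: "0 \<le> K" and M: "\<And>v. x v \<le> M" "0 \<le> M"
    and good: "\<And>z. eventually (\<lambda>j. good K x j z) sequentially"
    and score: "\<And>z. (\<lambda>j. cell_score K x j z / (3 ^ CARD('d)) ^ j) \<longlonglongrightarrow> \<gamma>" and \<gamma>: "0 \<le> \<gamma>"
    and size: "\<And>z. (\<lambda>j. cluster_size K x j z / (3 ^ CARD('d)) ^ j) \<longlonglongrightarrow> \<kappa>"
    and \<eta>: "1 - \<eta> \<le> \<kappa>" "0 \<le> \<eta>" and \<epsilon>: "0 < \<epsilon>"
  shows "eventually (\<lambda>n. \<gamma> - \<epsilon> \<le> greedy_weight x n / real n ^ CARD('d)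
    \<and> greedy_weight x n / real n ^ CARD('d) \<le> \<gamma> + 3 ^ CARD('d) * (M * \<eta>) + \<epsilon>) sequentially"
proof -
  define N :: real where "N = 3 ^ CARD('d)"
  have N: "1 < N" unfolding N_def by (intro one_less_power) auto
  define \<rho> where "\<rho> = (N - 1) / N"
  have \<rho>: "0 \<le> \<rho>" "\<rho> < 1" using N by (auto simp: \<rho>_def divide_simps)
  have \<rho>0: "(\<lambda>j. \<rho> ^ j) \<longlonglongrightarrow> 0" using \<rho> by (intro LIMSEQ_realpow_zero) auto
  have \<rho>pow: "(N - 1) ^ j / N ^ j = \<rho> ^ j" for j by (simp add: \<rho>_def power_divide)
  have vol: "real (s * 3 ^ j) ^ CARD('d) = real s ^ CARD('d) * N ^ j" for s j
    by (simp add: N_def power_mult_distrib power_mult[symmetric] mult.commute)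
  have good_box: "eventually (\<lambda>j. \<forall>z\<in>lattice_box s. good K x j z) sequentially" for s
    by (intro eventually_ball_finite ballI good) simp
  have score': "(\<lambda>j. cell_score K x j z / N ^ j) \<longlonglongrightarrow> \<gamma>" for z using score by (simp add: N_def)
  have size': "(\<lambda>j. cluster_size K x j z / N ^ j) \<longlonglongrightarrow> \<kappa>" for z using size by (simp add: N_def)
  have Nj: "0 < N ^ j" for j using N by simp
  have lower: "eventually (\<lambda>j. (\<gamma> - \<epsilon>) * real (s * 3 ^ j) ^ CARD('d) \<le> greedy_weight x (s * 3 ^ j)) sequentially"
    if s: "1 \<le> s" and \<epsilon>: "0 < \<epsilon>" for s \<epsilon>
  proof -
    let ?B = "lattice_box s :: (int ^ 'd) set"
    let ?f = "\<lambda>j. (\<Sum>z\<in>?B. cell_score K x j z / N ^ j) - K * (2 * real s ^ CARD('d)) * \<rho> ^ j"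
    have "?f \<longlonglongrightarrow> (\<Sum>z\<in>?B. \<gamma>) - K * (2 * real s ^ CARD('d)) * 0"
      by (intro tendsto_diff tendsto_sum tendsto_mult tendsto_const score' \<rho>0)
    then have lim: "?f \<longlonglongrightarrow> \<gamma> * real s ^ CARD('d)"
      by (simp add: card_lattice_box mult.commute)
    have "eventually (\<lambda>j. ?f j \<le> greedy_weight x (s * 3 ^ j) / N ^ j) sequentially"
      using good_box[of s]
    proof eventually_elim
      case (elim j)
      have "((\<Sum>z\<in>?B. cell_score K x j z) - K * (2 * real s ^ CARD('d) * (N - 1) ^ j)) / N ^ j
          \<le> greedy_weight x (s * 3 ^ j) / N ^ j"
        using greedy_weight_box_ge[OF d K s, of x j] elim Nj[of j]
        by (intro divide_right_mono) (auto simp: N_def of_nat_diff)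
      then show ?case
        by (simp add: diff_divide_distrib sum_divide_distrib \<rho>pow[symmetric] mult.assoc)
    qed
    then have "eventually (\<lambda>j. (\<gamma> - \<epsilon>) * real s ^ CARD('d) \<le> greedy_weight x (s * 3 ^ j) / N ^ j) sequentially"
      by (rule eventually_ge_of_tendsto[OF _ lim]) (use s \<epsilon> in \<open>simp add: algebra_simps\<close>)
    then show ?thesis
      by eventually_elim (use Nj in \<open>simp only: vol pos_le_divide_eq mult.assoc\<close>)
  qed
  have upper1: "eventually (\<lambda>j. greedy_weight x (3 ^ j) / N ^ j \<le> \<gamma> + M * \<eta> + \<epsilon>) sequentially"
    if \<epsilon>: "0 < \<epsilon>" for \<epsilon>
  proof (rule eventually_le_of_tendsto)
    let ?g = "\<lambda>j. max (M * (1 - cluster_size K x j 0 / N ^ j)) (cell_score K x j 0 / N ^ j)"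
    show "eventually (\<lambda>j. greedy_weight x (3 ^ j) / N ^ j \<le> ?g j) sequentially"
      using good[of 0]
    proof eventually_elim
      case (elim j)
      have "greedy_weight x (3 ^ j) / N ^ j \<le> max (M * (N ^ j - cluster_size K x j 0)) (cell_score K x j 0) / N ^ j"
        using greedy_weight_cell_le[OF M elim] Nj[of j] by (intro divide_right_mono) (auto simp: N_def)
      also have "\<dots> = max (M * (N ^ j - cluster_size K x j 0) / N ^ j) (cell_score K x j 0 / N ^ j)"
        using Nj[of j] by (simp add: max_divide_distrib_right)
      also have "M * (N ^ j - cluster_size K x j 0) / N ^ j = M * (1 - cluster_size K x j 0 / N ^ j)"
      proof -
        have "(N ^ j - cluster_size K x j 0) / N ^ j = 1 - cluster_size K x j 0 / N ^ j"
          using N by (simp add: diff_divide_distrib)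
        then show ?thesis by (simp only: times_divide_eq_right[symmetric])
      qed
      finally show ?case .
    qed
    show "?g \<longlonglongrightarrow> max (M * (1 - \<kappa>)) \<gamma>"
      by (intro tendsto_max tendsto_mult tendsto_diff tendsto_const score' size')
    have "M * (1 - \<kappa>) \<le> M * \<eta>" using \<eta> M(2) by (intro mult_left_mono) auto
    moreover have "0 \<le> M * \<eta>" using \<eta> M(2) by simp
    ultimately show "max (M * (1 - \<kappa>)) \<gamma> < \<gamma> + M * \<eta> + \<epsilon>" using \<gamma> \<epsilon> by auto
  qed
  have upper: "eventually (\<lambda>j. greedy_weight x (s * 3 ^ j) \<le> (\<gamma> + N * (M * \<eta>) + \<epsilon>) * real (s * 3 ^ j) ^ CARD('d)) sequentially"
    if s: "1 \<le> s" and \<epsilon>: "0 < \<epsilon>" for s \<epsilon>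
  proof -
    obtain r where r: "s \<le> 3 ^ r" "3 ^ r \<le> 3 * s"
    proof -
      have "1 * 3 ^ 0 \<le> s" using s by simp
      then obtain s' j where sj: "0 \<le> j" "1 \<le> s'" "s' < 3 * 1" "s' * 3 ^ j \<le> s" "s < Suc s' * 3 ^ j"
        by (rule triadic_bracket[OF order_refl])
      have "Suc s' * 3 ^ j \<le> 3 * 3 ^ j" using sj(3) by (intro mult_right_mono) auto
      then have "s \<le> 3 ^ Suc j" using sj(5) unfolding power_Suc by linarith
      moreover have "1 * 3 ^ j \<le> s' * 3 ^ j" using sj(2) by (intro mult_right_mono) auto
      then have "3 ^ Suc j \<le> 3 * s" using sj(4) unfolding power_Suc by linarith
      ultimately show ?thesis by (rule that)
    qed
    define t where "t = (3::nat) ^ r"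
    let ?B = "lattice_box s :: (int ^ 'd) set" and ?C = "lattice_box t :: (int ^ 'd) set"
    have st: "?B \<subseteq> ?C" using r by (intro lattice_box_mono) (simp add: t_def)
    define sd where "sd = real s ^ CARD('d)"
    define td where "td = real t ^ CARD('d)"
    have sd: "0 < sd" using s by (simp add: sd_def)
    have td: "td \<le> N * sd"
    proof -
      have "real t \<le> real (3 * s)" using r by (simp add: t_def del: of_nat_mult)
      then have "td \<le> real (3 * s) ^ CARD('d)" unfolding td_def by (intro power_mono) auto
      then show ?thesis by (simp add: sd_def N_def power_mult_distrib)
    qed
    have td0: "0 \<le> td" by (simp add: td_def)
    have cardCB: "real (card (?C - ?B)) = td - sd"
      using card_mono[OF _ st] by (simp add: card_Diff_subset[OF _ st] of_nat_diff card_lattice_box td_def sd_def)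
    define \<delta> where "\<delta> = \<epsilon> / (2 * N)"
    have \<delta>: "0 < \<delta>" using \<epsilon> N by (simp add: \<delta>_def)
    let ?g = "\<lambda>j. max (M * (\<Sum>z\<in>?B. 1 - cluster_size K x j z / N ^ j))
      ((\<gamma> + M * \<eta> + \<delta>) * td - (\<Sum>z\<in>?C - ?B. cell_score K x j z / N ^ j) + K * (2 * td) * \<rho> ^ j)"
    have big: "eventually (\<lambda>j. greedy_weight x (3 ^ (j + r)) / N ^ (j + r) \<le> \<gamma> + M * \<eta> + \<delta>) sequentially"
      using upper1[OF \<delta>] by (rule sequentially_offset)
    have Nr: "N ^ r = td" by (simp add: N_def td_def t_def power_mult[symmetric] mult.commute)
    have le: "eventually (\<lambda>j. greedy_weight x (s * 3 ^ j) / N ^ j \<le> ?g j) sequentially"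
      using good_box[of t] big
    proof eventually_elim
      case (elim j)
      have "greedy_weight x (t * 3 ^ j) / N ^ j = greedy_weight x (3 ^ (j + r)) / N ^ (j + r) * td"
        using N by (simp add: t_def power_add mult.commute Nr[symmetric])
      also have "\<dots> \<le> (\<gamma> + M * \<eta> + \<delta>) * td" using elim td0 by (intro mult_right_mono) auto
      finally have G: "greedy_weight x (t * 3 ^ j) / N ^ j \<le> (\<gamma> + M * \<eta> + \<delta>) * td" .
      have c1: "M * (\<Sum>z\<in>?B. N ^ j - cluster_size K x j z) / N ^ j = M * (\<Sum>z\<in>?B. 1 - cluster_size K x j z / N ^ j)"
      proof -
        have "(\<Sum>z\<in>?B. N ^ j - cluster_size K x j z) / N ^ j = (\<Sum>z\<in>?B. 1 - cluster_size K x j z / N ^ j)"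
          unfolding sum_divide_distrib diff_divide_distrib using N by simp
        then show ?thesis by (simp only: times_divide_eq_right[symmetric])
      qed
      have c2: "(greedy_weight x (t * 3 ^ j) - (\<Sum>z\<in>?C - ?B. cell_score K x j z) + K * (2 * td * (N - 1) ^ j)) / N ^ j
        \<le> (\<gamma> + M * \<eta> + \<delta>) * td - (\<Sum>z\<in>?C - ?B. cell_score K x j z / N ^ j) + K * (2 * td) * \<rho> ^ j"
        using G by (simp add: add_divide_distrib diff_divide_distrib sum_divide_distrib \<rho>pow[symmetric] mult.assoc)
      have "greedy_weight x (s * 3 ^ j) \<le> max (M * (\<Sum>z\<in>?B. N ^ j - cluster_size K x j z))
        (greedy_weight x (t * 3 ^ j) - (\<Sum>z\<in>?C - ?B. cell_score K x j z) + K * (2 * td * (N - 1) ^ j))"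
      proof -
        have "s \<le> t" using r by (simp add: t_def)
        from greedy_weight_box_le[OF d K M s this, where j = j] elim(1) show ?thesis
          by (simp add: N_def td_def)
      qed
      then have "greedy_weight x (s * 3 ^ j) / N ^ j \<le> max (M * (\<Sum>z\<in>?B. N ^ j - cluster_size K x j z))
        (greedy_weight x (t * 3 ^ j) - (\<Sum>z\<in>?C - ?B. cell_score K x j z) + K * (2 * td * (N - 1) ^ j)) / N ^ j"
        using Nj[of j] by (intro divide_right_mono) auto
      also have "\<dots> = max (M * (\<Sum>z\<in>?B. N ^ j - cluster_size K x j z) / N ^ j)
        ((greedy_weight x (t * 3 ^ j) - (\<Sum>z\<in>?C - ?B. cell_score K x j z) + K * (2 * td * (N - 1) ^ j)) / N ^ j)"
        using Nj[of j] by (simp add: max_divide_distrib_right)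
      also have "\<dots> \<le> ?g j" unfolding c1 using c2 by (intro max.mono) auto
      finally show ?case .
    qed
    have "?g \<longlonglongrightarrow> max (M * (\<Sum>z\<in>?B. 1 - \<kappa>))
      ((\<gamma> + M * \<eta> + \<delta>) * td - (\<Sum>z\<in>?C - ?B. \<gamma>) + K * (2 * td) * 0)"
      by (intro tendsto_max tendsto_add tendsto_mult tendsto_diff tendsto_sum tendsto_const score' size' \<rho>0)
    then have lim: "?g \<longlonglongrightarrow> max (M * (sd * (1 - \<kappa>))) ((\<gamma> + M * \<eta> + \<delta>) * td - (td - sd) * \<gamma>)"
      by (simp only: sum_constant cardCB card_lattice_box of_nat_power sd_def[symmetric] mult_zero_right add_0_right)
    have "max (M * (sd * (1 - \<kappa>))) ((\<gamma> + M * \<eta> + \<delta>) * td - (td - sd) * \<gamma>) < (\<gamma> + N * (M * \<eta>) + \<epsilon>) * sd"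
    proof -
      have "M * (sd * (1 - \<kappa>)) \<le> M * (sd * \<eta>)" using \<eta> M(2) sd by (intro mult_left_mono) auto
      also have "\<dots> = 1 * (M * \<eta> * sd)" by simp
      also have "\<dots> \<le> N * (M * \<eta> * sd)" using N M(2) \<eta> sd by (intro mult_right_mono) auto
      finally have 1: "M * (sd * (1 - \<kappa>)) \<le> N * (M * \<eta>) * sd" by (simp add: mult.assoc)
      have "(M * \<eta> + \<delta>) * td \<le> (M * \<eta> + \<delta>) * (N * sd)"
        using td M(2) \<eta> \<delta> by (intro mult_left_mono) auto
      also have "\<dots> = N * (M * \<eta>) * sd + \<epsilon> / 2 * sd" using N by (simp add: \<delta>_def field_simps)
      finally have "(\<gamma> + M * \<eta> + \<delta>) * td - (td - sd) * \<gamma> \<le> \<gamma> * sd + N * (M * \<eta>) * sd + \<epsilon> / 2 * sd"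
        by (simp add: algebra_simps)
      moreover have "0 < \<epsilon> / 2 * sd" "0 \<le> \<gamma> * sd" "(\<gamma> + N * (M * \<eta>) + \<epsilon>) * sd = \<gamma> * sd + N * (M * \<eta>) * sd + \<epsilon> / 2 * sd + \<epsilon> / 2 * sd"
        using \<epsilon> sd \<gamma> by (auto simp: algebra_simps)
      ultimately show ?thesis using 1 by (simp only: max_less_iff_conj) linarith
    qed
    from eventually_le_of_tendsto[OF le lim this] show ?thesis
      by eventually_elim (use Nj in \<open>simp only: vol pos_divide_le_eq mult.assoc sd_def\<close>)
  qed
  have pos: "0 \<le> \<gamma> + N * (M * \<eta>)" using \<gamma> N M(2) \<eta> by simp
  show ?thesis
    unfolding N_def[symmetric]
    by (rule monotone_density_from_triadic_scales[OF greedy_weight_mono \<gamma> pos lower upper \<epsilon>])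
qed

lemma cluster_clip: "0 \<le> K \<Longrightarrow> 0 \<le> M \<Longrightarrow> cluster K (clip M x) j z = cluster K x j z"
  by (induction j arbitrary: z) (auto simp: good_clip)

lemma cluster_size_clip: "0 \<le> K \<Longrightarrow> 0 \<le> M \<Longrightarrow> cluster_size K (clip M x) j z = cluster_size K x j z"
  by (simp add: cluster_size_def good_clip cluster_clip)

lemma greedy_weight_clip:
  assumes "1 \<le> n"
  shows "greedy_weight (clip M x) n \<le> greedy_weight x n"
    and "greedy_weight x n \<le> greedy_weight (clip M x) n + (\<Sum>v\<in>lattice_box n. max (x v - M) 0)"
proof -
  obtain \<xi> where \<xi>: "lattice_animal \<xi>" "\<xi> \<subseteq> lattice_box n" "greedy_weight (clip M x) n = weight (clip M x) \<xi>"
    using greedy_weight_attained[OF assms] .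
  have "weight (clip M x) \<xi> \<le> weight x \<xi>" unfolding weight_def by (intro sum_mono) simp
  then show "greedy_weight (clip M x) n \<le> greedy_weight x n"
    using greedy_weight_ge[OF \<xi>(1,2), of x] \<xi>(3) by simp
  obtain \<zeta> where \<zeta>: "lattice_animal \<zeta>" "\<zeta> \<subseteq> lattice_box n" "greedy_weight x n = weight x \<zeta>"
    using greedy_weight_attained[OF assms] .
  have "weight x \<zeta> = weight (clip M x) \<zeta> + (\<Sum>v\<in>\<zeta>. max (x v - M) 0)"
    unfolding weight_def sum.distrib[symmetric] by (intro sum.cong) auto
  also have "\<dots> \<le> greedy_weight (clip M x) n + (\<Sum>v\<in>lattice_box n. max (x v - M) 0)"
    by (intro add_mono greedy_weight_ge sum_mono2 \<zeta>(1,2)) auto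
  finally show "greedy_weight x n \<le> greedy_weight (clip M x) n + (\<Sum>v\<in>lattice_box n. max (x v - M) 0)"
    using \<zeta>(3) by simp
qed

context iid_field
begin

section \<open>The density of the greedy weight\<close>

lemma bad_prob_tendsto_0: "(\<lambda>k. bad_prob (real k) 0) \<longlonglongrightarrow> 0"
proof (rule tendsto_sandwich[of "\<lambda>_. 0"])
  have "(\<lambda>k. cdf F (- real k)) \<longlonglongrightarrow> 0"
    using finite_borel_measure.cdf_lim_at_bot[OF finite_borel_measure_M]
    by (rule filterlim_compose)
       (intro filterlim_compose[OF filterlim_uminus_at_bot_at_top filterlim_real_sequentially])
  then show "(\<lambda>k. cdf F (- real k)) \<longlonglongrightarrow> 0" .
  have "bad_prob K 0 \<le> cdf F (- K)" for K
  proof -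
    have "bad_prob K 0 = expectation (\<lambda>u. of_bool (\<not> - K \<le> u))"
      unfolding bad_prob_def good.simps(1)
      by (rule expectation_coordinate) measurable
    also have "\<dots> \<le> expectation (\<lambda>u. indicator {..- K} u)"
      by (intro integral_mono integrable_const_bound[of _ 1]) (auto simp: indicator_def)
    also have "\<dots> = cdf F (- K)" by (simp add: cdf_def)
    finally show ?thesis .
  qed
  then show "eventually (\<lambda>k. bad_prob (real k) 0 \<le> cdf F (- real k)) sequentially" by simp
qed (simp_all add: bad_prob_nonneg)

text \<open>
  The constant \<open>K\<close> is chosen so large that the error \<open>3^d * (M * \<eta>)\<close> of \<open>greedy_weight_density\<close> is below \<open>\<epsilon> / 2\<close>.
\<close>

lemma clipped_density_near_constant:
  assumes d: "CARD('d) \<ge> 2" and M: "0 \<le> M" and \<epsilon>: "0 < \<epsilon>"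
  shows "\<exists>\<gamma>. AE x in P. eventually (\<lambda>n. \<bar>greedy_weight (clip M x) n / real n ^ CARD('d) - \<gamma>\<bar> \<le> \<epsilon>) sequentially"
proof -
  define N :: real where "N = 3 ^ CARD('d)"
  have N: "1 < N" unfolding N_def by (intro one_less_power) auto
  \<comment> \<open>The proportion of sites outside the clusters will be at most \<open>2 * \<theta>\<close>.\<close>
  define \<theta> where "\<theta> = min (1 / 2) (\<epsilon> / (4 * (N * M + 1)))"
  have NM: "0 \<le> N * M" using N M by simp
  have "0 < \<epsilon> / (4 * (N * M + 1))" using \<epsilon> NM by (intro divide_pos_pos) auto
  then have \<theta>: "0 < \<theta>" by (simp add: \<theta>_def)
  have \<theta>2: "\<theta> \<le> 1 / 2" unfolding \<theta>_def by (rule min.cobounded1)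
  have "(\<lambda>k. N\<^sup>2 * bad_prob (real k) 0) \<longlonglongrightarrow> N\<^sup>2 * 0"
    by (intro tendsto_mult tendsto_const bad_prob_tendsto_0)
  then have "eventually (\<lambda>k. N\<^sup>2 * bad_prob (real k) 0 < \<theta>) sequentially"
    using \<theta> by (intro order_tendstoD(2)[where y = 0]) auto
  then obtain k where k: "N\<^sup>2 * bad_prob (real k) 0 < \<theta>" by (auto simp: eventually_sequentially)
  define K where "K = real k"
  have K: "0 \<le> K" by (simp add: K_def)
  have bad: "(3 ^ CARD('d))\<^sup>2 * bad_prob K 0 \<le> \<theta>" using k by (simp add: K_def N_def)
  note s = summable_bad_prob[OF bad \<theta>2]
  define \<eta> where "\<eta> = suminf (bad_prob K)"
  have \<eta>: "0 \<le> \<eta>" unfolding \<eta>_def by (intro suminf_nonneg s bad_prob_nonneg)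
  have "N * (M * \<eta>) = N * M * \<eta>" by simp
  also have "\<dots> \<le> N * M * (2 * \<theta>)" unfolding \<eta>_def by (rule mult_left_mono[OF s(2) NM])
  also have "\<dots> \<le> N * M * (2 * (\<epsilon> / (4 * (N * M + 1))))"
    using NM by (intro mult_left_mono) (auto simp: \<theta>_def)
  also have "\<dots> \<le> \<epsilon> / 2" using NM \<epsilon> by (simp add: divide_simps)
  finally have small: "N * (M * \<eta>) \<le> \<epsilon> / 2" .
  obtain \<gamma> where \<gamma>: "0 \<le> \<gamma>" "\<And>z. AE x in P. (\<lambda>j. cell_score K (clip M x) j z / (3 ^ CARD('d)) ^ j) \<longlonglongrightarrow> \<gamma>"
    using cell_score_density[OF d K M s(1)] by blast
  obtain \<kappa> where \<kappa>: "1 - \<eta> \<le> \<kappa>" "\<And>z. AE x in P. (\<lambda>j. cluster_size K x j z / (3 ^ CARD('d)) ^ j) \<longlonglongrightarrow> \<kappa>"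
    using cluster_density[OF d s(1)] unfolding \<eta>_def by blast
  have "AE x in P. \<forall>z. (\<lambda>j. cell_score K (clip M x) j z / (3 ^ CARD('d)) ^ j) \<longlonglongrightarrow> \<gamma>"
    unfolding AE_all_countable using \<gamma>(2) by blast
  moreover have "AE x in P. \<forall>z. (\<lambda>j. cluster_size K x j z / (3 ^ CARD('d)) ^ j) \<longlonglongrightarrow> \<kappa>"
    unfolding AE_all_countable using \<kappa>(2) by blast
  moreover have "AE x in P. \<forall>z. eventually (\<lambda>j. good K x j z) sequentially"
    unfolding AE_all_countable using AE_eventually_good[OF s(1)] by blast
  ultimately have "AE x in P. eventually (\<lambda>n. \<bar>greedy_weight (clip M x) n / real n ^ CARD('d) - \<gamma>\<bar> \<le> \<epsilon>) sequentially"
  proof eventually_elim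
    case (elim x)
    have "eventually (\<lambda>n. \<gamma> - \<epsilon> / 2 \<le> greedy_weight (clip M x) n / real n ^ CARD('d)
      \<and> greedy_weight (clip M x) n / real n ^ CARD('d) \<le> \<gamma> + 3 ^ CARD('d) * (M * \<eta>) + \<epsilon> / 2) sequentially"
    proof (rule greedy_weight_density[OF d K _ M _ _ \<gamma>(1) _ \<kappa>(1) \<eta>])
      show "eventually (\<lambda>j. good K (clip M x) j z) sequentially" for z
        using elim(3) by (simp add: good_clip K M)
      show "(\<lambda>j. cell_score K (clip M x) j z / (3 ^ CARD('d)) ^ j) \<longlonglongrightarrow> \<gamma>" for z
        using elim(1) by simp
      show "(\<lambda>j. cluster_size K (clip M x) j z / (3 ^ CARD('d)) ^ j) \<longlonglongrightarrow> \<kappa>" for z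
        using elim(2) by (simp add: cluster_size_clip K M)
    qed (use \<epsilon> in auto)
    then show ?case
    proof eventually_elim
      case (elim n)
      then show ?case using small unfolding N_def by (intro abs_leI) linarith+
    qed
  qed
  then show ?thesis by blast
qed

text \<open>
  Because \<open>d \<ge> 2\<close>, the variance of the average over a box of side \<open>n\<close> is of order at most \<open>n^-2\<close>, which is summable.
\<close>

lemma box_average_converges:
  assumes d: "CARD('d) \<ge> 2" and h: "h \<in> borel_measurable borel" and sq: "integrable F (\<lambda>u. (h u)\<^sup>2)"
  shows "AE x in P. (\<lambda>n. (\<Sum>v\<in>lattice_box n. h (x v)) / real n ^ CARD('d)) \<longlonglongrightarrow> expectation h"
proof -
  have [measurable]: "h \<in> borel_measurable borel" by (rule h)
  define \<mu> where "\<mu> = expectation h"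
  have hF: "h \<in> borel_measurable F" using h by (simp add: measurable_cong_sets[OF events_eq_borel refl])
  have inth: "integrable F h" by (rule square_integrable_imp_integrable[OF hF sq])
  have coord: "distr P F (\<lambda>x. x v) = F" for v
    unfolding P_eq by (rule distr_PiM_component) (auto intro: prob_space_axioms)
  have mcoord: "(\<lambda>x. x v) \<in> measurable P F" for v
    by (simp add: measurable_cong_sets[OF refl events_eq_borel])
  have int_coord: "integrable P (\<lambda>x. f (x v))" if "integrable F f" for f :: "real \<Rightarrow> real" and v
    using integrable_distr[OF mcoord[of v], of f] that by (simp add: coord)
  have sq\<mu>: "integrable F (\<lambda>u. (h u - \<mu>)\<^sup>2)" using sq inth by (simp add: power2_diff)
  define \<sigma> where "\<sigma> = expectation (\<lambda>u. (h u - \<mu>)\<^sup>2)"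
  have \<sigma>: "0 \<le> \<sigma>" unfolding \<sigma>_def by (intro Bochner_Integration.integral_nonneg) auto
  define A where "A n x = (\<Sum>v\<in>lattice_box n. h (x v)) / real n ^ CARD('d)" for n and x :: "int ^ 'd \<Rightarrow> real"
  have A: "integrable P (\<lambda>x. (A n x - \<mu>)\<^sup>2)" "P.expectation (\<lambda>x. (A n x - \<mu>)\<^sup>2) = \<sigma> / real n ^ CARD('d)"
    if n: "1 \<le> n" for n
  proof -
    let ?B = "lattice_box n :: (int ^ 'd) set" and ?V = "real n ^ CARD('d)"
    have V: "0 < ?V" using n by simp
    have eq: "A n x - \<mu> = (\<Sum>v\<in>?B. h (x v) - \<mu>) / ?V" for x
      using V by (simp add: A_def sum_subtractf card_lattice_box diff_divide_distrib)
    have "P.expectation (\<lambda>x. h (x v) - \<mu>) = 0" for v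
      using int_coord[OF inth] P.prob_space by (simp add: expectation_coordinate[OF h] \<mu>_def)
    then have ess: "integrable P (\<lambda>x. (\<Sum>v\<in>?B. h (x v) - \<mu>)\<^sup>2)"
      "P.expectation (\<lambda>x. (\<Sum>v\<in>?B. h (x v) - \<mu>)\<^sup>2) = (\<Sum>v\<in>?B. P.expectation (\<lambda>x. (h (x v) - \<mu>)\<^sup>2))"
      using int_coord[OF sq\<mu>]
      by (intro expectation_sum_square[where A = "\<lambda>v. {v}"]; simp)+
    show "integrable P (\<lambda>x. (A n x - \<mu>)\<^sup>2)"
      unfolding eq power_divide by (intro integrable_divide_zero ess(1))
    have one: "P.expectation (\<lambda>x. (h (x v) - \<mu>)\<^sup>2) = \<sigma>" for v
      unfolding \<sigma>_def by (rule expectation_coordinate) measurable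
    have "P.expectation (\<lambda>x. (A n x - \<mu>)\<^sup>2) = (\<Sum>v\<in>?B. \<sigma>) / ?V\<^sup>2"
      unfolding eq power_divide by (simp only: Bochner_Integration.integral_divide_zero ess(2) one)
    then show "P.expectation (\<lambda>x. (A n x - \<mu>)\<^sup>2) = \<sigma> / ?V"
      using V by (simp add: card_lattice_box power2_eq_square)
  qed
  \<comment> \<open>The formula for the second moment fails for the empty box, hence the shift.\<close>
  have "AE x in P. (\<lambda>n. (A (Suc n) x - \<mu>)\<^sup>2) \<longlonglongrightarrow> 0"
  proof (rule P.AE_LIMSEQ_zero_of_summable_expectations)
    show "summable (\<lambda>n. P.expectation (\<lambda>x. (A (Suc n) x - \<mu>)\<^sup>2))"
    proof (rule summable_comparison_test'[where N = 0])
      have "summable (\<lambda>n. inverse (real n ^ 2))" by (rule inverse_power_summable) simp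
      then have "summable (\<lambda>n. inverse (real (Suc n) ^ 2))" by (subst summable_Suc_iff)
      then show "summable (\<lambda>n. \<sigma> * inverse (real (Suc n) ^ 2))" by (rule summable_mult)
      fix n :: nat
      have "real (Suc n) ^ 2 \<le> real (Suc n) ^ CARD('d)" using d by (intro power_increasing) auto
      then have "\<sigma> / real (Suc n) ^ CARD('d) \<le> \<sigma> / real (Suc n) ^ 2" 
        using \<sigma> by (intro divide_left_mono) auto
      then show "norm (P.expectation (\<lambda>x. (A (Suc n) x - \<mu>)\<^sup>2)) \<le> \<sigma> * inverse (real (Suc n) ^ 2)"
        using \<sigma> A(2)[of "Suc n"] by (simp add: divide_inverse)
    qed
  qed (use A(1) in auto)
  then show ?thesis
  proof eventually_elim
    case (elim x)
    then have "(\<lambda>n. A (Suc n) x - \<mu>) \<longlonglongrightarrow> 0"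
      using tendsto_real_sqrt[OF elim] by (simp add: tendsto_rabs_zero_iff)
    then have "(\<lambda>n. A (Suc n) x) \<longlonglongrightarrow> \<mu>" by (simp add: LIM_zero_iff)
    then have "(\<lambda>n. A n x) \<longlonglongrightarrow> \<mu>" by (rule LIMSEQ_imp_Suc)
    then show ?case by (simp add: A_def \<mu>_def)
  qed
qed

text \<open>
  Clip at a level \<open>M\<close> for which the mean of \<open>max (X - M) 0\<close> is below \<open>\<epsilon> / 4\<close>.
\<close>

lemma density_near_constant:
  assumes d: "CARD('d) \<ge> 2" and sq: "integrable F (\<lambda>u. (max u 0)\<^sup>2)" and \<epsilon>: "0 < \<epsilon>"
  shows "\<exists>g. AE x in P. eventually (\<lambda>n. \<bar>greedy_weight x n / real n ^ CARD('d) - g\<bar> \<le> \<epsilon>) sequentially"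
proof -
  have mF: "f \<in> borel_measurable F" if "f \<in> borel_measurable borel" for f :: "real \<Rightarrow> real"
    using that by (simp add: measurable_cong_sets[OF events_eq_borel refl])
  have int: "integrable F (\<lambda>u. max u 0)"
    by (rule square_integrable_imp_integrable[OF mF sq]) measurable
  have "(\<lambda>m. expectation (\<lambda>u. max (u - real m) 0)) \<longlonglongrightarrow> expectation (\<lambda>u. 0)"
  proof (rule integral_dominated_convergence[OF _ _ int])
    show "AE u in F. (\<lambda>m. max (u - real m) 0) \<longlonglongrightarrow> 0"
    proof (rule AE_I2)
      fix u :: real
      have "eventually (\<lambda>m. real m \<ge> u) sequentially"
        using filterlim_real_sequentially by (simp add: filterlim_at_top)
      then have "eventually (\<lambda>m. max (u - real m) 0 = 0) sequentially" by eventually_elim simp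
      then show "(\<lambda>m. max (u - real m) 0) \<longlonglongrightarrow> 0" by (rule tendsto_eventually)
    qed
    show "(\<lambda>u. max (u - real m) 0) \<in> borel_measurable F" for m by (rule mF) measurable
  qed auto
  then have "eventually (\<lambda>m. expectation (\<lambda>u. max (u - real m) 0) < \<epsilon> / 4) sequentially"
    using \<epsilon> by (intro order_tendstoD(2)) auto
  then obtain m where m: "expectation (\<lambda>u. max (u - real m) 0) < \<epsilon> / 4" by (auto simp: eventually_sequentially)
  define M where "M = real m"
  define h where "h u = max (u - M) 0" for u
  have h: "h \<in> borel_measurable borel" unfolding h_def by measurable
  have "integrable F (\<lambda>u. (h u)\<^sup>2)"
  proof (rule Bochner_Integration.integrable_bound[OF sq])
    show "(\<lambda>u. (h u)\<^sup>2) \<in> borel_measurable F" by (rule mF) (rule borel_measurable_power[OF h])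
    have "(h u)\<^sup>2 \<le> (max u 0)\<^sup>2" for u by (intro power_mono) (auto simp: h_def M_def)
    then show "AE u in F. norm ((h u)\<^sup>2) \<le> norm ((max u 0)\<^sup>2)" by simp
  qed
  note avg = box_average_converges[OF d h this]
  obtain \<gamma> where \<gamma>: "AE x in P. eventually (\<lambda>n. \<bar>greedy_weight (clip M x) n / real n ^ CARD('d) - \<gamma>\<bar> \<le> \<epsilon> / 2) sequentially"
    using clipped_density_near_constant[OF d, of M "\<epsilon> / 2"] \<epsilon> by (auto simp: M_def)
  have "AE x in P. eventually (\<lambda>n. \<bar>greedy_weight x n / real n ^ CARD('d) - \<gamma>\<bar> \<le> \<epsilon>) sequentially"
    using \<gamma> avg
  proof eventually_elim
    case (elim x)
    have "expectation h < \<epsilon> / 4" using m by (simp add: h_def[abs_def] M_def)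
    then have "eventually (\<lambda>n. (\<Sum>v\<in>lattice_box n. h (x v)) / real n ^ CARD('d) < \<epsilon> / 4) sequentially"
      by (intro order_tendstoD(2)[OF elim(2)])
    with elim(1) eventually_ge_at_top[of 1] show ?case
    proof eventually_elim
      case (elim n)
      let ?V = "real n ^ CARD('d)"
      have V: "0 < ?V" using elim(2) by simp
      note G = greedy_weight_clip[OF elim(2), where M = M and x = x, folded h_def]
      have "greedy_weight (clip M x) n / ?V \<le> greedy_weight x n / ?V"
        using G(1) V by (intro divide_right_mono) auto
      moreover have "greedy_weight x n / ?V \<le> greedy_weight (clip M x) n / ?V + (\<Sum>v\<in>lattice_box n. h (x v)) / ?V"
        unfolding add_divide_distrib[symmetric] using G(2) V by (intro divide_right_mono) auto
      ultimately show ?case using elim(1,3) \<epsilon> by (simp only: abs_le_iff) linarith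
    qed
  qed
  then show ?thesis by blast
qed

text \<open>
  The constants for \<open>\<epsilon> = 1 / (m + 1)\<close> form a Cauchy sequence, because a single field in the almost sure event is close to all of them.
\<close>

lemma density_converges:
  assumes d: "CARD('d) \<ge> 2" and sq: "integrable F (\<lambda>u. (max u 0)\<^sup>2)"
  shows "\<exists>G. AE x in P. (\<lambda>n. greedy_weight x n / real n ^ CARD('d)) \<longlonglongrightarrow> G"
proof -
  define r where "r x n = greedy_weight x n / real n ^ CARD('d)" for x :: "int ^ 'd \<Rightarrow> real" and n
  have "\<exists>g. AE x in P. eventually (\<lambda>n. \<bar>r x n - g\<bar> \<le> inverse (real (Suc m))) sequentially" for m
    unfolding r_def by (rule density_near_constant[OF d sq]) simp
  then obtain g where g: "\<And>m. AE x in P. eventually (\<lambda>n. \<bar>r x n - g m\<bar> \<le> inverse (real (Suc m))) sequentially"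
    by metis
  then have all: "AE x in P. \<forall>m. eventually (\<lambda>n. \<bar>r x n - g m\<bar> \<le> inverse (real (Suc m))) sequentially"
    unfolding AE_all_countable by blast
  have "\<exists>x. \<forall>m. eventually (\<lambda>n. \<bar>r x n - g m\<bar> \<le> inverse (real (Suc m))) sequentially"
  proof (rule ccontr)
    assume none: "\<nexists>x. \<forall>m. eventually (\<lambda>n. \<bar>r x n - g m\<bar> \<le> inverse (real (Suc m))) sequentially"
    from all have "AE x in P. False" by eventually_elim (use none in blast)
    then show False by simp
  qed
  then obtain x0 where x0: "\<And>m. eventually (\<lambda>n. \<bar>r x0 n - g m\<bar> \<le> inverse (real (Suc m))) sequentially" by blast
  have gap: "\<bar>g m - g k\<bar> \<le> inverse (real (Suc m)) + inverse (real (Suc k))" for m k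
  proof -
    have "eventually (\<lambda>n. \<bar>g m - g k\<bar> \<le> inverse (real (Suc m)) + inverse (real (Suc k))) sequentially"
      using x0[of m] x0[of k] by eventually_elim linarith
    then show ?thesis by simp
  qed
  have inv0: "eventually (\<lambda>m. inverse (real (Suc m)) < \<epsilon>) sequentially" if "0 < \<epsilon>" for \<epsilon>
    using order_tendstoD(2)[OF LIMSEQ_inverse_real_of_nat that] .
  have "Cauchy g"
  proof (rule metric_CauchyI)
    fix \<epsilon> :: real assume "0 < \<epsilon>"
    then obtain m0 where m0: "\<And>m. m0 \<le> m \<Longrightarrow> inverse (real (Suc m)) < \<epsilon> / 2"
      using inv0[of "\<epsilon> / 2"] by (auto simp: eventually_sequentially)
    show "\<exists>m0. \<forall>m\<ge>m0. \<forall>k\<ge>m0. dist (g m) (g k) < \<epsilon>"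
    proof (intro exI[of _ m0] allI impI)
      fix m k assume "m0 \<le> m" "m0 \<le> k"
      then show "dist (g m) (g k) < \<epsilon>" using gap[of m k] m0[of m] m0[of k] by (simp add: dist_real_def)
    qed
  qed
  then obtain G where G: "g \<longlonglongrightarrow> G" using Cauchy_convergent convergentD by blast
  have "AE x in P. r x \<longlonglongrightarrow> G"
    using all
  proof eventually_elim
    case (elim x)
    show ?case
    proof (rule metric_LIMSEQ_I)
      fix \<epsilon> :: real assume \<epsilon>: "0 < \<epsilon>"
      have "eventually (\<lambda>m. \<bar>g m - G\<bar> < \<epsilon> / 2) sequentially"
        using tendstoD[OF G, of "\<epsilon> / 2"] \<epsilon> by (simp add: dist_real_def)
      with inv0[of "\<epsilon> / 2"] \<epsilon> have "eventually (\<lambda>m. \<bar>g m - G\<bar> < \<epsilon> / 2 \<and> inverse (real (Suc m)) < \<epsilon> / 2) sequentially"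
        by (simp add: eventually_conj_iff)
      then obtain m where m: "\<bar>g m - G\<bar> < \<epsilon> / 2" "inverse (real (Suc m)) < \<epsilon> / 2"
        by (auto simp: eventually_sequentially)
      have "eventually (\<lambda>n. \<bar>r x n - G\<bar> < \<epsilon>) sequentially"
        using elim[rule_format, of m] by eventually_elim (use m in linarith)
      then show "\<exists>n0. \<forall>n\<ge>n0. dist (r x n) G < \<epsilon>" by (simp add: eventually_sequentially dist_real_def)
    qed
  qed
  then show ?thesis by (auto simp: r_def[abs_def])
qed

end

section \<open>The moment condition\<close>

text \<open>
  Let \<open>h = (1 - F)^(1/d)\<close>, with integral \<open>J\<close> over the positive half-line.  As \<open>h\<close> decreases, \<open>t h(t) \<le> J\<close>, and as
  \<open>d \<ge> 2\<close>, \<open>1 - F \<le> h\<^sup>2\<close>.  Hence the second moment \<open>\<integral> 2 t (1 - F(t)) dt\<close> of the positive part is at most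
  \<open>2 J \<integral> h = 2 J\<^sup>2\<close>.
\<close>

lemma (in real_distribution) square_integrable_positive_part:
  assumes d: "d \<ge> 2"
    and fin: "(\<integral>\<^sup>+ t\<in>{0..}. ennreal ((1 - cdf M t) powr (1 / real d)) \<partial>lborel) < \<infinity>"
  shows "integrable M (\<lambda>u. (max u 0)\<^sup>2)"
proof -
  define h where "h t = (1 - cdf M t) powr (1 / real d)" for t
  have cdf1: "0 \<le> 1 - cdf M t" "1 - cdf M t \<le> 1" for t
    using cdf_bounded_prob[of t] by (auto simp: cdf_nonneg)
  have h0: "0 \<le> h t" for t by (simp add: h_def)
  have anti: "h t \<le> h s" if "s \<le> t" for s t
    unfolding h_def using cdf_nondecreasing[OF that] cdf1[of t] by (intro powr_mono2) auto
  have [measurable]: "cdf M \<in> borel_measurable borel"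
    by (rule borel_measurable_mono) (auto simp: mono_def cdf_nondecreasing)
  have [measurable]: "h \<in> borel_measurable borel" unfolding h_def by measurable
  define J where "J = (\<integral>\<^sup>+ t\<in>{0..}. ennreal (h t) \<partial>lborel)"
  have J: "J < \<infinity>" using fin by (simp add: J_def h_def)
  have tail: "1 - cdf M t \<le> h t * h t" for t
  proof -
    have "1 - cdf M t = (1 - cdf M t) powr 1" using cdf1[of t] by simp
    also have "\<dots> \<le> (1 - cdf M t) powr (1 / real d + 1 / real d)"
      using cdf1[of t] d by (intro powr_mono') (auto simp: field_simps)
    also have "\<dots> = h t * h t" by (simp only: h_def powr_add)
    finally show ?thesis .
  qed
  have th: "ennreal (t * h t) \<le> J" if "0 \<le> t" for t
  proof -
    have "ennreal (t * h t) = (\<integral>\<^sup>+ s. ennreal (h t) * indicator {0..t} s \<partial>lborel)"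
      using that h0[of t] by (simp add: nn_integral_cmult_indicator ennreal_mult mult.commute)
    also have "\<dots> \<le> J" unfolding J_def
      by (intro nn_integral_mono) (auto simp: indicator_def intro!: ennreal_leI anti)
    finally show ?thesis .
  qed
  have layer: "ennreal ((max u 0)\<^sup>2) = (\<integral>\<^sup>+ t. ennreal (2 * t) * indicator {0..} t * indicator {t<..} u \<partial>lborel)" for u :: real
  proof -
    have "(\<integral>\<^sup>+ t. ennreal (2 * t) * indicator {0..max u 0} t \<partial>lborel) = ennreal ((max u 0)\<^sup>2 - 0\<^sup>2)"
      by (rule nn_integral_FTC_Icc) (auto intro!: derivative_eq_intros)
    \<comment> \<open>The two integrands differ at most at \<open>t = u\<close> and, if \<open>u < 0\<close>, at \<open>t = 0\<close>, where the factor \<open>2 * t\<close> vanishes.\<close>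
    moreover have "AE t in lborel. ennreal (2 * t) * indicator {0..} t * indicator {t<..} u
      = ennreal (2 * t) * indicator {0..max u 0} t"
      using AE_lborel_singleton[of u] by eventually_elim (auto simp: indicator_def)
    then have "(\<integral>\<^sup>+ t. ennreal (2 * t) * indicator {0..} t * indicator {t<..} u \<partial>lborel)
      = (\<integral>\<^sup>+ t. ennreal (2 * t) * indicator {0..max u 0} t \<partial>lborel)"
      by (rule nn_integral_cong_AE)
    ultimately show ?thesis by simp
  qed
  interpret pair_sigma_finite lborel M ..
  have "(\<integral>\<^sup>+ u. ennreal ((max u 0)\<^sup>2) \<partial>M)
    = (\<integral>\<^sup>+ u. (\<integral>\<^sup>+ t. ennreal (2 * t) * indicator {0..} t * indicator {t<..} u \<partial>lborel) \<partial>M)"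
    by (simp add: layer)
  also have "\<dots> = (\<integral>\<^sup>+ t. (\<integral>\<^sup>+ u. ennreal (2 * t) * indicator {0..} t * indicator {t<..} u \<partial>M) \<partial>lborel)"
  proof (rule Fubini')
    have "(\<lambda>(t, u). ennreal (2 * t) * indicator {0..} t * (if t < u then 1 else 0)) \<in> borel_measurable (lborel \<Otimes>\<^sub>M M)"
      by measurable
    moreover have "(indicator {t<..} u :: ennreal) = (if t < u then 1 else 0)" for t u :: real
      by (simp add: indicator_def)
    ultimately show "(\<lambda>(t, u). ennreal (2 * t) * indicator {0..} t * indicator {t<..} u) \<in> borel_measurable (lborel \<Otimes>\<^sub>M M)"
      by simp
  qed
  also have "\<dots> \<le> (\<integral>\<^sup>+ t. 2 * J * (ennreal (h t) * indicator {0..} t) \<partial>lborel)"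
  proof (rule nn_integral_mono)
    fix t :: real
    show "(\<integral>\<^sup>+ u. ennreal (2 * t) * indicator {0..} t * indicator {t<..} u \<partial>M) \<le> 2 * J * (ennreal (h t) * indicator {0..} t)"
    proof (cases "0 \<le> t")
      case True
      have "emeasure M {t<..} = ennreal (1 - cdf M t)"
      proof -
        have "{t<..} = space M - {..t}" by auto
        then have "prob {t<..} = 1 - cdf M t" using prob_compl[of "{..t}"] by (simp add: cdf_def)
        then show ?thesis by (simp add: emeasure_eq_measure)
      qed
      then have "(\<integral>\<^sup>+ u. ennreal (2 * t) * indicator {0..} t * indicator {t<..} u \<partial>M) = ennreal (2 * t) * ennreal (1 - cdf M t)"
        using True by (simp add: nn_integral_cmult_indicator)
      also have "\<dots> \<le> ennreal (2 * t) * ennreal (h t * h t)" by (intro mult_left_mono ennreal_leI tail) simp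
      also have "\<dots> = 2 * ennreal (t * h t) * ennreal (h t)"
        using True h0[of t] by (simp add: ennreal_mult mult_ac)
      also have "\<dots> \<le> 2 * J * ennreal (h t)" by (intro mult_right_mono mult_left_mono th True) auto
      finally show ?thesis using True by simp
    qed simp
  qed
  also have "\<dots> = 2 * J * J" unfolding J_def by (subst nn_integral_cmult) auto
  also have "\<dots> < \<infinity>" using J by (simp add: ennreal_mult_less_top)
  finally show ?thesis by (intro integrableI_bounded) auto
qed

section \<open>Linear growth of greedy lattice animals in a box\<close>

theorem theorem1p2:
  fixes F :: "real measure"
  assumes "CARD('d::finite) \<ge> 2"
    and "real_distribution F"
    and "(\<integral>\<^sup>+ x \<in> {0..}. ennreal ((1 - cdf F x) powr (1 / real CARD('d))) \<partial>lborel) < \<infinity>"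
  shows "\<exists>G::real. \<forall>(M :: 'a measure) (X :: int ^ 'd \<Rightarrow> 'a \<Rightarrow> real).
           prob_space M \<longrightarrow>
           prob_space.indep_vars M (\<lambda>_. borel) X UNIV \<longrightarrow>
           (\<forall>v. distr M borel (X v) = F) \<longrightarrow>
           (AE \<omega> in M. (\<lambda>n. greedy_weight (\<lambda>v. X v \<omega>) n / real n ^ CARD('d)) \<longlonglongrightarrow> G)"
proof -
  interpret F: real_distribution F by (rule assms(2))
  interpret iid_field F "PiM UNIV (\<lambda>_. F) :: (int ^ 'd \<Rightarrow> real) measure"
    by unfold_locales simp
  obtain G where G: "AE x in PiM UNIV (\<lambda>_. F). (\<lambda>n. greedy_weight (x :: int ^ 'd \<Rightarrow> real) n / real n ^ CARD('d)) \<longlonglongrightarrow> G"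
    using density_converges[OF assms(1) F.square_integrable_positive_part[OF assms(1,3)]] by blast
  show ?thesis
  proof (intro exI[of _ G] allI impI)
    fix M :: "'a measure" and X :: "int ^ 'd \<Rightarrow> 'a \<Rightarrow> real"
    assume M: "prob_space M" and ind: "prob_space.indep_vars M (\<lambda>_. borel) X UNIV"
      and law: "\<forall>v. distr M borel (X v) = F"
    interpret M: prob_space M by (rule M)
    have X: "X v \<in> borel_measurable M" for v
      using ind by (simp add: M.indep_vars_def)
    have "distr M field_space (\<lambda>\<omega>. \<lambda>v\<in>UNIV. X v \<omega>) = PiM UNIV (\<lambda>v. distr M borel (X v))"
      using ind X by (subst (asm) M.indep_vars_iff_distr_eq_PiM) auto
    then have eq: "distr M field_space (\<lambda>\<omega> v. X v \<omega>) = PiM UNIV (\<lambda>_. F)"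
      using law by (simp add: restrict_UNIV)
    have ae: "AE x in distr M field_space (\<lambda>\<omega> v. X v \<omega>). (\<lambda>n. greedy_weight x n / real n ^ CARD('d)) \<longlonglongrightarrow> G"
      unfolding eq by (rule G)
    have "(\<lambda>\<omega> v. X v \<omega>) \<in> measurable M field_space"
      by (rule measurable_abs_UNIV) (rule X)
    from AE_distrD[OF this ae] show "AE \<omega> in M. (\<lambda>n. greedy_weight (\<lambda>v. X v \<omega>) n / real n ^ CARD('d)) \<longlonglongrightarrow> G"
      .
  qed
qed

end
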